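(* Let $\Lambda$ be an Artin algebra and let $0\to A\xrightarrow{f}B\xrightarrow{g}C\to0$ and $0\to A'\xrightarrow{f'}B'\xrightarrow{g'}A\to0$ be almost split sequences in $\mathrm{mod}\,\Lambda$. Then $$0\to (B'\xrightarrow{g'}A)\xrightarrow{\ \phi\ }(A\xrightarrow{1}A)\oplus(B'\xrightarrow{fg'}B)\xrightarrow{\ \psi\ }(A\xrightarrow{f}B)\to0$$ is an almost split sequence in the morphism category $\mathcal H$ of $\Lambda$, where $\phi$ has components $\begin{bmatrix}g'\\ 1\end{bmatrix}:B'\to A\oplus B'$ and $\begin{bmatrix}1\\ f\end{bmatrix}:A\to A\oplus B$, and $\psi$ has components $\begin{bmatrix}-1&g'\end{bmatrix}:A\oplus B'\to A$ and $\begin{bmatrix}-f&1\end{bmatrix}:A\oplus B\to B$. Further, $(B'\xrightarrow{fg'}B)$ is an indecomposable object of $\mathcal H$.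
   Context: $\mathrm{mod}\,\Lambda$ is the category of finitely generated left $\Lambda$-modules. The morphism category $\mathcal H=H(\Lambda)$ has as objects the maps $(A\xrightarrow{f}B)$ in $\mathrm{mod}\,\Lambda$; a morphism from $(A\xrightarrow{f}B)$ to $(C\xrightarrow{g}D)$ is a pair $(h_1,h_2)$ with $h_1:A\to C$, $h_2:B\to D$, $gh_1=h_2f$. It is an abelian category, equivalent to the category of finitely generated modules over $T_2(\Lambda)=\begin{pmatrix}\Lambda&\Lambda\\ 0&\Lambda\end{pmatrix}$; almost split sequences in $\mathcal H$ are understood via this equivalence. *)

theory Defs
  imports "HOL-Algebra.Module" "HOL-Algebra.Ideal" "HOL-Algebra.RingHom"
begin

section \<open>Left modules over a not necessarily commutative ring\<close>

text \<open>The locale \<^locale>\<open>module\<close> of HOL-Algebra requires a commutative ring of scalars; the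
  following is the same set of axioms over an arbitrary ring. Module records also have fields
  \<^const>\<open>mult\<close> and \<^const>\<open>one\<close>; as in HOL-Algebra, these are ignored.\<close>

locale left_module = R?: ring R + M?: abelian_group M for R (structure) and M (structure) +
  assumes smult_closed:
      "\<lbrakk>a \<in> carrier R; x \<in> carrier M\<rbrakk> \<Longrightarrow> a \<odot>\<^bsub>M\<^esub> x \<in> carrier M"
    and smult_l_distr:
      "\<lbrakk>a \<in> carrier R; b \<in> carrier R; x \<in> carrier M\<rbrakk> \<Longrightarrow>
        (a \<oplus>\<^bsub>R\<^esub> b) \<odot>\<^bsub>M\<^esub> x = a \<odot>\<^bsub>M\<^esub> x \<oplus>\<^bsub>M\<^esub> b \<odot>\<^bsub>M\<^esub> x"
    and smult_r_distr:
      "\<lbrakk>a \<in> carrier R; x \<in> carrier M; y \<in> carrier M\<rbrakk> \<Longrightarrow>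
        a \<odot>\<^bsub>M\<^esub> (x \<oplus>\<^bsub>M\<^esub> y) = a \<odot>\<^bsub>M\<^esub> x \<oplus>\<^bsub>M\<^esub> a \<odot>\<^bsub>M\<^esub> y"
    and smult_assoc1:
      "\<lbrakk>a \<in> carrier R; b \<in> carrier R; x \<in> carrier M\<rbrakk> \<Longrightarrow>
        (a \<otimes>\<^bsub>R\<^esub> b) \<odot>\<^bsub>M\<^esub> x = a \<odot>\<^bsub>M\<^esub> (b \<odot>\<^bsub>M\<^esub> x)"
    and smult_one: "x \<in> carrier M \<Longrightarrow> \<one>\<^bsub>R\<^esub> \<odot>\<^bsub>M\<^esub> x = x"

definition fin_gen :: "('r, 'e) ring_scheme \<Rightarrow> ('r, 'm) module \<Rightarrow> bool" where
  "fin_gen R M \<longleftrightarrow>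
    (\<exists>S. finite S \<and> S \<subseteq> carrier M \<and>
      (\<forall>x\<in>carrier M. \<exists>c\<in>S \<rightarrow> carrier R. x = (\<Oplus>\<^bsub>M\<^esub>s\<in>S. c s \<odot>\<^bsub>M\<^esub> s)))"

definition fg_module :: "('r, 'e) ring_scheme \<Rightarrow> ('r, 'm) module \<Rightarrow> bool" where
  "fg_module R M \<longleftrightarrow> left_module R M \<and> fin_gen R M"

definition lin_hom ::
  "('r, 'e) ring_scheme \<Rightarrow> ('r, 'm) module \<Rightarrow> ('r, 'n) module \<Rightarrow> ('m \<Rightarrow> 'n) set" where
  "lin_hom R M N = {h \<in> carrier M \<rightarrow> carrier N.
    (\<forall>x\<in>carrier M. \<forall>y\<in>carrier M. h (x \<oplus>\<^bsub>M\<^esub> y) = h x \<oplus>\<^bsub>N\<^esub> h y) \<and>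
    (\<forall>a\<in>carrier R. \<forall>x\<in>carrier M. h (a \<odot>\<^bsub>M\<^esub> x) = a \<odot>\<^bsub>N\<^esub> h x)}"

definition dsum :: "('r, 'm) module \<Rightarrow> ('r, 'n) module \<Rightarrow> ('r, 'm \<times> 'n) module" where
  "dsum M N = \<lparr>carrier = carrier M \<times> carrier N,
    mult = (\<lambda>_ _. (\<zero>\<^bsub>M\<^esub>, \<zero>\<^bsub>N\<^esub>)), one = (\<zero>\<^bsub>M\<^esub>, \<zero>\<^bsub>N\<^esub>), zero = (\<zero>\<^bsub>M\<^esub>, \<zero>\<^bsub>N\<^esub>),
    add = (\<lambda>(x, y) (x', y'). (x \<oplus>\<^bsub>M\<^esub> x', y \<oplus>\<^bsub>N\<^esub> y')),
    smult = (\<lambda>a (x, y). (a \<odot>\<^bsub>M\<^esub> x, a \<odot>\<^bsub>N\<^esub> y))\<rparr>"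


section \<open>Artin algebras\<close>

definition artinian_cring :: "('k, 'e) ring_scheme \<Rightarrow> bool" where
  "artinian_cring K \<longleftrightarrow> cring K \<and>
    (\<forall>I :: nat \<Rightarrow> 'k set. (\<forall>n. ideal (I n) K) \<and> (\<forall>n. I (Suc n) \<subseteq> I n) \<longrightarrow>
      (\<exists>n. \<forall>m\<ge>n. I m = I n))"

definition scalars_via :: "('k \<Rightarrow> 'r) \<Rightarrow> ('r, 'e) ring_scheme \<Rightarrow> ('k, 'r) module" where
  "scalars_via \<eta> R = \<lparr>carrier = carrier R, mult = mult R, one = one R, zero = zero R,
    add = add R, smult = (\<lambda>c x. \<eta> c \<otimes>\<^bsub>R\<^esub> x)\<rparr>"

text \<open>The ring \<open>R\<close> is an Artin \<open>K\<close>-algebra with structure map \<open>\<eta>\<close>.\<close>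

definition artin_algebra ::
  "('k, 'd) ring_scheme \<Rightarrow> ('k \<Rightarrow> 'r) \<Rightarrow> ('r, 'e) ring_scheme \<Rightarrow> bool" where
  "artin_algebra K \<eta> R \<longleftrightarrow> artinian_cring K \<and> ring R \<and> \<eta> \<in> ring_hom K R \<and>
    (\<forall>c\<in>carrier K. \<forall>x\<in>carrier R. \<eta> c \<otimes>\<^bsub>R\<^esub> x = x \<otimes>\<^bsub>R\<^esub> \<eta> c) \<and>
    fin_gen K (scalars_via \<eta> R)"


section \<open>Almost split sequences of finitely generated modules\<close>

definition split_mono ::
  "('r, 'e) ring_scheme \<Rightarrow> ('r, 'a) module \<Rightarrow> ('a \<Rightarrow> 'b) \<Rightarrow> ('r, 'b) module \<Rightarrow> bool" where
  "split_mono R A f B \<longleftrightarrow> f \<in> lin_hom R A B \<and>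
    (\<exists>r\<in>lin_hom R B A. \<forall>x\<in>carrier A. r (f x) = x)"

definition split_epi ::
  "('r, 'e) ring_scheme \<Rightarrow> ('r, 'b) module \<Rightarrow> ('b \<Rightarrow> 'c) \<Rightarrow> ('r, 'c) module \<Rightarrow> bool" where
  "split_epi R B g C \<longleftrightarrow> g \<in> lin_hom R B C \<and>
    (\<exists>s\<in>lin_hom R C B. \<forall>z\<in>carrier C. g (s z) = z)"

text \<open>HOL cannot quantify over the carrier types of all modules inside a definition. The test
  modules below, over a ring with elements of type \<open>'r\<close>, therefore have carriers of type
  \<open>(nat \<Rightarrow> 'r) set\<close>. This is no restriction: every finitely generated module is a quotient of a
  free module \<open>R\<^sup>n\<close>, hence isomorphic to a module whose elements are sets of coefficient
  sequences; see \<open>fg_module_representative\<close> below.\<close>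

definition left_almost_split ::
  "('r, 'e) ring_scheme \<Rightarrow> ('r, 'a) module \<Rightarrow> ('a \<Rightarrow> 'b) \<Rightarrow> ('r, 'b) module \<Rightarrow> bool" where
  "left_almost_split R A f B \<longleftrightarrow> f \<in> lin_hom R A B \<and> \<not> split_mono R A f B \<and>
    (\<forall>(X :: ('r, (nat \<Rightarrow> 'r) set) module) u.
      fg_module R X \<and> u \<in> lin_hom R A X \<and> \<not> split_mono R A u X \<longrightarrow>
      (\<exists>v\<in>lin_hom R B X. \<forall>x\<in>carrier A. v (f x) = u x))"

definition right_almost_split ::
  "('r, 'e) ring_scheme \<Rightarrow> ('r, 'b) module \<Rightarrow> ('b \<Rightarrow> 'c) \<Rightarrow> ('r, 'c) module \<Rightarrow> bool" where
  "right_almost_split R B g C \<longleftrightarrow> g \<in> lin_hom R B C \<and> \<not> split_epi R B g C \<and>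
    (\<forall>(X :: ('r, (nat \<Rightarrow> 'r) set) module) u.
      fg_module R X \<and> u \<in> lin_hom R X C \<and> \<not> split_epi R X u C \<longrightarrow>
      (\<exists>v\<in>lin_hom R X B. \<forall>x\<in>carrier X. g (v x) = u x))"

definition short_exact ::
  "('r, 'e) ring_scheme \<Rightarrow> ('r, 'a) module \<Rightarrow> ('a \<Rightarrow> 'b) \<Rightarrow> ('r, 'b) module \<Rightarrow>
    ('b \<Rightarrow> 'c) \<Rightarrow> ('r, 'c) module \<Rightarrow> bool" where
  "short_exact R A f B g C \<longleftrightarrow> f \<in> lin_hom R A B \<and> g \<in> lin_hom R B C \<and>
    inj_on f (carrier A) \<and> f ` carrier A = {y \<in> carrier B. g y = \<zero>\<^bsub>C\<^esub>} \<and>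
    g ` carrier B = carrier C"

text \<open>The sequence \<open>0 \<rightarrow> A \<rightarrow> B \<rightarrow> C \<rightarrow> 0\<close> with maps \<open>f\<close> and \<open>g\<close> is almost split in the category
  of finitely generated left modules.\<close>

definition almost_split ::
  "('r, 'e) ring_scheme \<Rightarrow> ('r, 'a) module \<Rightarrow> ('a \<Rightarrow> 'b) \<Rightarrow> ('r, 'b) module \<Rightarrow>
    ('b \<Rightarrow> 'c) \<Rightarrow> ('r, 'c) module \<Rightarrow> bool" where
  "almost_split R A f B g C \<longleftrightarrow> fg_module R A \<and> fg_module R B \<and> fg_module R C \<and>
    short_exact R A f B g C \<and> left_almost_split R A f B \<and> right_almost_split R B g C"


section \<open>The morphism category\<close>

record ('r, 'a, 'b) mor_obj =
  src :: "('r, 'a) module"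
  tgt :: "('r, 'b) module"
  arr :: "'a \<Rightarrow> 'b"

definition mor_object :: "('r, 'e) ring_scheme \<Rightarrow> ('r, 'a, 'b) mor_obj \<Rightarrow> bool" where
  "mor_object R X \<longleftrightarrow>
    fg_module R (src X) \<and> fg_module R (tgt X) \<and> arr X \<in> lin_hom R (src X) (tgt X)"

definition mor_hom ::
  "('r, 'e) ring_scheme \<Rightarrow> ('r, 'a, 'b) mor_obj \<Rightarrow> ('r, 'c, 'd) mor_obj \<Rightarrow>
    (('a \<Rightarrow> 'c) \<times> ('b \<Rightarrow> 'd)) set" where
  "mor_hom R X Y = {(h1, h2). h1 \<in> lin_hom R (src X) (src Y) \<and> h2 \<in> lin_hom R (tgt X) (tgt Y) \<and>
    (\<forall>x\<in>carrier (src X). arr Y (h1 x) = h2 (arr X x))}"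

definition mor_iso ::
  "('r, 'e) ring_scheme \<Rightarrow> ('r, 'a, 'b) mor_obj \<Rightarrow> ('r, 'c, 'd) mor_obj \<Rightarrow> bool" where
  "mor_iso R X Y \<longleftrightarrow> (\<exists>h1 h2 k1 k2. (h1, h2) \<in> mor_hom R X Y \<and> (k1, k2) \<in> mor_hom R Y X \<and>
    (\<forall>x\<in>carrier (src X). k1 (h1 x) = x) \<and> (\<forall>x\<in>carrier (tgt X). k2 (h2 x) = x) \<and>
    (\<forall>y\<in>carrier (src Y). h1 (k1 y) = y) \<and> (\<forall>y\<in>carrier (tgt Y). h2 (k2 y) = y))"

definition mor_dsum ::
  "('r, 'a, 'b) mor_obj \<Rightarrow> ('r, 'c, 'd) mor_obj \<Rightarrow> ('r, 'a \<times> 'c, 'b \<times> 'd) mor_obj" where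
  "mor_dsum X Y = \<lparr>src = dsum (src X) (src Y), tgt = dsum (tgt X) (tgt Y),
    arr = map_prod (arr X) (arr Y)\<rparr>"

definition mor_zero :: "('r, 'a, 'b) mor_obj \<Rightarrow> bool" where
  "mor_zero X \<longleftrightarrow> carrier (src X) = {\<zero>\<^bsub>src X\<^esub>} \<and> carrier (tgt X) = {\<zero>\<^bsub>tgt X\<^esub>}"

text \<open>The candidate summands range over the same representatives as the test modules above.\<close>

definition mor_indecomposable :: "('r, 'e) ring_scheme \<Rightarrow> ('r, 'a, 'b) mor_obj \<Rightarrow> bool" where
  "mor_indecomposable R X \<longleftrightarrow> mor_object R X \<and> \<not> mor_zero X \<and>
    (\<forall>(Y :: ('r, (nat \<Rightarrow> 'r) set, (nat \<Rightarrow> 'r) set) mor_obj)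
      (Z :: ('r, (nat \<Rightarrow> 'r) set, (nat \<Rightarrow> 'r) set) mor_obj).
      mor_object R Y \<and> mor_object R Z \<and> mor_iso R X (mor_dsum Y Z) \<longrightarrow> mor_zero Y \<or> mor_zero Z)"


section \<open>The equivalence with modules over the triangular matrix ring\<close>

text \<open>The triple \<open>(a, b, c)\<close> stands for the upper triangular matrix with first row \<open>a, b\<close> and
  second row \<open>0, c\<close>.\<close>

definition T2 :: "('r, 'e) ring_scheme \<Rightarrow> ('r \<times> 'r \<times> 'r) ring" where
  "T2 R = \<lparr>carrier = carrier R \<times> carrier R \<times> carrier R,
    mult = (\<lambda>(a, b, c) (a', b', c').
      (a \<otimes>\<^bsub>R\<^esub> a', (a \<otimes>\<^bsub>R\<^esub> b') \<oplus>\<^bsub>R\<^esub> (b \<otimes>\<^bsub>R\<^esub> c'), c \<otimes>\<^bsub>R\<^esub> c')),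
    one = (\<one>\<^bsub>R\<^esub>, \<zero>\<^bsub>R\<^esub>, \<one>\<^bsub>R\<^esub>), zero = (\<zero>\<^bsub>R\<^esub>, \<zero>\<^bsub>R\<^esub>, \<zero>\<^bsub>R\<^esub>),
    add = (\<lambda>(a, b, c) (a', b', c'). (a \<oplus>\<^bsub>R\<^esub> a', b \<oplus>\<^bsub>R\<^esub> b', c \<oplus>\<^bsub>R\<^esub> c'))\<rparr>"

text \<open>An object \<open>A \<rightarrow> B\<close> with map \<open>f\<close> corresponds to the module of column vectors with upper entry
  \<open>y\<close> in \<open>B\<close> and lower entry \<open>x\<close> in \<open>A\<close>; the off-diagonal matrix entry acts through \<open>f\<close>.\<close>

definition T2_module ::
  "('r, 'a, 'b) mor_obj \<Rightarrow> ('r \<times> 'r \<times> 'r, 'b \<times> 'a) module" where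
  "T2_module X = \<lparr>carrier = carrier (tgt X) \<times> carrier (src X),
    mult = (\<lambda>_ _. (\<zero>\<^bsub>tgt X\<^esub>, \<zero>\<^bsub>src X\<^esub>)), one = (\<zero>\<^bsub>tgt X\<^esub>, \<zero>\<^bsub>src X\<^esub>),
    zero = (\<zero>\<^bsub>tgt X\<^esub>, \<zero>\<^bsub>src X\<^esub>),
    add = (\<lambda>(y, x) (y', x'). (y \<oplus>\<^bsub>tgt X\<^esub> y', x \<oplus>\<^bsub>src X\<^esub> x')),
    smult = (\<lambda>(a, b, c) (y, x).
      ((a \<odot>\<^bsub>tgt X\<^esub> y) \<oplus>\<^bsub>tgt X\<^esub> (b \<odot>\<^bsub>tgt X\<^esub> arr X x), c \<odot>\<^bsub>src X\<^esub> x))\<rparr>"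

definition T2_map :: "('a \<Rightarrow> 'c) \<times> ('b \<Rightarrow> 'd) \<Rightarrow> 'b \<times> 'a \<Rightarrow> 'd \<times> 'c" where
  "T2_map h = map_prod (snd h) (fst h)"

text \<open>A sequence in the morphism category is almost split if the corresponding sequence of modules
  over the triangular matrix ring is.\<close>

definition mor_almost_split ::
  "('r, 'e) ring_scheme \<Rightarrow> ('r, 'a, 'b) mor_obj \<Rightarrow> ('a \<Rightarrow> 'c) \<times> ('b \<Rightarrow> 'd) \<Rightarrow>
    ('r, 'c, 'd) mor_obj \<Rightarrow> ('c \<Rightarrow> 'g) \<times> ('d \<Rightarrow> 'h) \<Rightarrow> ('r, 'g, 'h) mor_obj \<Rightarrow> bool" where
  "mor_almost_split R X \<phi> Y \<psi> Z \<longleftrightarrow>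
    mor_object R X \<and> mor_object R Y \<and> mor_object R Z \<and>
    \<phi> \<in> mor_hom R X Y \<and> \<psi> \<in> mor_hom R Y Z \<and>
    almost_split (T2 R) (T2_module X) (T2_map \<phi>) (T2_module Y) (T2_map \<psi>) (T2_module Z)"


section \<open>Adequacy of the definitions\<close>

lemma fg_module_representative:
  fixes R :: "('r, 'e) ring_scheme" and M :: "('r, 'm) module"
  assumes "fg_module R M"
  shows "\<exists>(N :: ('r, (nat \<Rightarrow> 'r) set) module) h k. fg_module R N \<and>
    h \<in> lin_hom R M N \<and> k \<in> lin_hom R N M \<and>
    (\<forall>x\<in>carrier M. k (h x) = x) \<and> (\<forall>y\<in>carrier N. h (k y) = y)"
proof -
  interpret left_module R M using assms by (simp add: fg_module_def)
  obtain S where S: "finite S" "S \<subseteq> carrier M"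
    and gen: "\<And>x. x \<in> carrier M \<Longrightarrow>
      \<exists>c\<in>S \<rightarrow> carrier R. x = (\<Oplus>\<^bsub>M\<^esub>s\<in>S. c s \<odot>\<^bsub>M\<^esub> s)"
    using assms unfolding fg_module_def fin_gen_def by blast
  obtain i :: "'m \<Rightarrow> nat" where i: "inj_on i S"
    using finite_imp_inj_to_nat_seg[OF S(1)] by blast
  define h where "h x = {d :: nat \<Rightarrow> 'r. x = (\<Oplus>\<^bsub>M\<^esub>s\<in>S. d (i s) \<odot>\<^bsub>M\<^esub> s) \<and>
      (\<forall>s\<in>S. d (i s) \<in> carrier R)}" for x
  have ne: "h x \<noteq> {}" if x: "x \<in> carrier M" for x
  proof -
    obtain c where c: "c \<in> S \<rightarrow> carrier R" "x = (\<Oplus>\<^bsub>M\<^esub>s\<in>S. c s \<odot>\<^bsub>M\<^esub> s)"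
      using gen[OF x] by blast
    have "(\<Oplus>\<^bsub>M\<^esub>s\<in>S. c (inv_into S i (i s)) \<odot>\<^bsub>M\<^esub> s) = (\<Oplus>\<^bsub>M\<^esub>s\<in>S. c s \<odot>\<^bsub>M\<^esub> s)"
      using c(1) S(2) i by (intro M.finsum_cong') (auto intro!: smult_closed)
    then have "(\<lambda>n. c (inv_into S i n)) \<in> h x"
      using c i by (auto simp: h_def)
    then show ?thesis by blast
  qed
  have inj: "inj_on h (carrier M)"
  proof (rule inj_onI)
    fix x y assume x: "x \<in> carrier M" and eq: "h x = h y"
    obtain d where "d \<in> h x" using ne[OF x] by blast
    moreover from this have "d \<in> h y" using eq by simp
    ultimately show "x = y" by (simp add: h_def)
  qed
  define k where "k = inv_into (carrier M) h"
  have kh [simp]: "k (h x) = x" if "x \<in> carrier M" for x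
    using that inj by (simp add: k_def)
  define N :: "('r, (nat \<Rightarrow> 'r) set) module" where
    "N = \<lparr>carrier = h ` carrier M, mult = (\<lambda>_ _. h \<zero>\<^bsub>M\<^esub>), one = h \<zero>\<^bsub>M\<^esub>, zero = h \<zero>\<^bsub>M\<^esub>,
      add = (\<lambda>u v. h (k u \<oplus>\<^bsub>M\<^esub> k v)), smult = (\<lambda>a u. h (a \<odot>\<^bsub>M\<^esub> k u))\<rparr>"
  have grp: "abelian_group N"
  proof (rule abelian_groupI)
    fix u assume "u \<in> carrier N"
    then obtain x where "x \<in> carrier M" "u = h x" by (auto simp: N_def)
    then show "\<exists>v\<in>carrier N. v \<oplus>\<^bsub>N\<^esub> u = \<zero>\<^bsub>N\<^esub>"
      by (intro bexI[of _ "h (\<ominus>\<^bsub>M\<^esub> x)"]) (auto simp: N_def M.l_neg)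
  qed (auto simp: N_def M.a_ac)
  have modN: "left_module R N"
    by (intro left_module.intro grp left_module_axioms.intro R.ring_axioms)
       (auto simp: N_def smult_closed smult_l_distr smult_r_distr smult_assoc1 smult_one)
  then interpret N: left_module R N .
  have hN: "h \<in> lin_hom R M N" and kN: "k \<in> lin_hom R N M"
    by (auto simp: lin_hom_def N_def smult_closed)
  have hsum: "h (\<Oplus>\<^bsub>M\<^esub>s\<in>F. g s) = (\<Oplus>\<^bsub>N\<^esub>s\<in>F. h (g s))"
    if "finite F" "g \<in> F \<rightarrow> carrier M" for F and g :: "'m \<Rightarrow> 'm"
    using that
  proof (induction F rule: finite_induct)
    case empty
    have "h \<zero>\<^bsub>M\<^esub> = \<zero>\<^bsub>N\<^esub>" by (simp add: N_def)
    then show ?case by simp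
  next
    case (insert s F)
    have "h (g s \<oplus>\<^bsub>M\<^esub> (\<Oplus>\<^bsub>M\<^esub>t\<in>F. g t)) = h (g s) \<oplus>\<^bsub>N\<^esub> h (\<Oplus>\<^bsub>M\<^esub>t\<in>F. g t)"
      using hN insert.prems by (auto simp: lin_hom_def)
    moreover have "(\<lambda>t. h (g t)) \<in> F \<rightarrow> carrier N" "h (g s) \<in> carrier N"
      using insert.prems by (auto simp: N_def)
    ultimately show ?case
      using insert by (simp add: M.finsum_insert N.finsum_insert)
  qed
  have "fin_gen R N"
    unfolding fin_gen_def
  proof (intro exI[of _ "h ` S"] conjI ballI)
    show "finite (h ` S)" using S by simp
    show "h ` S \<subseteq> carrier N" using S by (auto simp: N_def)
    fix u assume "u \<in> carrier N"
    then obtain x where x: "x \<in> carrier M" "u = h x" by (auto simp: N_def)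
    obtain c where c: "c \<in> S \<rightarrow> carrier R" "x = (\<Oplus>\<^bsub>M\<^esub>s\<in>S. c s \<odot>\<^bsub>M\<^esub> s)"
      using gen[OF x(1)] by blast
    have ck: "(\<lambda>v. c (k v)) \<in> h ` S \<rightarrow> carrier R"
      using c(1) S(2) by (auto simp: subset_iff Pi_iff)
    have "(\<lambda>s. c s \<odot>\<^bsub>M\<^esub> s) \<in> S \<rightarrow> carrier M"
      using c(1) S(2) by (auto simp: smult_closed subset_iff Pi_iff)
    then have "u = (\<Oplus>\<^bsub>N\<^esub>s\<in>S. h (c s \<odot>\<^bsub>M\<^esub> s))"
      using x(2) c(2) hsum[OF S(1), of "\<lambda>s. c s \<odot>\<^bsub>M\<^esub> s"] by simp
    also have "\<dots> = (\<Oplus>\<^bsub>N\<^esub>s\<in>S. c (k (h s)) \<odot>\<^bsub>N\<^esub> h s)"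
      using c(1) S(2) by (intro N.M.finsum_cong') (auto simp: N_def smult_closed subset_iff Pi_iff)
    also have "\<dots> = (\<Oplus>\<^bsub>N\<^esub>v\<in>h ` S. c (k v) \<odot>\<^bsub>N\<^esub> v)"
      using c(1) S(2) ck inj_on_subset[OF inj S(2)]
      by (intro N.M.finsum_reindex[symmetric]) (auto simp: N_def smult_closed subset_iff Pi_iff)
    finally show "\<exists>c\<in>h ` S \<rightarrow> carrier R. u = (\<Oplus>\<^bsub>N\<^esub>v\<in>h ` S. c v \<odot>\<^bsub>N\<^esub> v)"
      using ck by (rule bexI[of _ "\<lambda>v. c (k v)"])
  qed
  then have "fg_module R N" using modN by (simp add: fg_module_def)
  moreover have "\<forall>u\<in>carrier N. h (k u) = u" by (auto simp: N_def)
  ultimately show ?thesis using hN kN kh by blast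
qed

lemma T2_ring:
  assumes "ring R"
  shows "ring (T2 R)"
proof -
  interpret ring R by fact
  have "\<exists>u\<in>carrier (T2 R). u \<oplus>\<^bsub>T2 R\<^esub> t = \<zero>\<^bsub>T2 R\<^esub>" if "t \<in> carrier (T2 R)" for t
    using that
    by (intro bexI[of _ "case t of (a, b, c) \<Rightarrow> (\<ominus>\<^bsub>R\<^esub> a, \<ominus>\<^bsub>R\<^esub> b, \<ominus>\<^bsub>R\<^esub> c)"])
       (auto simp: T2_def l_neg)
  then have "abelian_group (T2 R)"
    by (intro abelian_groupI) (auto simp: T2_def a_ac)
  moreover have "Group.monoid (T2 R)"
    by (intro monoidI) (auto simp: T2_def m_assoc a_assoc l_distr r_distr)
  ultimately show ?thesis
  proof (rule ringI)
  qed (auto simp: T2_def l_distr r_distr a_ac)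
qed

lemma T2_module_left_module:
  assumes "mor_object R X"
  shows "left_module (T2 R) (T2_module X)"
proof -
  interpret A: left_module R "src X" using assms by (simp add: mor_object_def fg_module_def)
  interpret B: left_module R "tgt X" using assms by (simp add: mor_object_def fg_module_def)
  have arr: "arr X x \<in> carrier (tgt X)"
    "arr X (x \<oplus>\<^bsub>src X\<^esub> x') = arr X x \<oplus>\<^bsub>tgt X\<^esub> arr X x'"
    "a \<in> carrier R \<Longrightarrow> arr X (a \<odot>\<^bsub>src X\<^esub> x) = a \<odot>\<^bsub>tgt X\<^esub> arr X x"
    if "x \<in> carrier (src X)" "x' \<in> carrier (src X)" for a x x'
    using assms that by (auto simp: mor_object_def lin_hom_def)
  have zero: "\<zero>\<^bsub>R\<^esub> \<odot>\<^bsub>tgt X\<^esub> y = \<zero>\<^bsub>tgt X\<^esub>" if "y \<in> carrier (tgt X)" for y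
    using B.smult_l_distr[of "\<zero>\<^bsub>R\<^esub>" "\<zero>\<^bsub>R\<^esub>" y] that
    by (simp add: B.smult_closed B.M.add.l_cancel_one')
  have "\<exists>u\<in>carrier (T2_module X). u \<oplus>\<^bsub>T2_module X\<^esub> t = \<zero>\<^bsub>T2_module X\<^esub>"
    if "t \<in> carrier (T2_module X)" for t
    using that
    by (intro bexI[of _ "case t of (y, x) \<Rightarrow> (\<ominus>\<^bsub>tgt X\<^esub> y, \<ominus>\<^bsub>src X\<^esub> x)"])
       (auto simp: T2_module_def A.M.l_neg B.M.l_neg)
  then have "abelian_group (T2_module X)"
    by (intro abelian_groupI) (auto simp: T2_module_def A.M.a_ac B.M.a_ac)
  then show ?thesis
    by (intro left_module.intro left_module_axioms.intro T2_ring A.R.ring_axioms)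
       (auto simp: T2_module_def T2_def A.smult_closed B.smult_closed arr zero
         A.smult_l_distr B.smult_l_distr A.smult_r_distr B.smult_r_distr
         A.smult_assoc1 B.smult_assoc1 A.smult_one B.smult_one B.M.a_ac)
qed

end

theory Submission
  imports Defs
begin

text \<open>A homomorphism \<open>(h1, h2)\<close> from \<open>x : X1 \<rightarrow> X2\<close> to \<open>f : A \<rightarrow> B\<close> lifts along \<open>\<psi>\<close> exactly if \<open>h1 + r x\<close>
  factors through \<open>g'\<close>, that is, fails to be a split epimorphism, for some \<open>r : X2 \<rightarrow> A\<close>. If there is
  no such \<open>r\<close>, then the descending chain condition, which finitely generated modules over an Artin
  algebra satisfy, gives a section \<open>s\<close> of \<open>h1\<close> such that \<open>x s\<close> is not a split monomorphism. Hence \<open>x s\<close>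
  extends along \<open>f\<close>, and left minimality of \<open>f\<close> turns the extension into a section of \<open>(h1, h2)\<close>.
  Extensions along \<open>\<phi>\<close> are dual. An idempotent of \<open>f g' : B' \<rightarrow> B\<close> induces one of \<open>A\<close>, the image of
  \<open>f g'\<close>; the latter is \<open>0\<close> or \<open>1\<close>, and minimality of \<open>f\<close> and \<open>g'\<close> then forces the former to be
  \<open>0\<close> or \<open>1\<close>.\<close>


section \<open>Homomorphisms\<close>

text \<open>The lifting criterion comes from the identity summand: a morphism from \<open>x\<close>
  to the identity of \<open>A\<close> is the same as a map \<open>r\<close> from \<open>X2\<close>
  to \<open>A\<close>, its source component being \<open>r x\<close>. Once \<open>r\<close> is
  chosen, the target equation for \<open>\<psi>\<close> forces the component
  \<open>h2 + f r\<close>, and only \<open>g' q = h1 + r x\<close> remains to be solved for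
  \<open>q\<close>. The obstacle is that one correction need not be enough. If \<open>h1\<close> has
  a section \<open>s\<close> and \<open>x s\<close> has a retraction \<open>p\<close>, then
  \<open>r = - p\<close> kills the copy \<open>s(A)\<close>, but \<open>h1 - p x\<close> may still
  be a split epimorphism because of another copy of \<open>A\<close> in \<open>X1\<close>. Copies
  are split off until none is left; the chain condition ends this, and it is where the Artin
  hypothesis enters. Local endomorphism rings are replaced by a direct argument: almost splitness
  makes every \<open>1 - g e\<close> invertible and every \<open>1 - e f\<close> left invertible.
  From this follow minimality, the triviality of idempotents, and that neither \<open>\<phi>\<close>
  nor \<open>\<psi>\<close> splits.\<close>

lemma (in left_module) smult_zero:
  assumes "x \<in> carrier M"
  shows "\<zero>\<^bsub>R\<^esub> \<odot>\<^bsub>M\<^esub> x = \<zero>\<^bsub>M\<^esub>"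
  using smult_l_distr[of "\<zero>\<^bsub>R\<^esub>" "\<zero>\<^bsub>R\<^esub>" x] assms
  by (simp add: smult_closed M.add.l_cancel_one')

lemma (in left_module) smult_r_zero:
  assumes "a \<in> carrier R"
  shows "a \<odot>\<^bsub>M\<^esub> \<zero>\<^bsub>M\<^esub> = \<zero>\<^bsub>M\<^esub>"
  using smult_r_distr[of a "\<zero>\<^bsub>M\<^esub>" "\<zero>\<^bsub>M\<^esub>"] assms
  by (simp add: smult_closed M.add.l_cancel_one')

lemma (in left_module) smult_r_neg:
  assumes "a \<in> carrier R" "x \<in> carrier M"
  shows "a \<odot>\<^bsub>M\<^esub> (\<ominus>\<^bsub>M\<^esub> x) = \<ominus>\<^bsub>M\<^esub> (a \<odot>\<^bsub>M\<^esub> x)"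
  using smult_r_distr[of a x "\<ominus>\<^bsub>M\<^esub> x"] assms
  by (metis M.add.inv_closed M.minus_equality M.add.m_comm M.r_neg smult_closed smult_r_zero)

lemma (in left_module) smult_l_neg_one:
  assumes "x \<in> carrier M"
  shows "(\<ominus>\<^bsub>R\<^esub> \<one>\<^bsub>R\<^esub>) \<odot>\<^bsub>M\<^esub> x = \<ominus>\<^bsub>M\<^esub> x"
  using smult_l_distr[of "\<ominus>\<^bsub>R\<^esub> \<one>\<^bsub>R\<^esub>" "\<one>\<^bsub>R\<^esub>" x] assms
  by (metis M.minus_equality R.add.inv_closed R.l_neg R.one_closed smult_closed smult_one smult_zero)

lemma (in abelian_group) minus_self: "x \<in> carrier G \<Longrightarrow> x \<ominus> x = \<zero>"
  by (simp add: minus_eq r_neg)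

lemma (in abelian_group) minus_add_cancel:
  "\<lbrakk>x \<in> carrier G; y \<in> carrier G\<rbrakk> \<Longrightarrow> (x \<ominus> y) \<oplus> y = x"
  by (simp add: minus_eq a_assoc l_neg)

lemma (in abelian_group) minus_eq_iff:
  "\<lbrakk>x \<in> carrier G; y \<in> carrier G; z \<in> carrier G\<rbrakk> \<Longrightarrow> x \<ominus> y = z \<longleftrightarrow> x = z \<oplus> y"
  by (auto simp: minus_add_cancel) (simp add: minus_eq a_assoc r_neg)

lemma lin_hom_rules:
  assumes M: "left_module R M" and N: "left_module R N" and f: "f \<in> lin_hom R M N"
  shows lin_hom_closed: "x \<in> carrier M \<Longrightarrow> f x \<in> carrier N"
    and lin_hom_add: "\<lbrakk>x \<in> carrier M; y \<in> carrier M\<rbrakk> \<Longrightarrow> f (x \<oplus>\<^bsub>M\<^esub> y) = f x \<oplus>\<^bsub>N\<^esub> f y"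
    and lin_hom_smult: "\<lbrakk>a \<in> carrier R; x \<in> carrier M\<rbrakk> \<Longrightarrow> f (a \<odot>\<^bsub>M\<^esub> x) = a \<odot>\<^bsub>N\<^esub> f x"
    and lin_hom_zero: "f \<zero>\<^bsub>M\<^esub> = \<zero>\<^bsub>N\<^esub>"
    and lin_hom_neg: "x \<in> carrier M \<Longrightarrow> f (\<ominus>\<^bsub>M\<^esub> x) = \<ominus>\<^bsub>N\<^esub> f x"
    and lin_hom_minus: "\<lbrakk>x \<in> carrier M; y \<in> carrier M\<rbrakk> \<Longrightarrow> f (x \<ominus>\<^bsub>M\<^esub> y) = f x \<ominus>\<^bsub>N\<^esub> f y"
proof -
  interpret M: left_module R M by (fact M)
  interpret N: left_module R N by (fact N)
  show closed: "x \<in> carrier M \<Longrightarrow> f x \<in> carrier N"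
    and add: "\<lbrakk>x \<in> carrier M; y \<in> carrier M\<rbrakk> \<Longrightarrow> f (x \<oplus>\<^bsub>M\<^esub> y) = f x \<oplus>\<^bsub>N\<^esub> f y"
    and "\<lbrakk>a \<in> carrier R; x \<in> carrier M\<rbrakk> \<Longrightarrow> f (a \<odot>\<^bsub>M\<^esub> x) = a \<odot>\<^bsub>N\<^esub> f x" for a x y
    using f by (auto simp: lin_hom_def)
  show zero: "f \<zero>\<^bsub>M\<^esub> = \<zero>\<^bsub>N\<^esub>"
    using add[of "\<zero>\<^bsub>M\<^esub>" "\<zero>\<^bsub>M\<^esub>"] by (simp add: closed N.M.add.l_cancel_one')
  show neg: "f (\<ominus>\<^bsub>M\<^esub> x) = \<ominus>\<^bsub>N\<^esub> f x" if "x \<in> carrier M" for x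
    using add[of "\<ominus>\<^bsub>M\<^esub> x" x] that
    by (metis M.M.l_neg M.M.a_inv_closed N.M.minus_equality closed zero)
  show "f (x \<ominus>\<^bsub>M\<^esub> y) = f x \<ominus>\<^bsub>N\<^esub> f y" if "x \<in> carrier M" "y \<in> carrier M" for x y
    using that by (simp add: a_minus_def add neg)
qed

lemma lin_hom_ident: "(\<lambda>x. x) \<in> lin_hom R M M"
  by (simp add: lin_hom_def)

lemma lin_hom_comp:
  "u \<in> lin_hom R M N \<Longrightarrow> v \<in> lin_hom R N P \<Longrightarrow> (\<lambda>x. v (u x)) \<in> lin_hom R M P"
  by (auto simp: lin_hom_def Pi_iff)

lemma lin_hom_const_zero:
  assumes "left_module R N"
  shows "(\<lambda>x. \<zero>\<^bsub>N\<^esub>) \<in> lin_hom R M N"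
proof -
  interpret N: left_module R N by fact
  show ?thesis by (simp add: lin_hom_def N.smult_r_zero)
qed

lemma lin_hom_plus:
  assumes "left_module R N" "u \<in> lin_hom R M N" "v \<in> lin_hom R M N"
  shows "(\<lambda>x. u x \<oplus>\<^bsub>N\<^esub> v x) \<in> lin_hom R M N"
proof -
  interpret N: left_module R N by fact
  show ?thesis using assms(2,3) by (auto simp: lin_hom_def Pi_iff N.smult_r_distr N.M.a_ac)
qed

lemma lin_hom_uminus:
  assumes "left_module R N" "u \<in> lin_hom R M N"
  shows "(\<lambda>x. \<ominus>\<^bsub>N\<^esub> u x) \<in> lin_hom R M N"
proof -
  interpret N: left_module R N by fact
  show ?thesis using assms(2) by (auto simp: lin_hom_def Pi_iff N.smult_r_neg N.M.minus_add)
qed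

lemma lin_hom_diff:
  assumes "left_module R N" "u \<in> lin_hom R M N" "v \<in> lin_hom R M N"
  shows "(\<lambda>x. u x \<ominus>\<^bsub>N\<^esub> v x) \<in> lin_hom R M N"
  using lin_hom_plus[OF assms(1,2) lin_hom_uminus[OF assms(1,3)]] by (simp add: a_minus_def)

lemmas lin_hom_intros =
  lin_hom_ident lin_hom_const_zero lin_hom_plus lin_hom_uminus lin_hom_diff

lemma fg_left_module: "fg_module R M \<Longrightarrow> left_module R M"
  by (simp add: fg_module_def)

lemma hom_factors_through_epi:
  assumes M: "left_module R M" and N: "left_module R N" and P: "left_module R P"
    and g: "g \<in> lin_hom R M N" and h: "h \<in> lin_hom R M P" and surj: "g ` carrier M = carrier N"
    and ker: "\<And>x. x \<in> carrier M \<Longrightarrow> g x = \<zero>\<^bsub>N\<^esub> \<Longrightarrow> h x = \<zero>\<^bsub>P\<^esub>"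
  shows "\<exists>e\<in>lin_hom R N P. \<forall>x\<in>carrier M. e (g x) = h x"
proof -
  interpret M: left_module R M by (fact M)
  interpret N: left_module R N by (fact N)
  interpret P: left_module R P by (fact P)
  note [simp] = lin_hom_rules[OF M N g] lin_hom_rules[OF M P h] M.smult_closed
  define e where "e z = h (inv_into (carrier M) g z)" for z
  have eg [simp]: "e (g x) = h x" if x: "x \<in> carrier M" for x
  proof -
    define y where "y = inv_into (carrier M) g (g x)"
    have y [simp]: "y \<in> carrier M" "g y = g x"
      using x by (auto simp: y_def intro: inv_into_into f_inv_into_f)
    have "h (y \<ominus>\<^bsub>M\<^esub> x) = \<zero>\<^bsub>P\<^esub>" using x by (intro ker) (auto simp: N.M.minus_self)
    then have "h y = h x" using x by (simp add: P.M.minus_eq_iff)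
    then show ?thesis using x by (simp add: e_def y_def[symmetric])
  qed
  have im: "\<exists>x\<in>carrier M. z = g x" if "z \<in> carrier N" for z
    using that surj by blast
  have "e \<in> lin_hom R N P"
    unfolding lin_hom_def
  proof (intro CollectI conjI ballI funcsetI)
    fix z assume "z \<in> carrier N"
    then show "e z \<in> carrier P" using im by fastforce
  next
    fix z w assume "z \<in> carrier N" "w \<in> carrier N"
    then obtain x y where "x \<in> carrier M" "z = g x" "y \<in> carrier M" "w = g y" using im by blast
    then show "e (z \<oplus>\<^bsub>N\<^esub> w) = e z \<oplus>\<^bsub>P\<^esub> e w"
      using eg[of "x \<oplus>\<^bsub>M\<^esub> y"] by simp
  next
    fix a z assume "a \<in> carrier R" "z \<in> carrier N"
    moreover from this obtain x where "x \<in> carrier M" "z = g x" using im by blast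
    ultimately show "e (a \<odot>\<^bsub>N\<^esub> z) = a \<odot>\<^bsub>P\<^esub> e z"
      using eg[of "a \<odot>\<^bsub>M\<^esub> x"] by simp
  qed
  then show ?thesis using eg by blast
qed

lemma hom_factors_through_mono:
  assumes M: "left_module R M" and N: "left_module R N" and P: "left_module R P"
    and f: "f \<in> lin_hom R M N" and h: "h \<in> lin_hom R P N" and inj: "inj_on f (carrier M)"
    and im: "h ` carrier P \<subseteq> f ` carrier M"
  shows "\<exists>e\<in>lin_hom R P M. \<forall>x\<in>carrier P. f (e x) = h x"
proof -
  interpret M: left_module R M by (fact M)
  interpret P: left_module R P by (fact P)
  note [simp] = lin_hom_rules[OF M N f] lin_hom_rules[OF P N h] M.smult_closed P.smult_closed
  define e where "e z = inv_into (carrier M) f (h z)" for z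
  have h_im: "h z \<in> f ` carrier M" if "z \<in> carrier P" for z
    using that im by blast
  have fe: "f (e z) = h z" if "z \<in> carrier P" for z
    using h_im[OF that] unfolding e_def by (rule f_inv_into_f)
  have ec: "e z \<in> carrier M" if "z \<in> carrier P" for z
    using h_im[OF that] unfolding e_def by (rule inv_into_into)
  have "e \<in> lin_hom R P M"
    unfolding lin_hom_def
  proof (intro CollectI conjI ballI funcsetI)
    fix x y assume "x \<in> carrier P" "y \<in> carrier P"
    then show "e (x \<oplus>\<^bsub>P\<^esub> y) = e x \<oplus>\<^bsub>M\<^esub> e y"
      by (intro inj_onD[OF inj]) (simp_all add: fe ec)
  next
    fix a x assume "a \<in> carrier R" "x \<in> carrier P"
    then show "e (a \<odot>\<^bsub>P\<^esub> x) = a \<odot>\<^bsub>M\<^esub> e x"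
      by (intro inj_onD[OF inj]) (simp_all add: fe ec)
  qed (simp add: ec)
  then show ?thesis using fe by blast
qed



section \<open>Almost split maps\<close>

text \<open>Frees the test module from the fixed carrier type of the definition: \<open>X\<close> is
  moved to an isomorphic module \<open>N\<close> of that type, and a section \<open>s\<close> of
  \<open>u k\<close> would give the section \<open>k s\<close> of \<open>u\<close>.\<close>

lemma right_almost_split_lift:
  assumes g: "right_almost_split R B g C" and X: "fg_module R X"
    and u: "u \<in> lin_hom R X C" "\<not> split_epi R X u C"
  shows "\<exists>v\<in>lin_hom R X B. \<forall>x\<in>carrier X. g (v x) = u x"
proof -
  obtain N :: "('a, (nat \<Rightarrow> 'a) set) module" and h k where N: "fg_module R N"
    and h: "h \<in> lin_hom R X N" and k: "k \<in> lin_hom R N X"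
    and kh: "\<forall>x\<in>carrier X. k (h x) = x"
    using fg_module_representative[OF X] by blast
  have hc: "h x \<in> carrier N" if "x \<in> carrier X" for x using h that by (auto simp: lin_hom_def)
  have "\<not> split_epi R N (\<lambda>y. u (k y)) C"
  proof
    assume "split_epi R N (\<lambda>y. u (k y)) C"
    then obtain s where s: "s \<in> lin_hom R C N" "\<forall>z\<in>carrier C. u (k (s z)) = z"
      by (auto simp: split_epi_def)
    then have "split_epi R X u C"
      using u(1) by (auto simp: split_epi_def intro!: bexI[OF _ lin_hom_comp[OF s(1) k]])
    with u(2) show False ..
  qed
  then obtain v where v: "v \<in> lin_hom R N B" "\<forall>y\<in>carrier N. g (v y) = u (k y)"
    using g N lin_hom_comp[OF k u(1)] unfolding right_almost_split_def by blast
  show ?thesis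
    by (intro bexI[OF _ lin_hom_comp[OF h v(1)]] ballI) (simp add: v(2) hc kh)
qed

text \<open>The same transport for extensions: a retraction \<open>r\<close> of \<open>h u\<close>
  would give the retraction \<open>r h\<close> of \<open>u\<close>.\<close>

lemma left_almost_split_extend:
  assumes f: "left_almost_split R A f B" and X: "fg_module R X"
    and u: "u \<in> lin_hom R A X" "\<not> split_mono R A u X"
  shows "\<exists>v\<in>lin_hom R B X. \<forall>x\<in>carrier A. v (f x) = u x"
proof -
  obtain N :: "('a, (nat \<Rightarrow> 'a) set) module" and h k where N: "fg_module R N"
    and h: "h \<in> lin_hom R X N" and k: "k \<in> lin_hom R N X"
    and kh: "\<forall>x\<in>carrier X. k (h x) = x"
    using fg_module_representative[OF X] by blast
  have uc: "u x \<in> carrier X" if "x \<in> carrier A" for x using u(1) that by (auto simp: lin_hom_def)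
  have "\<not> split_mono R A (\<lambda>y. h (u y)) N"
  proof
    assume "split_mono R A (\<lambda>y. h (u y)) N"
    then obtain r where r: "r \<in> lin_hom R N A" "\<forall>z\<in>carrier A. r (h (u z)) = z"
      by (auto simp: split_mono_def)
    then have "split_mono R A u X"
      using u(1) by (auto simp: split_mono_def intro!: bexI[OF _ lin_hom_comp[OF h r(1)]])
    with u(2) show False ..
  qed
  then obtain v where v: "v \<in> lin_hom R B N" "\<forall>y\<in>carrier A. v (f y) = h (u y)"
    using f N lin_hom_comp[OF u(1) h] unfolding left_almost_split_def by blast
  show ?thesis
    by (intro bexI[OF _ lin_hom_comp[OF v(1) k]] ballI) (simp add: v(2) uc kh)
qed

text \<open>If some \<open>1 - g d\<close> were not a split epimorphism, it would be
  \<open>g w\<close>, and \<open>w + d\<close> would split \<open>g\<close>. So all maps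
  \<open>1 - g d\<close> have right inverses. A right inverse \<open>k\<close> of
  \<open>1 - g e\<close> is again of this form, hence has a right inverse itself, which makes
  \<open>k\<close> a two-sided inverse.\<close>

lemma right_almost_split_one_minus:
  assumes R: "right_almost_split R B g C" and B: "left_module R B" and C: "fg_module R C"
    and e: "e \<in> lin_hom R C B"
  shows "\<exists>k\<in>lin_hom R C C. \<forall>z\<in>carrier C. k z \<ominus>\<^bsub>C\<^esub> g (e (k z)) = z \<and> k (z \<ominus>\<^bsub>C\<^esub> g (e z)) = z"
proof -
  have Cm: "left_module R C" using C by (rule fg_left_module)
  interpret B: left_module R B by (fact B)
  interpret C: left_module R C by (fact Cm)
  have g: "g \<in> lin_hom R B C" and ng: "\<not> split_epi R B g C"
    using R by (auto simp: right_almost_split_def)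
  note g_simps = lin_hom_rules[OF B Cm g]
  have right_inv: "\<exists>k\<in>lin_hom R C C. \<forall>z\<in>carrier C. k z \<ominus>\<^bsub>C\<^esub> g (d (k z)) = z"
    if d: "d \<in> lin_hom R C B" for d
  proof -
    note d_simps = lin_hom_rules[OF Cm B d]
    have u: "(\<lambda>z. z \<ominus>\<^bsub>C\<^esub> g (d z)) \<in> lin_hom R C C"
      by (intro lin_hom_intros Cm lin_hom_comp[OF d g])
    have "split_epi R C (\<lambda>z. z \<ominus>\<^bsub>C\<^esub> g (d z)) C"
    proof (rule ccontr)
      assume "\<not> ?thesis"
      then obtain w where w: "w \<in> lin_hom R C B" "\<forall>z\<in>carrier C. g (w z) = z \<ominus>\<^bsub>C\<^esub> g (d z)"
        using right_almost_split_lift[OF R C u] by blast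
      have "\<forall>z\<in>carrier C. g (w z \<oplus>\<^bsub>B\<^esub> d z) = z"
        using w by (simp add: g_simps d_simps lin_hom_rules[OF Cm B w(1)] C.M.minus_add_cancel)
      then have "split_epi R B g C"
        unfolding split_epi_def by (intro conjI g bexI[OF _ lin_hom_plus[OF B w(1) d]])
      with ng show False ..
    qed
    then show ?thesis by (auto simp: split_epi_def)
  qed
  obtain k where k: "k \<in> lin_hom R C C" "\<forall>z\<in>carrier C. k z \<ominus>\<^bsub>C\<^esub> g (e (k z)) = z"
    using right_inv[OF e] by blast
  note k_simps = lin_hom_rules[OF Cm Cm k(1)] and e_simps = lin_hom_rules[OF Cm B e]
  \<comment> \<open>From \<open>(1 - g e) k = 1\<close> one reads off \<open>k = 1 - g d\<close>
    with \<open>d = - e k\<close>, so \<open>right_inv\<close> applies a second time and gives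
    \<open>k l = 1\<close>; then \<open>l\<close> and \<open>1 - g e\<close> coincide.\<close>
  have "(\<lambda>z. \<ominus>\<^bsub>B\<^esub> e (k z)) \<in> lin_hom R C B"
    by (intro lin_hom_intros B lin_hom_comp[OF k(1) e])
  then obtain l where l: "l \<in> lin_hom R C C"
    "\<forall>z\<in>carrier C. l z \<ominus>\<^bsub>C\<^esub> g (\<ominus>\<^bsub>B\<^esub> e (k (l z))) = z"
    using right_inv by blast
  note l_simps = lin_hom_rules[OF Cm Cm l(1)]
  have k_eq: "k z = z \<oplus>\<^bsub>C\<^esub> g (e (k z))" if "z \<in> carrier C" for z
    using k(2) that by (simp add: C.M.minus_eq_iff g_simps e_simps k_simps)
  have kl: "k (l z) = z" if "z \<in> carrier C" for z
    using l(2) k_eq[of "l z"] that by (simp add: a_minus_def g_simps e_simps k_simps l_simps)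
  have "k (z \<ominus>\<^bsub>C\<^esub> g (e z)) = z" if z: "z \<in> carrier C" for z
  proof -
    have "z \<ominus>\<^bsub>C\<^esub> g (e z) = l z"
      using k(2) z kl[OF z] by (metis l_simps(1))
    then show ?thesis using kl[OF z] by simp
  qed
  with k show ?thesis by blast
qed

text \<open>If \<open>1 - e f\<close> were not a split monomorphism, it would be \<open>w f\<close>,
  and \<open>w + e\<close> would be a retraction of \<open>f\<close>. A left inverse is all that
  right minimality asks for.\<close>

lemma left_almost_split_one_minus:
  assumes L: "left_almost_split R A f B" and A: "fg_module R A" and B: "left_module R B"
    and e: "e \<in> lin_hom R B A"
  shows "\<exists>k\<in>lin_hom R A A. \<forall>x\<in>carrier A. k (x \<ominus>\<^bsub>A\<^esub> e (f x)) = x"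
proof -
  have Am: "left_module R A" using A by (rule fg_left_module)
  interpret A: left_module R A by (fact Am)
  interpret B: left_module R B by (fact B)
  have f: "f \<in> lin_hom R A B" and nf: "\<not> split_mono R A f B"
    using L by (auto simp: left_almost_split_def)
  note f_simps = lin_hom_rules[OF Am B f] and e_simps = lin_hom_rules[OF B Am e]
  have u: "(\<lambda>x. x \<ominus>\<^bsub>A\<^esub> e (f x)) \<in> lin_hom R A A"
    by (intro lin_hom_intros Am lin_hom_comp[OF f e])
  have "split_mono R A (\<lambda>x. x \<ominus>\<^bsub>A\<^esub> e (f x)) A"
  proof (rule ccontr)
    assume "\<not> ?thesis"
    then obtain w where w: "w \<in> lin_hom R B A" "\<forall>x\<in>carrier A. w (f x) = x \<ominus>\<^bsub>A\<^esub> e (f x)"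
      using left_almost_split_extend[OF L A u] by blast
    have "\<forall>x\<in>carrier A. w (f x) \<oplus>\<^bsub>A\<^esub> e (f x) = x"
      using w by (simp add: f_simps e_simps A.M.minus_add_cancel)
    then have "split_mono R A f B"
      unfolding split_mono_def by (intro conjI f bexI[OF _ lin_hom_plus[OF Am w(1) e]])
    with nf show False ..
  qed
  then show ?thesis by (auto simp: split_mono_def)
qed

text \<open>An endomorphism \<open>h\<close> fixing \<open>f\<close> is \<open>1 - e g\<close>, and if \<open>k\<close> is inverse to \<open>1 - g e\<close> then
  \<open>1 + e k g\<close> is inverse to \<open>1 - e g\<close>.\<close>

lemma almost_split_left_minimal:
  assumes S: "almost_split R A f B g C" and h: "h \<in> lin_hom R B B"
    and hf: "\<And>x. x \<in> carrier A \<Longrightarrow> h (f x) = f x"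
  shows "\<exists>k\<in>lin_hom R B B. (\<forall>y\<in>carrier B. h (k y) = y) \<and> (\<forall>x\<in>carrier A. k (f x) = f x)"
proof -
  have C: "fg_module R C" and mods: "left_module R A" "left_module R B" "left_module R C"
    and R: "right_almost_split R B g C" and ex: "short_exact R A f B g C"
    using S by (auto simp: almost_split_def fg_module_def)
  interpret A: left_module R A by (fact mods)
  interpret B: left_module R B by (fact mods)
  interpret C: left_module R C by (fact mods)
  have f: "f \<in> lin_hom R A B" and g: "g \<in> lin_hom R B C" and surj: "g ` carrier B = carrier C"
    and ker: "f ` carrier A = {y \<in> carrier B. g y = \<zero>\<^bsub>C\<^esub>}"
    using ex by (auto simp: short_exact_def)
  note simps = lin_hom_rules[OF mods(1,2) f] lin_hom_rules[OF mods(2,3) g]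
    lin_hom_rules[OF mods(2,2) h]
  have gf: "g (f x) = \<zero>\<^bsub>C\<^esub>" if "x \<in> carrier A" for x using ker that by blast
  have d: "(\<lambda>y. y \<ominus>\<^bsub>B\<^esub> h y) \<in> lin_hom R B B" by (intro lin_hom_intros mods h)
  have "y \<ominus>\<^bsub>B\<^esub> h y = \<zero>\<^bsub>B\<^esub>" if "y \<in> carrier B" "g y = \<zero>\<^bsub>C\<^esub>" for y
  proof -
    have "y \<in> f ` carrier A" using that by (simp add: ker)
    then obtain x where "x \<in> carrier A" "y = f x" by blast
    then show ?thesis using hf by (simp add: simps B.M.minus_self)
  qed
  then obtain e where e: "e \<in> lin_hom R C B" "\<forall>y\<in>carrier B. e (g y) = y \<ominus>\<^bsub>B\<^esub> h y"
    using hom_factors_through_epi[OF mods(2,3,2) g d surj] by blast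
  obtain k where k: "k \<in> lin_hom R C C" "\<forall>z\<in>carrier C. k z \<ominus>\<^bsub>C\<^esub> g (e (k z)) = z"
    using right_almost_split_one_minus[OF R mods(2) C e(1)] by blast
  note simps = simps lin_hom_rules[OF mods(3,2) e(1)] lin_hom_rules[OF mods(3,3) k(1)]
  have h_eq: "h y = y \<ominus>\<^bsub>B\<^esub> e (g y)" if y: "y \<in> carrier B" for y
  proof -
    have "y = h y \<oplus>\<^bsub>B\<^esub> e (g y)"
      using y by (subst B.M.add.m_comm) (simp_all add: simps e(2) B.M.minus_add_cancel)
    then have "y \<ominus>\<^bsub>B\<^esub> e (g y) = h y"
      by (rule B.M.minus_eq_iff[THEN iffD2, rotated 3]) (simp_all add: simps y)
    then show ?thesis ..
  qed
  show ?thesis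
  proof (intro bexI conjI ballI)
    show "(\<lambda>y. y \<oplus>\<^bsub>B\<^esub> e (k (g y))) \<in> lin_hom R B B"
      by (intro lin_hom_intros mods lin_hom_comp[OF lin_hom_comp[OF g k(1)] e(1)])
  next
    fix y assume y: "y \<in> carrier B"
    have "k (g y) = g y \<oplus>\<^bsub>C\<^esub> g (e (k (g y)))"
      using k(2) y by (simp add: C.M.minus_eq_iff simps)
    then have "e (k (g y)) = e (g (y \<oplus>\<^bsub>B\<^esub> e (k (g y))))"
      using y by (simp add: simps)
    then show "h (y \<oplus>\<^bsub>B\<^esub> e (k (g y))) = y"
      using y by (subst h_eq) (simp_all add: simps B.M.minus_eq_iff)
  next
    fix x assume "x \<in> carrier A"
    then show "f x \<oplus>\<^bsub>B\<^esub> e (k (g (f x))) = f x" by (simp add: gf simps)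
  qed
qed

text \<open>Since \<open>g\<close> annihilates \<open>1 - h\<close>, this map lands in the image of
  \<open>f\<close>, so \<open>h = 1 - f e\<close>. If \<open>k\<close> is a left inverse of
  \<open>1 - e f\<close>, then \<open>1 + f k e\<close> is a left inverse of \<open>1 - f e\<close>,
  and it does not change \<open>g\<close> because \<open>g f = 0\<close>.\<close>

lemma almost_split_right_minimal:
  assumes S: "almost_split R A f B g C" and h: "h \<in> lin_hom R B B"
    and gh: "\<And>y. y \<in> carrier B \<Longrightarrow> g (h y) = g y"
  shows "\<exists>k\<in>lin_hom R B B. (\<forall>y\<in>carrier B. k (h y) = y) \<and> (\<forall>y\<in>carrier B. g (k y) = g y)"
proof -
  have A: "fg_module R A" and mods: "left_module R A" "left_module R B" "left_module R C"
    and L: "left_almost_split R A f B" and ex: "short_exact R A f B g C"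
    using S by (auto simp: almost_split_def fg_module_def)
  interpret A: left_module R A by (fact mods)
  interpret B: left_module R B by (fact mods)
  interpret C: left_module R C by (fact mods)
  have f: "f \<in> lin_hom R A B" and g: "g \<in> lin_hom R B C" and inj: "inj_on f (carrier A)"
    and ker: "f ` carrier A = {y \<in> carrier B. g y = \<zero>\<^bsub>C\<^esub>}"
    using ex by (auto simp: short_exact_def)
  note simps = lin_hom_rules[OF mods(1,2) f] lin_hom_rules[OF mods(2,3) g]
    lin_hom_rules[OF mods(2,2) h]
  have gf: "g (f x) = \<zero>\<^bsub>C\<^esub>" if "x \<in> carrier A" for x using ker that by blast
  have d: "(\<lambda>y. y \<ominus>\<^bsub>B\<^esub> h y) \<in> lin_hom R B B" by (intro lin_hom_intros mods h)
  have "(\<lambda>y. y \<ominus>\<^bsub>B\<^esub> h y) ` carrier B \<subseteq> f ` carrier A"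
    using gh by (auto simp: ker simps C.M.minus_self)
  then obtain e where e: "e \<in> lin_hom R B A" "\<forall>y\<in>carrier B. f (e y) = y \<ominus>\<^bsub>B\<^esub> h y"
    using hom_factors_through_mono[OF mods(1,2,2) f d inj] by blast
  obtain k where k: "k \<in> lin_hom R A A" "\<forall>x\<in>carrier A. k (x \<ominus>\<^bsub>A\<^esub> e (f x)) = x"
    using left_almost_split_one_minus[OF L A mods(2) e(1)] by blast
  note simps = simps lin_hom_rules[OF mods(2,1) e(1)] lin_hom_rules[OF mods(1,1) k(1)]
  show ?thesis
  proof (intro bexI conjI ballI)
    show "(\<lambda>y. y \<oplus>\<^bsub>B\<^esub> f (k (e y))) \<in> lin_hom R B B"
      by (intro lin_hom_intros mods lin_hom_comp[OF lin_hom_comp[OF e(1) k(1)] f])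
  next
    fix y assume y: "y \<in> carrier B"
    have 1: "y = f (e y) \<oplus>\<^bsub>B\<^esub> h y"
      using y by (simp add: simps e(2) B.M.minus_add_cancel)
    then have "e y = e (f (e y) \<oplus>\<^bsub>B\<^esub> h y)" by (rule arg_cong)
    also have "\<dots> = e (h y) \<oplus>\<^bsub>A\<^esub> e (f (e y))"
      using y by (simp add: simps A.M.add.m_comm)
    finally have "e y \<ominus>\<^bsub>A\<^esub> e (f (e y)) = e (h y)"
      by (rule A.M.minus_eq_iff[THEN iffD2, rotated 3]) (simp_all add: simps y)
    then have "k (e (h y)) = e y" using bspec[OF k(2), of "e y"] y by (simp add: simps)
    moreover have "h y \<oplus>\<^bsub>B\<^esub> f (e y) = y"
      using y by (subst B.M.add.m_comm) (simp_all add: simps flip: 1)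
    ultimately show "h y \<oplus>\<^bsub>B\<^esub> f (k (e (h y))) = y" by simp
  next
    fix y assume "y \<in> carrier B"
    then show "g (y \<oplus>\<^bsub>B\<^esub> f (k (e y))) = g y" by (simp add: gf simps)
  qed
qed

text \<open>An idempotent with a section is the identity. Any other one factors as
  \<open>g w\<close>, so \<open>1 - e\<close> has a left inverse, and \<open>(1 - e) e = 0\<close>
  gives \<open>e = 0\<close>.\<close>

lemma right_almost_split_idempotent:
  assumes R: "right_almost_split R B g C" and B: "left_module R B" and C: "fg_module R C"
    and e: "e \<in> lin_hom R C C" "\<And>z. z \<in> carrier C \<Longrightarrow> e (e z) = e z"
  shows "(\<forall>z\<in>carrier C. e z = \<zero>\<^bsub>C\<^esub>) \<or> (\<forall>z\<in>carrier C. e z = z)"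
proof (cases "split_epi R C e C")
  case True
  then show ?thesis
    using e(2) by (auto simp: split_epi_def lin_hom_def Pi_iff) metis
next
  case False
  have Cm: "left_module R C" using C by (rule fg_left_module)
  interpret C: left_module R C by (fact Cm)
  obtain w where w: "w \<in> lin_hom R C B" "\<forall>z\<in>carrier C. g (w z) = e z"
    using right_almost_split_lift[OF R C e(1) False] by blast
  obtain k where k: "k \<in> lin_hom R C C" "\<forall>z\<in>carrier C. k (z \<ominus>\<^bsub>C\<^esub> g (w z)) = z"
    using right_almost_split_one_minus[OF R B C w(1)] by blast
  note simps = lin_hom_rules[OF Cm Cm e(1)] lin_hom_rules[OF Cm Cm k(1)]
  have "e z = \<zero>\<^bsub>C\<^esub>" if z: "z \<in> carrier C" for z
  proof -
    have "e z = k (e z \<ominus>\<^bsub>C\<^esub> e (e z))" using k(2) w(2) z by (simp add: simps)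
    also have "\<dots> = \<zero>\<^bsub>C\<^esub>" using z e(2) by (simp add: simps C.M.minus_self)
    finally show ?thesis .
  qed
  then show ?thesis by blast
qed

text \<open>With \<open>k\<close> the inverse of \<open>1 - g' a\<close>, the map \<open>k d\<close>
  would be a retraction of \<open>f\<close>. A splitting of \<open>\<phi>\<close> or of
  \<open>\<psi>\<close> leads to exactly such a pair \<open>d\<close>, \<open>a\<close>.\<close>

lemma almost_split_no_decomposition_of_identity:
  assumes L: "left_almost_split R A f B" and R: "right_almost_split R B' g' A"
    and A: "fg_module R A" and B: "left_module R B" and B': "left_module R B'"
    and d: "d \<in> lin_hom R B A" and a: "a \<in> lin_hom R A B'"
    and eq: "\<And>x. x \<in> carrier A \<Longrightarrow> d (f x) = x \<ominus>\<^bsub>A\<^esub> g' (a x)"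
  shows False
proof -
  obtain k where k: "k \<in> lin_hom R A A" "\<forall>x\<in>carrier A. k (x \<ominus>\<^bsub>A\<^esub> g' (a x)) = x"
    using right_almost_split_one_minus[OF R B' A a] by blast
  have "split_mono R A f B"
    using L k eq lin_hom_comp[OF d k(1)] unfolding split_mono_def left_almost_split_def by auto
  then show False using L by (simp add: left_almost_split_def)
qed


section \<open>Submodules and finite generation\<close>

text \<open>\<open>submodule\<close> extends the locale of additive subgroups; closure under
  negatives is recovered from the scalar -1.\<close>

lemma (in left_module) submodule_iff:
  "submodule N R M \<longleftrightarrow> N \<subseteq> carrier M \<and> \<zero>\<^bsub>M\<^esub> \<in> N \<and>
    (\<forall>x\<in>N. \<forall>y\<in>N. x \<oplus>\<^bsub>M\<^esub> y \<in> N) \<and> (\<forall>a\<in>carrier R. \<forall>x\<in>N. a \<odot>\<^bsub>M\<^esub> x \<in> N)"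
proof
  assume N: "submodule N R M"
  interpret N: submodule N R M by (fact N)
  show "N \<subseteq> carrier M \<and> \<zero>\<^bsub>M\<^esub> \<in> N \<and>
    (\<forall>x\<in>N. \<forall>y\<in>N. x \<oplus>\<^bsub>M\<^esub> y \<in> N) \<and> (\<forall>a\<in>carrier R. \<forall>x\<in>N. a \<odot>\<^bsub>M\<^esub> x \<in> N)"
    using N.subset N.one_closed N.m_closed by auto
next
  assume N: "N \<subseteq> carrier M \<and> \<zero>\<^bsub>M\<^esub> \<in> N \<and>
    (\<forall>x\<in>N. \<forall>y\<in>N. x \<oplus>\<^bsub>M\<^esub> y \<in> N) \<and> (\<forall>a\<in>carrier R. \<forall>x\<in>N. a \<odot>\<^bsub>M\<^esub> x \<in> N)"
  then have "\<ominus>\<^bsub>M\<^esub> x \<in> N" if "x \<in> N" for x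
    using that smult_l_neg_one[of x] by (metis R.add.inv_closed R.one_closed subsetD)
  with N show "submodule N R M"
    by unfold_locales (auto simp: a_inv_def[symmetric])
qed

lemma (in left_module) submodule_neg:
  assumes "submodule N R M" "x \<in> N"
  shows "\<ominus>\<^bsub>M\<^esub> x \<in> N"
proof -
  have "x \<in> carrier M" "(\<ominus>\<^bsub>R\<^esub> \<one>\<^bsub>R\<^esub>) \<odot>\<^bsub>M\<^esub> x \<in> N"
    using assms unfolding submodule_iff by auto
  then show ?thesis by (simp add: smult_l_neg_one)
qed

lemma (in left_module) finsum_in_submodule:
  assumes N: "submodule N R M" and S: "finite S" and g: "g \<in> S \<rightarrow> N"
  shows "(\<Oplus>\<^bsub>M\<^esub>s\<in>S. g s) \<in> N"
  using S g
proof (induction S rule: finite_induct)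
  case empty
  then show ?case using N by (simp add: submodule_iff)
next
  case (insert s S)
  then have "g \<in> S \<rightarrow> carrier M" "g s \<in> carrier M"
    using N by (auto simp: submodule_iff Pi_iff)
  then show ?case using insert N by (simp add: submodule_iff)
qed

lemma (in left_module) combinations_submodule:
  assumes S: "finite S" "S \<subseteq> carrier M"
  shows "submodule {x. \<exists>c\<in>S \<rightarrow> carrier R. x = (\<Oplus>\<^bsub>M\<^esub>s\<in>S. c s \<odot>\<^bsub>M\<^esub> s)} R M" (is "submodule ?N R M")
proof -
  have cl: "(\<lambda>s. c s \<odot>\<^bsub>M\<^esub> s) \<in> S \<rightarrow> carrier M" if "c \<in> S \<rightarrow> carrier R" for c
    using that S by (auto intro!: smult_closed)
  have "?N \<subseteq> carrier M" using cl by auto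
  moreover have "\<zero>\<^bsub>M\<^esub> \<in> ?N"
  proof (intro CollectI bexI)
    have "(\<Oplus>\<^bsub>M\<^esub>s\<in>S. \<zero>\<^bsub>R\<^esub> \<odot>\<^bsub>M\<^esub> s) = (\<Oplus>\<^bsub>M\<^esub>s\<in>S. \<zero>\<^bsub>M\<^esub>)"
      using S by (intro M.finsum_cong') (auto simp: smult_zero)
    then show "\<zero>\<^bsub>M\<^esub> = (\<Oplus>\<^bsub>M\<^esub>s\<in>S. \<zero>\<^bsub>R\<^esub> \<odot>\<^bsub>M\<^esub> s)" by simp
  qed simp
  moreover have "x \<oplus>\<^bsub>M\<^esub> y \<in> ?N" if xy: "x \<in> ?N" "y \<in> ?N" for x y
  proof -
    obtain c d where c: "c \<in> S \<rightarrow> carrier R" "x = (\<Oplus>\<^bsub>M\<^esub>s\<in>S. c s \<odot>\<^bsub>M\<^esub> s)"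
      and d: "d \<in> S \<rightarrow> carrier R" "y = (\<Oplus>\<^bsub>M\<^esub>s\<in>S. d s \<odot>\<^bsub>M\<^esub> s)" using xy by blast
    have "x \<oplus>\<^bsub>M\<^esub> y = (\<Oplus>\<^bsub>M\<^esub>s\<in>S. c s \<odot>\<^bsub>M\<^esub> s \<oplus>\<^bsub>M\<^esub> d s \<odot>\<^bsub>M\<^esub> s)"
      using c d cl by (simp add: M.finsum_addf)
    also have "\<dots> = (\<Oplus>\<^bsub>M\<^esub>s\<in>S. (c s \<oplus>\<^bsub>R\<^esub> d s) \<odot>\<^bsub>M\<^esub> s)"
      using c d S cl
      by (intro M.finsum_cong') (auto intro!: smult_closed simp: smult_l_distr Pi_iff subset_iff)
    finally show ?thesis
      using c d by (intro CollectI bexI[of _ "\<lambda>s. c s \<oplus>\<^bsub>R\<^esub> d s"]) auto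
  qed
  moreover have "a \<odot>\<^bsub>M\<^esub> x \<in> ?N" if a: "a \<in> carrier R" and x: "x \<in> ?N" for a x
  proof -
    obtain c where c: "c \<in> S \<rightarrow> carrier R" "x = (\<Oplus>\<^bsub>M\<^esub>s\<in>S. c s \<odot>\<^bsub>M\<^esub> s)" using x by blast
    have "a \<odot>\<^bsub>M\<^esub> (\<Oplus>\<^bsub>M\<^esub>s\<in>F. c s \<odot>\<^bsub>M\<^esub> s) = (\<Oplus>\<^bsub>M\<^esub>s\<in>F. (a \<otimes>\<^bsub>R\<^esub> c s) \<odot>\<^bsub>M\<^esub> s)"
      if "finite F" "F \<subseteq> S" for F
      using that
    proof (induction F rule: finite_induct)
      case empty
      then show ?case using a by (simp add: smult_r_zero)
    next
      case (insert s F)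
      then have "c s \<in> carrier R" "s \<in> carrier M" "\<And>t. t \<in> F \<Longrightarrow> c t \<in> carrier R"
        "\<And>t. t \<in> F \<Longrightarrow> t \<in> carrier M"
        using c S by auto
      then show ?case
        using a insert by (simp add: Pi_iff smult_closed smult_r_distr smult_assoc1)
    qed
    then show ?thesis
      using a c S by (intro CollectI bexI[of _ "\<lambda>s. a \<otimes>\<^bsub>R\<^esub> c s"]) auto
  qed
  ultimately show ?thesis unfolding submodule_iff by blast
qed

text \<open>Replaces linear combinations by generation: a submodule containing \<open>S\<close>
  contains all combinations, and these form a submodule containing \<open>S\<close>. Finite
  generation can then be proved by checking that some set is a submodule, without handling finite
  sums.\<close>

lemma fin_gen_iff:
  assumes "left_module R M"
  shows "fin_gen R M \<longleftrightarrow>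
    (\<exists>S. finite S \<and> S \<subseteq> carrier M \<and> (\<forall>N. submodule N R M \<longrightarrow> S \<subseteq> N \<longrightarrow> carrier M \<subseteq> N))"
proof -
  interpret left_module R M by fact
  show ?thesis
  proof
    assume "fin_gen R M"
    then obtain S where S: "finite S" "S \<subseteq> carrier M"
      and gen: "\<forall>x\<in>carrier M. \<exists>c\<in>S \<rightarrow> carrier R. x = (\<Oplus>\<^bsub>M\<^esub>s\<in>S. c s \<odot>\<^bsub>M\<^esub> s)"
      unfolding fin_gen_def by blast
    have "x \<in> N" if N: "submodule N R M" "S \<subseteq> N" and x: "x \<in> carrier M" for N x
    proof -
      obtain c where c: "c \<in> S \<rightarrow> carrier R" "x = (\<Oplus>\<^bsub>M\<^esub>s\<in>S. c s \<odot>\<^bsub>M\<^esub> s)" using gen x by blast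
      show ?thesis
        unfolding c(2) using N c(1)
        by (intro finsum_in_submodule N S) (auto simp: submodule_iff subset_iff Pi_iff)
    qed
    with S show "\<exists>S. finite S \<and> S \<subseteq> carrier M \<and> (\<forall>N. submodule N R M \<longrightarrow> S \<subseteq> N \<longrightarrow> carrier M \<subseteq> N)"
      by blast
  next
    assume "\<exists>S. finite S \<and> S \<subseteq> carrier M \<and> (\<forall>N. submodule N R M \<longrightarrow> S \<subseteq> N \<longrightarrow> carrier M \<subseteq> N)"
    then obtain S where S: "finite S" "S \<subseteq> carrier M"
      and gen: "\<And>N. submodule N R M \<Longrightarrow> S \<subseteq> N \<Longrightarrow> carrier M \<subseteq> N" by blast
    let ?N = "{x. \<exists>c\<in>S \<rightarrow> carrier R. x = (\<Oplus>\<^bsub>M\<^esub>s\<in>S. c s \<odot>\<^bsub>M\<^esub> s)}"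
    have "S \<subseteq> ?N"
    proof
      fix t assume t: "t \<in> S"
      have "(\<Oplus>\<^bsub>M\<^esub>s\<in>S. (if t = s then \<one>\<^bsub>R\<^esub> else \<zero>\<^bsub>R\<^esub>) \<odot>\<^bsub>M\<^esub> s) = (\<Oplus>\<^bsub>M\<^esub>s\<in>S. if t = s then s else \<zero>\<^bsub>M\<^esub>)"
        using S by (intro M.finsum_cong') (auto simp: smult_zero smult_one)
      also have "\<dots> = t" using M.finsum_singleton[OF t S(1), of "\<lambda>s. s"] S by auto
      finally show "t \<in> ?N" by (intro CollectI bexI[of _ "\<lambda>s. if t = s then \<one>\<^bsub>R\<^esub> else \<zero>\<^bsub>R\<^esub>"]) auto
    qed
    then have "carrier M \<subseteq> ?N" by (intro gen combinations_submodule S)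
    with S show "fin_gen R M" unfolding fin_gen_def by blast
  qed
qed

lemma lin_hom_image_submodule:
  assumes M: "left_module R M" and N: "left_module R N" and h: "h \<in> lin_hom R M N"
  shows "submodule (h ` carrier M) R N"
proof -
  interpret M: left_module R M by (fact M)
  interpret N: left_module R N by (fact N)
  note simps = lin_hom_rules[OF M N h]
  show ?thesis
    unfolding N.submodule_iff
  proof (intro conjI ballI)
    show "\<zero>\<^bsub>N\<^esub> \<in> h ` carrier M" using simps(4) by (metis M.M.zero_closed imageI)
  qed (auto simp: simps simp flip: simps(2,3) intro!: imageI M.smult_closed)
qed



section \<open>The descending chain condition\<close>

text \<open>Relative to a subset \<open>T\<close> of one ambient module, so that the induction over
  generators never has to make \<open>T\<close> a module of its own.\<close>

definition dcc_below :: "('r, 'e) ring_scheme \<Rightarrow> ('r, 'm, 'x) module_scheme \<Rightarrow> 'm set \<Rightarrow> bool" where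
  "dcc_below R M T \<longleftrightarrow> (\<forall>N :: nat \<Rightarrow> 'm set.
    (\<forall>n. submodule (N n) R M \<and> N n \<subseteq> T \<and> N (Suc n) \<subseteq> N n) \<longrightarrow> (\<exists>n. \<forall>m\<ge>n. N m = N n))"

lemma dcc_below_minimal:
  assumes dcc: "dcc_below R M (carrier M)" and sub: "\<And>N. N \<in> \<N> \<Longrightarrow> submodule N R M"
    and ne: "\<N> \<noteq> {}"
  shows "\<exists>N\<in>\<N>. \<forall>N'\<in>\<N>. \<not> N' \<subset> N"
proof (rule ccontr)
  assume "\<not> ?thesis"
  then have step: "\<forall>N\<in>\<N>. \<exists>N'\<in>\<N>. N' \<subset> N" by blast
  obtain N0 where "N0 \<in> \<N>" using ne by blast
  then obtain f where f: "\<And>n. f n \<in> \<N>" "\<And>n. f (Suc n) \<subset> f n"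
    using dependent_nat_choice[of "\<lambda>_ N. N \<in> \<N>" "\<lambda>_ N N'. N' \<subset> N"] step by metis
  have "submodule (f n) R M \<and> f n \<subseteq> carrier M \<and> f (Suc n) \<subseteq> f n" for n
    using sub[OF f(1)] f(2)[of n] subgroup.subset[OF submodule.axioms(1)[OF sub[OF f(1)]]] by auto
  then obtain n where "\<forall>m\<ge>n. f m = f n" using dcc unfolding dcc_below_def by blast
  then have "f (Suc n) = f n" by (meson le_SucI order_refl)
  with f(2)[of n] show False by simp
qed

text \<open>The classical argument for an extension of a cyclic module by \<open>T\<close>: a chain
  below \<open>T'\<close> is controlled by its intersections with \<open>T\<close>, which become
  stationary by assumption, and by ideals of coefficients of \<open>s\<close>, which become
  stationary because the scalars are Artinian. Commutativity makes these left ideals two-sided, as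
  \<open>artinian_cring\<close> requires.\<close>

lemma (in left_module) dcc_below_add_generator:
  assumes K: "artinian_cring R" and T: "submodule T R M" "dcc_below R M T" and s: "s \<in> carrier M"
  defines "T' \<equiv> {x. \<exists>c\<in>carrier R. \<exists>t\<in>T. x = c \<odot>\<^bsub>M\<^esub> s \<oplus>\<^bsub>M\<^esub> t}"
  shows "submodule T' R M" "insert s T \<subseteq> T'" "dcc_below R M T'"
proof -
  interpret K: cring R using K by (simp add: artinian_cring_def)
  have Tc: "t \<in> carrier M" if "t \<in> T" for t using T(1) that by (auto simp: submodule_iff)
  have T0: "\<zero>\<^bsub>M\<^esub> \<in> T" and Tadd: "\<And>x y. x \<in> T \<Longrightarrow> y \<in> T \<Longrightarrow> x \<oplus>\<^bsub>M\<^esub> y \<in> T"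
    and Tsm: "\<And>a x. a \<in> carrier R \<Longrightarrow> x \<in> T \<Longrightarrow> a \<odot>\<^bsub>M\<^esub> x \<in> T"
    using T(1) by (auto simp: submodule_iff)
  show "submodule T' R M"
    unfolding submodule_iff
  proof (intro conjI ballI)
    show "T' \<subseteq> carrier M" using Tc s by (auto simp: T'_def intro!: smult_closed)
    show "\<zero>\<^bsub>M\<^esub> \<in> T'" using T0 s by (auto simp: T'_def smult_zero intro!: bexI[of _ "\<zero>\<^bsub>R\<^esub>"] bexI[OF _ T0])
    fix x assume "x \<in> T'"
    then obtain c t where x: "c \<in> carrier R" "t \<in> T" "x = c \<odot>\<^bsub>M\<^esub> s \<oplus>\<^bsub>M\<^esub> t" by (auto simp: T'_def)
    {
      fix y assume "y \<in> T'"
      then obtain d u where y: "d \<in> carrier R" "u \<in> T" "y = d \<odot>\<^bsub>M\<^esub> s \<oplus>\<^bsub>M\<^esub> u" by (auto simp: T'_def)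
      have "x \<oplus>\<^bsub>M\<^esub> y = (c \<oplus>\<^bsub>R\<^esub> d) \<odot>\<^bsub>M\<^esub> s \<oplus>\<^bsub>M\<^esub> (t \<oplus>\<^bsub>M\<^esub> u)"
        using x y s by (simp add: Tc smult_closed smult_l_distr M.a_ac)
      then show "x \<oplus>\<^bsub>M\<^esub> y \<in> T'" using x y Tadd unfolding T'_def by blast
    }
    fix a assume a: "a \<in> carrier R"
    have "a \<odot>\<^bsub>M\<^esub> x = (a \<otimes>\<^bsub>R\<^esub> c) \<odot>\<^bsub>M\<^esub> s \<oplus>\<^bsub>M\<^esub> a \<odot>\<^bsub>M\<^esub> t"
      using x a s by (simp add: Tc smult_closed smult_r_distr smult_assoc1)
    then show "a \<odot>\<^bsub>M\<^esub> x \<in> T'" using x a Tsm unfolding T'_def by blast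
  qed
  have "s = \<one>\<^bsub>R\<^esub> \<odot>\<^bsub>M\<^esub> s \<oplus>\<^bsub>M\<^esub> \<zero>\<^bsub>M\<^esub>" using s by (simp add: smult_one)
  moreover have "t = \<zero>\<^bsub>R\<^esub> \<odot>\<^bsub>M\<^esub> s \<oplus>\<^bsub>M\<^esub> t" if "t \<in> T" for t
    using s that by (simp add: smult_zero Tc)
  ultimately show "insert s T \<subseteq> T'"
    using T0 unfolding T'_def by blast
  show "dcc_below R M T'"
    unfolding dcc_below_def
  proof (intro allI impI)
    fix N :: "nat \<Rightarrow> 'c set"
    assume N: "\<forall>n. submodule (N n) R M \<and> N n \<subseteq> T' \<and> N (Suc n) \<subseteq> N n"
    then have sub: "submodule (N n) R M" and below: "N n \<subseteq> T'" and step: "N (Suc n) \<subseteq> N n" for n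
      by blast+
    have dec: "N m \<subseteq> N n" if "n \<le> m" for m n
      by (rule lift_Suc_antimono_le[of N, OF step that])
    note N = sub[unfolded submodule_iff]
    have Nc: "x \<in> carrier M" if "x \<in> N n" for x n using N that by blast
    have N0: "\<zero>\<^bsub>M\<^esub> \<in> N n" for n using N by blast
    have Nadd: "x \<oplus>\<^bsub>M\<^esub> y \<in> N n" if "x \<in> N n" "y \<in> N n" for x y n using N that by blast
    have Nsm: "a \<odot>\<^bsub>M\<^esub> x \<in> N n" if "a \<in> carrier R" "x \<in> N n" for a x n using N that by blast
    have Nneg: "\<ominus>\<^bsub>M\<^esub> x \<in> N n" if "x \<in> N n" for x n
      by (rule submodule_neg[OF sub that])
    have "submodule (N n \<inter> T) R M" for n
      unfolding submodule_iff by (auto intro: Nc N0 Nadd Nsm T0 Tadd Tsm)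
    then have "submodule (N n \<inter> T) R M \<and> N n \<inter> T \<subseteq> T \<and> N (Suc n) \<inter> T \<subseteq> N n \<inter> T" for n
      using Int_mono[OF step order_refl] by simp
    then obtain n1 where n1: "\<forall>m\<ge>n1. N m \<inter> T = N n1 \<inter> T"
      using T(2)[unfolded dcc_below_def, rule_format, of "\<lambda>n. N n \<inter> T"] by blast
    \<comment> \<open>\<open>I n\<close> collects the \<open>c\<close> for which \<open>N n\<close>
      meets the coset \<open>c s + T\<close>; it is the preimage in the scalars of the image of
      \<open>N n\<close> in \<open>T'/T\<close>.\<close>
    define I where "I n = {c \<in> carrier R. \<exists>t\<in>T. c \<odot>\<^bsub>M\<^esub> s \<oplus>\<^bsub>M\<^esub> t \<in> N n}" for n
    have I_left: "a \<otimes>\<^bsub>R\<^esub> c \<in> I n" if ac: "a \<in> carrier R" "c \<in> I n" for a c n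
    proof -
      obtain t where t: "c \<in> carrier R" "t \<in> T" "c \<odot>\<^bsub>M\<^esub> s \<oplus>\<^bsub>M\<^esub> t \<in> N n" using ac by (auto simp: I_def)
      have "(a \<otimes>\<^bsub>R\<^esub> c) \<odot>\<^bsub>M\<^esub> s \<oplus>\<^bsub>M\<^esub> a \<odot>\<^bsub>M\<^esub> t \<in> N n"
        using Nsm[OF ac(1) t(3)] t s ac by (simp add: Tc smult_closed smult_r_distr smult_assoc1)
      then show ?thesis using t ac Tsm unfolding I_def by blast
    qed
    have I_add: "c \<oplus>\<^bsub>R\<^esub> d \<in> I n" if cd: "c \<in> I n" "d \<in> I n" for c d n
    proof -
      obtain t u where t: "c \<in> carrier R" "t \<in> T" "c \<odot>\<^bsub>M\<^esub> s \<oplus>\<^bsub>M\<^esub> t \<in> N n"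
        and u: "d \<in> carrier R" "u \<in> T" "d \<odot>\<^bsub>M\<^esub> s \<oplus>\<^bsub>M\<^esub> u \<in> N n" using cd by (auto simp: I_def)
      have "(c \<oplus>\<^bsub>R\<^esub> d) \<odot>\<^bsub>M\<^esub> s \<oplus>\<^bsub>M\<^esub> (t \<oplus>\<^bsub>M\<^esub> u) \<in> N n"
        using Nadd[OF t(3) u(3)] t u s by (simp add: Tc smult_closed smult_l_distr M.a_ac)
      then show ?thesis using t u Tadd unfolding I_def by blast
    qed
    have I_zero: "\<zero>\<^bsub>R\<^esub> \<in> I n" for n
      unfolding I_def using s N0 T0 by (auto simp: smult_zero intro!: bexI[of _ "\<zero>\<^bsub>M\<^esub>"])
    have I_ideal: "ideal (I n) R" for n
    proof (rule idealI)
      show "subgroup (I n) (add_monoid R)"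
      proof (rule R.add.subgroupI)
        show "I n \<subseteq> carrier R" by (auto simp: I_def)
        show "I n \<noteq> {}" using I_zero by blast
        fix c assume c: "c \<in> I n"
        then have "(\<ominus>\<^bsub>R\<^esub> \<one>\<^bsub>R\<^esub>) \<otimes>\<^bsub>R\<^esub> c \<in> I n" by (intro I_left) auto
        then show "\<ominus>\<^bsub>R\<^esub> c \<in> I n" using c by (simp add: R.l_minus I_def)
      qed (auto intro: I_add)
      fix a c assume "a \<in> I n" "c \<in> carrier R"
      then show "c \<otimes>\<^bsub>R\<^esub> a \<in> I n" "a \<otimes>\<^bsub>R\<^esub> c \<in> I n"
        using I_left[of c a n] K.m_comm[of a c] by (auto simp: I_def)
    qed (rule R.ring_axioms)
    have "I (Suc n) \<subseteq> I n" for n using step unfolding I_def by blast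
    then obtain n2 where n2: "\<forall>m\<ge>n2. I m = I n2"
      using K I_ideal unfolding artinian_cring_def by meson
    have "N n \<subseteq> N m" if m: "m \<ge> n" and n: "n = max n1 n2" for m n
    proof
      fix x assume x: "x \<in> N n"
      then obtain c t where c: "c \<in> carrier R" "t \<in> T" "x = c \<odot>\<^bsub>M\<^esub> s \<oplus>\<^bsub>M\<^esub> t"
        using below unfolding T'_def by blast
      then have "c \<in> I n" using x by (auto simp: I_def)
      moreover have "I n = I m" using n2 m n by (metis max.bounded_iff order_refl order_trans)
      ultimately obtain u where u: "u \<in> T" "c \<odot>\<^bsub>M\<^esub> s \<oplus>\<^bsub>M\<^esub> u \<in> N m" by (auto simp: I_def)
      have cs: "c \<odot>\<^bsub>M\<^esub> s \<in> carrier M" using c s by (simp add: smult_closed)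
      \<comment> \<open>\<open>y\<close> has the same \<open>s\<close>-coefficient as
        \<open>x\<close> but lies already in \<open>N m\<close>. Hence \<open>x - y\<close> belongs
        to \<open>N n \<inter> T = N m \<inter> T\<close>, and \<open>x\<close> is a sum of two
        elements of \<open>N m\<close>.\<close>
      define y where "y = c \<odot>\<^bsub>M\<^esub> s \<oplus>\<^bsub>M\<^esub> u"
      have y: "y \<in> N m" "y \<in> N n" using u dec[OF m] by (auto simp: y_def)
      have "x \<ominus>\<^bsub>M\<^esub> y = t \<ominus>\<^bsub>M\<^esub> u"
      proof (rule M.minus_eq_iff[THEN iffD2])
        have "t \<ominus>\<^bsub>M\<^esub> u \<oplus>\<^bsub>M\<^esub> y = c \<odot>\<^bsub>M\<^esub> s \<oplus>\<^bsub>M\<^esub> ((t \<ominus>\<^bsub>M\<^esub> u) \<oplus>\<^bsub>M\<^esub> u)"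
          using cs c u by (simp add: y_def Tc M.a_lcomm)
        then show "x = t \<ominus>\<^bsub>M\<^esub> u \<oplus>\<^bsub>M\<^esub> y"
          using c u by (simp add: Tc M.minus_add_cancel)
      qed (use x y Nc c u in \<open>simp_all add: Tc\<close>)
      then have "x \<oplus>\<^bsub>M\<^esub> \<ominus>\<^bsub>M\<^esub> y = t \<oplus>\<^bsub>M\<^esub> \<ominus>\<^bsub>M\<^esub> u" by (simp add: a_minus_def)
      then have d: "x \<oplus>\<^bsub>M\<^esub> \<ominus>\<^bsub>M\<^esub> y \<in> N n \<inter> T"
        using Nadd[OF x Nneg[OF y(2)]] Tadd[OF c(2) submodule_neg[OF T(1) u(1)]] by simp
      have "N n \<inter> T = N m \<inter> T" using n1 m n by (metis max.bounded_iff order_refl order_trans)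
      then have "y \<oplus>\<^bsub>M\<^esub> (x \<oplus>\<^bsub>M\<^esub> \<ominus>\<^bsub>M\<^esub> y) \<in> N m" using d y Nadd by blast
      then show "x \<in> N m" using x y Nc by (simp add: M.a_lcomm M.r_neg)
    qed
    then show "\<exists>n. \<forall>m\<ge>n. N m = N n" using dec by (metis subset_antisym)
  qed
qed

text \<open>Starting from the zero submodule, the generators are added one at a time; a submodule
  containing all of them is the whole module.\<close>

lemma fin_gen_dcc_below:
  assumes K: "artinian_cring K" and M: "left_module K M" and fg: "fin_gen K M"
  shows "dcc_below K M (carrier M)"
proof -
  interpret left_module K M by (fact M)
  obtain S where S: "finite S" "S \<subseteq> carrier M"
    and gen: "\<And>N. submodule N K M \<Longrightarrow> S \<subseteq> N \<Longrightarrow> carrier M \<subseteq> N"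
    using fg unfolding fin_gen_iff[OF M] by blast
  have "\<exists>T. submodule T K M \<and> S \<subseteq> T \<and> dcc_below K M T"
    using S
  proof (induction S rule: finite_induct)
    case empty
    have "submodule {\<zero>\<^bsub>M\<^esub>} K M" by (auto simp: submodule_iff smult_r_zero)
    moreover have "N = {\<zero>\<^bsub>M\<^esub>}" if "submodule N K M" "N \<subseteq> {\<zero>\<^bsub>M\<^esub>}" for N
      using that by (auto simp: submodule_iff)
    then have "dcc_below K M {\<zero>\<^bsub>M\<^esub>}" unfolding dcc_below_def by metis
    ultimately show ?case by blast
  next
    case (insert s S)
    then obtain T where T: "submodule T K M" "S \<subseteq> T" "dcc_below K M T" by auto
    have s: "s \<in> carrier M" using insert.prems by simp
    note T' = dcc_below_add_generator[OF K T(1,3) s]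
    show ?case
      by (intro exI conjI) (fact T'(1), fact order_trans[OF insert_mono[OF T(2)] T'(2)], fact T'(3))
  qed
  then obtain T where T: "submodule T K M" "S \<subseteq> T" "dcc_below K M T" by blast
  moreover have "T = carrier M" using gen[OF T(1,2)] T(1) by (auto simp: submodule_iff)
  ultimately show ?thesis by simp
qed

section \<open>Passage from the commutative base ring to modules over the Artin algebra\<close>

definition restrict_scalars :: "('k \<Rightarrow> 'r) \<Rightarrow> ('r, 'm) module \<Rightarrow> ('k, 'm) module" where
  "restrict_scalars \<eta> M = \<lparr>carrier = carrier M, mult = mult M, one = one M, zero = zero M,
    add = add M, smult = (\<lambda>c x. \<eta> c \<odot>\<^bsub>M\<^esub> x)\<rparr>"

lemma restrict_scalars_simps [simp]:
  "carrier (restrict_scalars \<eta> M) = carrier M" "zero (restrict_scalars \<eta> M) = zero M"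
  "add (restrict_scalars \<eta> M) = add M" "smult (restrict_scalars \<eta> M) c x = \<eta> c \<odot>\<^bsub>M\<^esub> x"
  by (simp_all add: restrict_scalars_def)

lemma restrict_scalars_left_module:
  assumes K: "ring K" and \<eta>: "\<eta> \<in> ring_hom K R" and M: "left_module R M"
  shows "left_module K (restrict_scalars \<eta> M)"
proof -
  interpret left_module R M by (fact M)
  have "abelian_group (restrict_scalars \<eta> M)"
  proof (rule abelian_groupI)
    fix x assume "x \<in> carrier (restrict_scalars \<eta> M)"
    then show "\<exists>y\<in>carrier (restrict_scalars \<eta> M). y \<oplus>\<^bsub>restrict_scalars \<eta> M\<^esub> x = \<zero>\<^bsub>restrict_scalars \<eta> M\<^esub>"
      by (intro bexI[of _ "\<ominus>\<^bsub>M\<^esub> x"]) (simp_all add: M.l_neg)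
  qed (simp_all add: M.a_ac)
  then show ?thesis
    using \<eta> by (intro left_module.intro left_module_axioms.intro K)
      (simp_all add: ring_hom_closed ring_hom_add ring_hom_mult ring_hom_one smult_closed
        smult_l_distr smult_r_distr smult_assoc1 smult_one)
qed

text \<open>With the identity as structure map, \<open>scalars_via\<close> is the regular left
  module. Its restriction along \<open>\<eta>\<close> is the module
  \<open>scalars_via \<eta> R\<close> from the definition of an Artin algebra.\<close>

lemma ring_scalars_left_module:
  assumes "ring R"
  shows "left_module R (scalars_via (\<lambda>x. x) R)" (is "left_module R ?M")
proof -
  interpret ring R by fact
  have "abelian_group ?M"
  proof (rule abelian_groupI)
    fix x assume "x \<in> carrier ?M"
    then show "\<exists>y\<in>carrier ?M. y \<oplus>\<^bsub>?M\<^esub> x = \<zero>\<^bsub>?M\<^esub>"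
      by (intro bexI[of _ "\<ominus>\<^bsub>R\<^esub> x"]) (simp_all add: scalars_via_def l_neg)
  qed (simp_all add: scalars_via_def a_ac)
  then show ?thesis
    by (intro left_module.intro left_module_axioms.intro assms)
      (simp_all add: scalars_via_def l_distr r_distr m_assoc)
qed

text \<open>Products of generators of \<open>R\<close> over \<open>K\<close> and of \<open>M\<close>
  over \<open>R\<close> generate \<open>M\<close> over \<open>K\<close>, where the chain condition
  is known; every \<open>R\<close>-submodule is a \<open>K\<close>-submodule.\<close>

lemma artin_algebra_fg_module_dcc_below:
  assumes AA: "artin_algebra K \<eta> R" and M: "fg_module R M"
  shows "dcc_below R M (carrier M)"
proof -
  let ?M = "restrict_scalars \<eta> M" and ?R = "scalars_via \<eta> R"
  have K: "artinian_cring K" "ring K" and R: "ring R" and \<eta>: "\<eta> \<in> ring_hom K R"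
    and fgR: "fin_gen K ?R"
    using AA by (auto simp: artin_algebra_def artinian_cring_def cring_def)
  interpret M: left_module R M using M by (rule fg_left_module)
  interpret KM: left_module K ?M by (rule restrict_scalars_left_module[OF K(2) \<eta> M.left_module_axioms])
  have "?R = restrict_scalars \<eta> (scalars_via (\<lambda>x. x) R)"
    by (simp add: scalars_via_def restrict_scalars_def)
  then interpret KR: left_module K ?R
    using restrict_scalars_left_module[OF K(2) \<eta> ring_scalars_left_module[OF R]] by simp
  obtain G where G: "finite G" "G \<subseteq> carrier ?R"
    and genR: "\<And>N. submodule N K ?R \<Longrightarrow> G \<subseteq> N \<Longrightarrow> carrier ?R \<subseteq> N"
    using fgR unfolding fin_gen_iff[OF KR.left_module_axioms] by blast
  obtain S where S: "finite S" "S \<subseteq> carrier M"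
    and genM: "\<And>N. submodule N R M \<Longrightarrow> S \<subseteq> N \<Longrightarrow> carrier M \<subseteq> N"
    using M unfolding fg_module_def fin_gen_iff[OF M.left_module_axioms] by blast
  have GR: "a \<in> carrier R" if "a \<in> G" for a using G that by (auto simp: scalars_via_def)
  have "fin_gen K ?M"
    unfolding fin_gen_iff[OF KM.left_module_axioms]
  proof (intro exI[of _ "(\<lambda>(a, s). a \<odot>\<^bsub>M\<^esub> s) ` (G \<times> S)"] conjI allI impI)
    show "finite ((\<lambda>(a, s). a \<odot>\<^bsub>M\<^esub> s) ` (G \<times> S))" using G S by simp
    show "(\<lambda>(a, s). a \<odot>\<^bsub>M\<^esub> s) ` (G \<times> S) \<subseteq> carrier ?M"
      using GR S by (auto intro!: M.smult_closed)
    fix N assume N: "submodule N K ?M" and GS: "(\<lambda>(a, s). a \<odot>\<^bsub>M\<^esub> s) ` (G \<times> S) \<subseteq> N"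
    note N' = N[unfolded KM.submodule_iff, simplified]
    have RS: "a \<odot>\<^bsub>M\<^esub> s \<in> N" if a: "a \<in> carrier R" and s: "s \<in> S" for a s
    proof -
      have "submodule {a \<in> carrier R. a \<odot>\<^bsub>M\<^esub> s \<in> N} K ?R"
        using N' s S unfolding KR.submodule_iff
        by (auto simp: scalars_via_def M.smult_zero M.smult_l_distr M.smult_assoc1
          ring_hom_closed[OF \<eta>] subset_iff)
      moreover have "G \<subseteq> {a \<in> carrier R. a \<odot>\<^bsub>M\<^esub> s \<in> N}" using GS GR s by auto
      ultimately show ?thesis
        using genR[of "{a \<in> carrier R. a \<odot>\<^bsub>M\<^esub> s \<in> N}"] a by (auto simp: scalars_via_def)
    qed
    \<comment> \<open>\<open>N\<close> is only a \<open>K\<close>-submodule, so generation over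
      \<open>R\<close> is applied to the largest \<open>R\<close>-submodule inside \<open>N\<close>,
      the set of all \<open>x\<close> whose multiples \<open>a x\<close> lie in \<open>N\<close>. By
      \<open>RS\<close> it contains \<open>S\<close>.\<close>
    have "submodule {x \<in> carrier M. \<forall>a\<in>carrier R. a \<odot>\<^bsub>M\<^esub> x \<in> N} R M"
      using N' unfolding M.submodule_iff
      by (auto simp: M.smult_r_zero M.smult_r_distr M.smult_closed simp flip: M.smult_assoc1)
    then have "carrier M \<subseteq> {x \<in> carrier M. \<forall>a\<in>carrier R. a \<odot>\<^bsub>M\<^esub> x \<in> N}"
      using RS S by (intro genM) auto
    then have "\<one>\<^bsub>R\<^esub> \<odot>\<^bsub>M\<^esub> x \<in> N" if "x \<in> carrier M" for x
      using M.R.one_closed that by blast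
    then show "carrier ?M \<subseteq> N" by (auto simp: M.smult_one)
  qed
  then have dcc: "dcc_below K ?M (carrier ?M)"
    by (rule fin_gen_dcc_below[OF K(1) KM.left_module_axioms])
  have "submodule N K ?M" if "submodule N R M" for N
    using that by (auto simp: KM.submodule_iff M.submodule_iff ring_hom_closed[OF \<eta>])
  with dcc show ?thesis unfolding dcc_below_def by auto
qed


section \<open>Lifting and extending in the morphism category\<close>

text \<open>If \<open>A\<close> were zero, the zero map would be a retraction of
  \<open>f\<close>.\<close>

lemma left_almost_split_nonzero:
  assumes L: "left_almost_split R A f B" and A: "left_module R A" and B: "left_module R B"
  shows "\<exists>a\<in>carrier A. a \<noteq> \<zero>\<^bsub>A\<^esub>"
proof (rule ccontr)
  assume "\<not> ?thesis"
  then have "\<forall>x\<in>carrier A. \<zero>\<^bsub>A\<^esub> = x" by fastforce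
  then have "split_mono R A f B"
    using L by (auto simp: split_mono_def left_almost_split_def
      intro!: bexI[OF _ lin_hom_const_zero[OF A]])
  then show False using L by (simp add: left_almost_split_def)
qed

text \<open>Among the endomorphisms \<open>e\<close> in the set \<open>E\<close> below choose one with minimal image, and let \<open>s\<close> be a
  section of \<open>h1 e = h1 + r x\<close>. If \<open>x e s\<close> had a retraction \<open>p\<close>, then \<open>e (1 - s p x e)\<close> would belong to
  \<open>E\<close> and have smaller image, because \<open>p x\<close> annihilates it but not the image of \<open>e s\<close>.\<close>

lemma lift_through_source_almost_split:
  assumes S: "almost_split R A f B g C" and S': "almost_split R A' f' B' g' A"
    and X: "fg_module R X1" "fg_module R X2" and dcc: "dcc_below R X1 (carrier X1)"
    and x: "x \<in> lin_hom R X1 X2" and h1: "h1 \<in> lin_hom R X1 A" and h2: "h2 \<in> lin_hom R X2 B"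
    and comm: "\<And>z. z \<in> carrier X1 \<Longrightarrow> f (h1 z) = h2 (x z)"
    and no_section: "\<And>s1 s2. \<lbrakk>s1 \<in> lin_hom R A X1; s2 \<in> lin_hom R B X2;
      \<forall>a\<in>carrier A. h1 (s1 a) = a; \<forall>b\<in>carrier B. h2 (s2 b) = b;
      \<forall>a\<in>carrier A. x (s1 a) = s2 (f a)\<rbrakk> \<Longrightarrow> False"
  shows "\<exists>r\<in>lin_hom R X2 A. \<exists>q\<in>lin_hom R X1 B'. \<forall>z\<in>carrier X1. g' (q z) = h1 z \<oplus>\<^bsub>A\<^esub> r (x z)"
proof (rule ccontr)
  assume no_lift: "\<not> ?thesis"
  have A: "left_module R A" and B: "left_module R B"
    and L: "left_almost_split R A f B" and R: "right_almost_split R B' g' A"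
    and f: "f \<in> lin_hom R A B"
    using S S' by (auto simp: almost_split_def fg_module_def short_exact_def)
  have X1: "left_module R X1" and X2: "left_module R X2" using X by (auto simp: fg_module_def)
  interpret A: left_module R A by (fact A)
  interpret B: left_module R B by (fact B)
  interpret X1: left_module R X1 by (fact X1)
  interpret X2: left_module R X2 by (fact X2)
  note x_simps = lin_hom_rules[OF X1 X2 x] and h1_simps = lin_hom_rules[OF X1 A h1]
    and h2_simps = lin_hom_rules[OF X2 B h2] and f_simps = lin_hom_rules[OF A B f]
  obtain a0 where a0: "a0 \<in> carrier A" "a0 \<noteq> \<zero>\<^bsub>A\<^esub>"
    using left_almost_split_nonzero[OF L A B] by blast
  \<comment> \<open>\<open>E\<close> consists of the source components of endomorphisms
    \<open>(e, e2)\<close> of the object \<open>x\<close> for which \<open>h1 e\<close> is again a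
    correction \<open>h1 + r x\<close>. The relation \<open>x e = e2 x\<close> makes a further
    correction by \<open>p x e\<close> again factor through \<open>x\<close>.\<close>
  define E where "E = {e \<in> lin_hom R X1 X1.
    (\<exists>e2\<in>lin_hom R X2 X2. \<forall>z\<in>carrier X1. x (e z) = e2 (x z)) \<and>
    (\<exists>r\<in>lin_hom R X2 A. \<forall>z\<in>carrier X1. h1 (e z) = h1 z \<oplus>\<^bsub>A\<^esub> r (x z))}"
  have "(\<lambda>z. z) \<in> E"
    unfolding E_def
  proof (intro CollectI conjI bexI ballI lin_hom_intros A)
    show "x z = x z" for z ..
    show "h1 z = h1 z \<oplus>\<^bsub>A\<^esub> \<zero>\<^bsub>A\<^esub>" if "z \<in> carrier X1" for z using that by (simp add: h1_simps)
  qed (rule lin_hom_intros A)+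
  then have "(\<lambda>e. e ` carrier X1) ` E \<noteq> {}" by blast
  moreover have "submodule N R X1" if "N \<in> (\<lambda>e. e ` carrier X1) ` E" for N
    using that lin_hom_image_submodule[OF X1 X1] by (auto simp: E_def)
  ultimately have "\<exists>N\<in>(\<lambda>e. e ` carrier X1) ` E. \<forall>N'\<in>(\<lambda>e. e ` carrier X1) ` E. \<not> N' \<subset> N"
    by (intro dcc_below_minimal[OF dcc])
  then obtain e where eE: "e \<in> E"
    and minimal: "\<And>e'. e' \<in> E \<Longrightarrow> \<not> e' ` carrier X1 \<subset> e ` carrier X1"
    by (simp only: bex_simps ball_simps) blast
  obtain e2 r where e: "e \<in> lin_hom R X1 X1"
    and e2: "e2 \<in> lin_hom R X2 X2" "\<And>z. z \<in> carrier X1 \<Longrightarrow> x (e z) = e2 (x z)"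
    and r: "r \<in> lin_hom R X2 A" "\<And>z. z \<in> carrier X1 \<Longrightarrow> h1 (e z) = h1 z \<oplus>\<^bsub>A\<^esub> r (x z)"
    using eE unfolding E_def by blast
  have "split_epi R X1 (\<lambda>z. h1 (e z)) A"
  proof (rule ccontr)
    assume "\<not> ?thesis"
    then obtain q where q: "q \<in> lin_hom R X1 B'" "\<forall>z\<in>carrier X1. g' (q z) = h1 (e z)"
      using right_almost_split_lift[OF R X(1) lin_hom_comp[OF e h1]] by blast
    have "\<forall>z\<in>carrier X1. g' (q z) = h1 z \<oplus>\<^bsub>A\<^esub> r (x z)" using q(2) r(2) by simp
    with q(1) r(1) no_lift show False by blast
  qed
  then obtain s where s: "s \<in> lin_hom R A X1" "\<And>a. a \<in> carrier A \<Longrightarrow> h1 (e (s a)) = a"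
    by (auto simp: split_epi_def)
  note s_simps = lin_hom_rules[OF A X1 s(1)] and e_simps = lin_hom_rules[OF X1 X1 e]
  have es: "(\<lambda>a. e (s a)) \<in> lin_hom R A X1" and xes: "(\<lambda>a. x (e (s a))) \<in> lin_hom R A X2"
    by (intro lin_hom_comp[OF s(1) e], intro lin_hom_comp[OF lin_hom_comp[OF s(1) e] x])
  show False
  proof (cases "split_mono R A (\<lambda>a. x (e (s a))) X2")
    case False
    then obtain t where t: "t \<in> lin_hom R B X2" "\<And>a. a \<in> carrier A \<Longrightarrow> t (f a) = x (e (s a))"
      using left_almost_split_extend[OF L X(2) xes] by blast
    \<comment> \<open>Here \<open>h2 x e s = f h1 e s = f\<close>, so \<open>h2 t\<close> fixes
      \<open>f\<close>. Left minimality supplies \<open>k\<close> with \<open>h2 t k = 1\<close> and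
      \<open>k f = f\<close>, and \<open>(e s, t k)\<close> is the forbidden section.\<close>
    have "h2 (t (f a)) = f a" if "a \<in> carrier A" for a
      using that by (simp add: t(2) s(2) s_simps e_simps flip: comm)
    then obtain k where k: "k \<in> lin_hom R B B" "\<forall>y\<in>carrier B. h2 (t (k y)) = y"
      "\<forall>a\<in>carrier A. k (f a) = f a"
      using almost_split_left_minimal[OF S lin_hom_comp[OF t(1) h2]] by blast
    show False
      by (rule no_section[OF es lin_hom_comp[OF k(1) t(1)]]) (use k t s in auto)
  next
    case True
    then obtain p where p: "p \<in> lin_hom R X2 A" "\<And>a. a \<in> carrier A \<Longrightarrow> p (x (e (s a))) = a"
      by (auto simp: split_mono_def)
    note p_simps = lin_hom_rules[OF X2 A p(1)] and e2_simps = lin_hom_rules[OF X2 X2 e2(1)]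
      and r_simps = lin_hom_rules[OF X2 A r(1)]
    define d where "d z = z \<ominus>\<^bsub>X1\<^esub> s (p (x (e z)))" for z
    have d: "d \<in> lin_hom R X1 X1"
      unfolding d_def
      by (intro lin_hom_intros X1 lin_hom_comp[OF lin_hom_comp[OF lin_hom_comp[OF e x] p(1)] s(1)])
    have dc: "d z \<in> carrier X1" if "z \<in> carrier X1" for z
      using lin_hom_closed[OF X1 X1 d that] .
    have "(\<lambda>z. e (d z)) \<in> E"
      unfolding E_def
    proof (intro CollectI conjI bexI ballI)
      show "(\<lambda>z. e (d z)) \<in> lin_hom R X1 X1" by (rule lin_hom_comp[OF d e])
      \<comment> \<open>By \<open>x e = e2 x\<close>, the composite \<open>x e d\<close> is
        \<open>(e2 - x e s p e2) x\<close>, and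
        \<open>h1 e d = h1 e - p x e = h1 + (r - p e2) x\<close>. These are the two
        witnesses.\<close>
      show "(\<lambda>w. e2 w \<ominus>\<^bsub>X2\<^esub> x (e (s (p (e2 w))))) \<in> lin_hom R X2 X2"
        by (intro lin_hom_intros X2 e2(1) lin_hom_comp[OF lin_hom_comp[OF e2(1) p(1)] xes])
      show "(\<lambda>w. r w \<ominus>\<^bsub>A\<^esub> p (e2 w)) \<in> lin_hom R X2 A"
        by (intro lin_hom_intros A r(1) lin_hom_comp[OF e2(1) p(1)])
      fix z assume z: "z \<in> carrier X1"
      show "x (e (d z)) = e2 (x z) \<ominus>\<^bsub>X2\<^esub> x (e (s (p (e2 (x z)))))"
        using z by (simp add: d_def e_simps x_simps s_simps p_simps flip: e2(2))
      have "h1 (e (d z)) = h1 (e z) \<ominus>\<^bsub>A\<^esub> p (x (e z))"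
        using z by (simp add: d_def e_simps x_simps s_simps p_simps h1_simps s(2))
      then show "h1 (e (d z)) = h1 z \<oplus>\<^bsub>A\<^esub> (r (x z) \<ominus>\<^bsub>A\<^esub> p (e2 (x z)))"
        using z
        by (simp add: r(2) e2(2) a_minus_def h1_simps r_simps p_simps e2_simps x_simps A.M.a_assoc)
    qed
    moreover have "(\<lambda>z. e (d z)) ` carrier X1 \<subseteq> e ` carrier X1" using dc by auto
    moreover have "e (s a0) \<notin> (\<lambda>z. e (d z)) ` carrier X1"
    proof
      assume "e (s a0) \<in> (\<lambda>z. e (d z)) ` carrier X1"
      then obtain z where z: "z \<in> carrier X1" "e (s a0) = e (d z)" by blast
      have "a0 = p (x (e (d z)))" using p(2)[OF a0(1)] z(2) by simp
      also have "\<dots> = \<zero>\<^bsub>A\<^esub>"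
        using z(1) by (simp add: d_def e_simps x_simps s_simps p_simps p(2) A.M.minus_self)
      finally show False using a0(2) by simp
    qed
    moreover have "e (s a0) \<in> e ` carrier X1" using a0(1) by (simp add: s_simps)
    ultimately show False using minimal[of "\<lambda>z. e (d z)"] by blast
  qed
qed

text \<open>Dual to \<open>lift_through_source_almost_split\<close>, but images rather than kernels
  are still minimised, because the descending condition is the one at hand. Let \<open>e\<close> in
  \<open>E\<close> have minimal image and let \<open>r\<close> be a retraction of
  \<open>e h2\<close>. If \<open>r e x\<close> is not a split epimorphism, it lifts along
  \<open>g'\<close>, and right minimality produces a retraction of \<open>(h1, h2)\<close>. If
  \<open>s\<close> is a section of \<open>r e x\<close>, then \<open>e (1 - x s r e)\<close> lies in
  \<open>E\<close> and has smaller image, since \<open>r\<close> annihilates that image but not the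
  image of \<open>e x s\<close>.\<close>

lemma extend_from_target_almost_split:
  assumes S: "almost_split R A f B g C" and S': "almost_split R A' f' B' g' A"
    and X: "fg_module R X1" "fg_module R X2" and dcc: "dcc_below R X2 (carrier X2)"
    and x: "x \<in> lin_hom R X1 X2" and h1: "h1 \<in> lin_hom R B' X1" and h2: "h2 \<in> lin_hom R A X2"
    and comm: "\<And>z. z \<in> carrier B' \<Longrightarrow> x (h1 z) = h2 (g' z)"
    and no_retraction: "\<And>r1 r2. \<lbrakk>r1 \<in> lin_hom R X1 B'; r2 \<in> lin_hom R X2 A;
      \<forall>z\<in>carrier B'. r1 (h1 z) = z; \<forall>a\<in>carrier A. r2 (h2 a) = a;
      \<forall>z\<in>carrier X1. g' (r1 z) = r2 (x z)\<rbrakk> \<Longrightarrow> False"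
  shows "\<exists>p\<in>lin_hom R A X1. \<exists>s\<in>lin_hom R B X2. \<forall>a\<in>carrier A. s (f a) = h2 a \<oplus>\<^bsub>X2\<^esub> x (p a)"
proof (rule ccontr)
  assume no_ext: "\<not> ?thesis"
  have A: "left_module R A" and B': "left_module R B'" and B: "left_module R B"
    and L: "left_almost_split R A f B" and R: "right_almost_split R B' g' A"
    and g': "g' \<in> lin_hom R B' A"
    using S S' by (auto simp: almost_split_def fg_module_def short_exact_def)
  have X1: "left_module R X1" and X2: "left_module R X2" using X by (auto simp: fg_module_def)
  interpret A: left_module R A by (fact A)
  interpret B': left_module R B' by (fact B')
  interpret X1: left_module R X1 by (fact X1)
  interpret X2: left_module R X2 by (fact X2)
  note x_simps = lin_hom_rules[OF X1 X2 x] and h1_simps = lin_hom_rules[OF B' X1 h1]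
    and h2_simps = lin_hom_rules[OF A X2 h2] and g'_simps = lin_hom_rules[OF B' A g']
  obtain a0 where a0: "a0 \<in> carrier A" "a0 \<noteq> \<zero>\<^bsub>A\<^esub>"
    using left_almost_split_nonzero[OF L A B] by blast
  \<comment> \<open>The elements of \<open>E\<close> are the target components of endomorphisms
    \<open>(e1, e)\<close> of the object \<open>x\<close> for which \<open>e h2\<close> differs from
    \<open>h2\<close> by a map \<open>x p\<close>.\<close>
  define E where "E = {e \<in> lin_hom R X2 X2.
    (\<exists>e1\<in>lin_hom R X1 X1. \<forall>z\<in>carrier X1. e (x z) = x (e1 z)) \<and>
    (\<exists>p\<in>lin_hom R A X1. \<forall>a\<in>carrier A. e (h2 a) = h2 a \<oplus>\<^bsub>X2\<^esub> x (p a))}"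
  have "(\<lambda>z. z) \<in> E"
    unfolding E_def
  proof (intro CollectI conjI bexI ballI lin_hom_intros X1)
    show "x z = x z" for z ..
    show "h2 a = h2 a \<oplus>\<^bsub>X2\<^esub> x \<zero>\<^bsub>X1\<^esub>" if "a \<in> carrier A" for a
      using that by (simp add: h2_simps x_simps)
  qed (rule lin_hom_intros X1)+
  then have "(\<lambda>e. e ` carrier X2) ` E \<noteq> {}" by blast
  moreover have "submodule N R X2" if "N \<in> (\<lambda>e. e ` carrier X2) ` E" for N
    using that lin_hom_image_submodule[OF X2 X2] by (auto simp: E_def)
  ultimately have "\<exists>N\<in>(\<lambda>e. e ` carrier X2) ` E. \<forall>N'\<in>(\<lambda>e. e ` carrier X2) ` E. \<not> N' \<subset> N"
    by (intro dcc_below_minimal[OF dcc])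
  then obtain e where eE: "e \<in> E"
    and minimal: "\<And>e'. e' \<in> E \<Longrightarrow> \<not> e' ` carrier X2 \<subset> e ` carrier X2"
    by (simp only: bex_simps ball_simps) blast
  obtain e1 p where e: "e \<in> lin_hom R X2 X2"
    and e1: "e1 \<in> lin_hom R X1 X1" "\<And>z. z \<in> carrier X1 \<Longrightarrow> e (x z) = x (e1 z)"
    and p: "p \<in> lin_hom R A X1" "\<And>a. a \<in> carrier A \<Longrightarrow> e (h2 a) = h2 a \<oplus>\<^bsub>X2\<^esub> x (p a)"
    using eE unfolding E_def by blast
  have "split_mono R A (\<lambda>a. e (h2 a)) X2"
  proof (rule ccontr)
    assume "\<not> ?thesis"
    then obtain s where s: "s \<in> lin_hom R B X2" "\<forall>a\<in>carrier A. s (f a) = e (h2 a)"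
      using left_almost_split_extend[OF L X(2) lin_hom_comp[OF h2 e]] by blast
    have "\<forall>a\<in>carrier A. s (f a) = h2 a \<oplus>\<^bsub>X2\<^esub> x (p a)" using s(2) p(2) by simp
    with s(1) p(1) no_ext show False by blast
  qed
  then obtain r where r: "r \<in> lin_hom R X2 A" "\<And>a. a \<in> carrier A \<Longrightarrow> r (e (h2 a)) = a"
    by (auto simp: split_mono_def)
  note r_simps = lin_hom_rules[OF X2 A r(1)] and e_simps = lin_hom_rules[OF X2 X2 e]
  have re: "(\<lambda>w. r (e w)) \<in> lin_hom R X2 A" and rex: "(\<lambda>z. r (e (x z))) \<in> lin_hom R X1 A"
    by (intro lin_hom_comp[OF e r(1)], intro lin_hom_comp[OF x lin_hom_comp[OF e r(1)]])
  show False
  proof (cases "split_epi R X1 (\<lambda>z. r (e (x z))) A")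
    case False
    then obtain t where t: "t \<in> lin_hom R X1 B'" "\<And>z. z \<in> carrier X1 \<Longrightarrow> g' (t z) = r (e (x z))"
      using right_almost_split_lift[OF R X(1) rex] by blast
    \<comment> \<open>From \<open>g' t h1 = r e x h1 = r e h2 g' = g'\<close>, right minimality
      yields \<open>k\<close> with \<open>k t h1 = 1\<close> and \<open>g' k = g'\<close>; so
      \<open>(k t, r e)\<close> is the forbidden retraction.\<close>
    have "g' (t (h1 y)) = g' y" if "y \<in> carrier B'" for y
      using that by (simp add: t(2) r(2) h1_simps g'_simps comm)
    then obtain k where k: "k \<in> lin_hom R B' B'" "\<forall>y\<in>carrier B'. k (t (h1 y)) = y"
      "\<forall>y\<in>carrier B'. g' (k y) = g' y"
      using almost_split_right_minimal[OF S' lin_hom_comp[OF h1 t(1)]] by blast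
    show False
      by (rule no_retraction[OF lin_hom_comp[OF t(1) k(1)] re])
        (use k t r lin_hom_closed[OF X1 B' t(1)] in auto)
  next
    case True
    then obtain s where s: "s \<in> lin_hom R A X1" "\<And>a. a \<in> carrier A \<Longrightarrow> r (e (x (s a))) = a"
      by (auto simp: split_epi_def)
    note s_simps = lin_hom_rules[OF A X1 s(1)] and e1_simps = lin_hom_rules[OF X1 X1 e1(1)]
      and p_simps = lin_hom_rules[OF A X1 p(1)]
    define d where "d w = w \<ominus>\<^bsub>X2\<^esub> x (s (r (e w)))" for w
    have d: "d \<in> lin_hom R X2 X2"
      unfolding d_def by (intro lin_hom_intros X2 lin_hom_comp[OF lin_hom_comp[OF re s(1)] x])
    have dc: "d w \<in> carrier X2" if "w \<in> carrier X2" for w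
      using lin_hom_closed[OF X2 X2 d that] .
    have "(\<lambda>w. e (d w)) \<in> E"
      unfolding E_def
    proof (intro CollectI conjI bexI ballI)
      show "(\<lambda>w. e (d w)) \<in> lin_hom R X2 X2" by (rule lin_hom_comp[OF d e])
      \<comment> \<open>By \<open>e x = x e1\<close>, the composite \<open>e d x\<close> is
        \<open>x (e1 - e1 s r e x)\<close>, and \<open>r e h2 = 1\<close> gives
        \<open>e d h2 = e h2 - e x s = h2 + x (p - e1 s)\<close>.\<close>
      show "(\<lambda>z. e1 z \<ominus>\<^bsub>X1\<^esub> e1 (s (r (e (x z))))) \<in> lin_hom R X1 X1"
        by (intro lin_hom_intros X1 e1(1) lin_hom_comp[OF lin_hom_comp[OF rex s(1)] e1(1)])
      show "(\<lambda>a. p a \<ominus>\<^bsub>X1\<^esub> e1 (s a)) \<in> lin_hom R A X1"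
        by (intro lin_hom_intros X1 p(1) lin_hom_comp[OF s(1) e1(1)])
    next
      fix z assume z: "z \<in> carrier X1"
      show "e (d (x z)) = x (e1 z \<ominus>\<^bsub>X1\<^esub> e1 (s (r (e (x z)))))"
        using z by (simp add: d_def e_simps x_simps s_simps r_simps e1_simps e1(2))
    next
      fix a assume a: "a \<in> carrier A"
      have "e (d (h2 a)) = e (h2 a) \<ominus>\<^bsub>X2\<^esub> x (e1 (s a))"
        using a by (simp add: d_def e_simps x_simps s_simps h2_simps r(2) flip: e1(2))
      then show "e (d (h2 a)) = h2 a \<oplus>\<^bsub>X2\<^esub> x (p a \<ominus>\<^bsub>X1\<^esub> e1 (s a))"
        using a by (simp add: p(2) x_simps h2_simps p_simps s_simps e1_simps)
          (simp add: a_minus_def h2_simps p_simps s_simps e1_simps x_simps X2.M.a_assoc)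
    qed
    moreover have "(\<lambda>w. e (d w)) ` carrier X2 \<subseteq> e ` carrier X2" using dc by auto
    moreover have "e (x (s a0)) \<notin> (\<lambda>w. e (d w)) ` carrier X2"
    proof
      assume "e (x (s a0)) \<in> (\<lambda>w. e (d w)) ` carrier X2"
      then obtain w where w: "w \<in> carrier X2" "e (x (s a0)) = e (d w)" by blast
      have "a0 = r (e (d w))" using s(2)[OF a0(1)] w(2) by simp
      also have "\<dots> = \<zero>\<^bsub>A\<^esub>"
        using w(1) by (simp add: d_def e_simps x_simps s_simps r_simps s(2) A.M.minus_self)
      finally show False using a0(2) by simp
    qed
    moreover have "e (x (s a0)) \<in> e ` carrier X2" using a0(1) by (simp add: s_simps x_simps)
    ultimately show False using minimal[of "\<lambda>w. e (d w)"] by blast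
  qed
qed


section \<open>Objects of the morphism category as modules over the triangular matrix ring\<close>

lemma dsum_simps [simp]:
  "carrier (dsum M N) = carrier M \<times> carrier N" "\<zero>\<^bsub>dsum M N\<^esub> = (\<zero>\<^bsub>M\<^esub>, \<zero>\<^bsub>N\<^esub>)"
  "(x, y) \<oplus>\<^bsub>dsum M N\<^esub> (x', y') = (x \<oplus>\<^bsub>M\<^esub> x', y \<oplus>\<^bsub>N\<^esub> y')"
  "a \<odot>\<^bsub>dsum M N\<^esub> (x, y) = (a \<odot>\<^bsub>M\<^esub> x, a \<odot>\<^bsub>N\<^esub> y)"
  by (simp_all add: dsum_def)

lemma dsum_left_module:
  assumes "left_module R M" "left_module R N"
  shows "left_module R (dsum M N)"
proof -
  interpret M: left_module R M by fact
  interpret N: left_module R N by fact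
  have "\<exists>u\<in>carrier (dsum M N). u \<oplus>\<^bsub>dsum M N\<^esub> t = \<zero>\<^bsub>dsum M N\<^esub>" if "t \<in> carrier (dsum M N)" for t
    using that
    by (intro bexI[of _ "case t of (x, y) \<Rightarrow> (\<ominus>\<^bsub>M\<^esub> x, \<ominus>\<^bsub>N\<^esub> y)"]) (auto simp: M.M.l_neg N.M.l_neg)
  then have "abelian_group (dsum M N)"
    by (intro abelian_groupI) (auto simp: M.M.a_ac N.M.a_ac)
  then show ?thesis
    by (intro left_module.intro left_module_axioms.intro M.R.ring_axioms)
      (auto simp: M.smult_closed N.smult_closed M.smult_l_distr N.smult_l_distr M.smult_r_distr
        N.smult_r_distr M.smult_assoc1 N.smult_assoc1 M.smult_one N.smult_one)
qed

lemma dsum_fg_module: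
  assumes "fg_module R M" "fg_module R N"
  shows "fg_module R (dsum M N)"
proof -
  have M: "left_module R M" and N: "left_module R N" using assms by (simp_all add: fg_module_def)
  interpret M: left_module R M by (fact M)
  interpret N: left_module R N by (fact N)
  interpret D: left_module R "dsum M N" by (rule dsum_left_module[OF M N])
  obtain S where S: "finite S" "S \<subseteq> carrier M"
    and genM: "\<And>P. submodule P R M \<Longrightarrow> S \<subseteq> P \<Longrightarrow> carrier M \<subseteq> P"
    using assms(1) unfolding fg_module_def fin_gen_iff[OF M] by blast
  obtain T where T: "finite T" "T \<subseteq> carrier N"
    and genN: "\<And>P. submodule P R N \<Longrightarrow> T \<subseteq> P \<Longrightarrow> carrier N \<subseteq> P"
    using assms(2) unfolding fg_module_def fin_gen_iff[OF N] by blast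
  have "fin_gen R (dsum M N)"
    unfolding fin_gen_iff[OF D.left_module_axioms]
  proof (intro exI[of _ "S \<times> {\<zero>\<^bsub>N\<^esub>} \<union> {\<zero>\<^bsub>M\<^esub>} \<times> T"] conjI allI impI)
    fix P assume P: "submodule P R (dsum M N)" and sub: "S \<times> {\<zero>\<^bsub>N\<^esub>} \<union> {\<zero>\<^bsub>M\<^esub>} \<times> T \<subseteq> P"
    have P0: "(\<zero>\<^bsub>M\<^esub>, \<zero>\<^bsub>N\<^esub>) \<in> P" and Padd: "\<And>s t. s \<in> P \<Longrightarrow> t \<in> P \<Longrightarrow> s \<oplus>\<^bsub>dsum M N\<^esub> t \<in> P"
      and Psm: "\<And>a s. a \<in> carrier R \<Longrightarrow> s \<in> P \<Longrightarrow> a \<odot>\<^bsub>dsum M N\<^esub> s \<in> P"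
      using P by (auto simp: D.submodule_iff)
    have "submodule {x \<in> carrier M. (x, \<zero>\<^bsub>N\<^esub>) \<in> P} R M"
      unfolding M.submodule_iff
      using P0 Padd[of "(_, \<zero>\<^bsub>N\<^esub>)" "(_, \<zero>\<^bsub>N\<^esub>)"] Psm[of _ "(_, \<zero>\<^bsub>N\<^esub>)"]
      by (auto simp: N.smult_r_zero M.smult_closed)
    then have 1: "carrier M \<subseteq> {x \<in> carrier M. (x, \<zero>\<^bsub>N\<^esub>) \<in> P}"
      using sub S by (intro genM) auto
    have "submodule {y \<in> carrier N. (\<zero>\<^bsub>M\<^esub>, y) \<in> P} R N"
      unfolding N.submodule_iff
      using P0 Padd[of "(\<zero>\<^bsub>M\<^esub>, _)" "(\<zero>\<^bsub>M\<^esub>, _)"] Psm[of _ "(\<zero>\<^bsub>M\<^esub>, _)"]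
      by (auto simp: M.smult_r_zero N.smult_closed)
    then have 2: "carrier N \<subseteq> {y \<in> carrier N. (\<zero>\<^bsub>M\<^esub>, y) \<in> P}"
      using sub T by (intro genN) auto
    show "carrier (dsum M N) \<subseteq> P"
    proof clarsimp
      fix x y assume "x \<in> carrier M" "y \<in> carrier N"
      then show "(x, y) \<in> P" using 1 2 Padd[of "(x, \<zero>\<^bsub>N\<^esub>)" "(\<zero>\<^bsub>M\<^esub>, y)"] by auto
    qed
  qed (use S T in auto)
  then show ?thesis using D.left_module_axioms by (simp add: fg_module_def)
qed

lemma T2_simps [simp]:
  "carrier (T2 R) = carrier R \<times> carrier R \<times> carrier R"
  "(a, b, c) \<otimes>\<^bsub>T2 R\<^esub> (a', b', c') = (a \<otimes>\<^bsub>R\<^esub> a', (a \<otimes>\<^bsub>R\<^esub> b') \<oplus>\<^bsub>R\<^esub> (b \<otimes>\<^bsub>R\<^esub> c'), c \<otimes>\<^bsub>R\<^esub> c')"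
  "(a, b, c) \<oplus>\<^bsub>T2 R\<^esub> (a', b', c') = (a \<oplus>\<^bsub>R\<^esub> a', b \<oplus>\<^bsub>R\<^esub> b', c \<oplus>\<^bsub>R\<^esub> c')"
  "\<one>\<^bsub>T2 R\<^esub> = (\<one>\<^bsub>R\<^esub>, \<zero>\<^bsub>R\<^esub>, \<one>\<^bsub>R\<^esub>)" "\<zero>\<^bsub>T2 R\<^esub> = (\<zero>\<^bsub>R\<^esub>, \<zero>\<^bsub>R\<^esub>, \<zero>\<^bsub>R\<^esub>)"
  by (simp_all add: T2_def)

lemma T2_module_simps [simp]:
  "carrier (T2_module X) = carrier (tgt X) \<times> carrier (src X)"
  "\<zero>\<^bsub>T2_module X\<^esub> = (\<zero>\<^bsub>tgt X\<^esub>, \<zero>\<^bsub>src X\<^esub>)"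
  "(y, x) \<oplus>\<^bsub>T2_module X\<^esub> (y', x') = (y \<oplus>\<^bsub>tgt X\<^esub> y', x \<oplus>\<^bsub>src X\<^esub> x')"
  "(a, b, c) \<odot>\<^bsub>T2_module X\<^esub> (y, x) =
    ((a \<odot>\<^bsub>tgt X\<^esub> y) \<oplus>\<^bsub>tgt X\<^esub> (b \<odot>\<^bsub>tgt X\<^esub> arr X x), c \<odot>\<^bsub>src X\<^esub> x)"
  by (simp_all add: T2_module_def)

lemma T2_map_apply [simp]: "T2_map h (y, x) = (snd h y, fst h x)"
  by (simp add: T2_map_def)

text \<open>Generators of target and source, placed in their own column entries, suffice:
  multiplication by diagonal matrices already generates each entry separately.\<close>

lemma T2_module_fg_module:
  assumes X: "mor_object R X"
  shows "fg_module (T2 R) (T2_module X)"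
proof -
  have A: "left_module R (src X)" and B: "left_module R (tgt X)"
    and arr: "arr X \<in> lin_hom R (src X) (tgt X)"
    using X by (auto simp: mor_object_def fg_module_def)
  interpret A: left_module R "src X" by (fact A)
  interpret B: left_module R "tgt X" by (fact B)
  interpret T: left_module "T2 R" "T2_module X" by (rule T2_module_left_module[OF X])
  note arr_simps = lin_hom_rules[OF A B arr]
  obtain S where S: "finite S" "S \<subseteq> carrier (src X)"
    and genA: "\<And>P. submodule P R (src X) \<Longrightarrow> S \<subseteq> P \<Longrightarrow> carrier (src X) \<subseteq> P"
    using X unfolding mor_object_def fg_module_def fin_gen_iff[OF A] by blast
  obtain T where T: "finite T" "T \<subseteq> carrier (tgt X)"
    and genB: "\<And>P. submodule P R (tgt X) \<Longrightarrow> T \<subseteq> P \<Longrightarrow> carrier (tgt X) \<subseteq> P"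
    using X unfolding mor_object_def fg_module_def fin_gen_iff[OF B] by blast
  have "fin_gen (T2 R) (T2_module X)"
    unfolding fin_gen_iff[OF T.left_module_axioms]
  proof (intro exI[of _ "T \<times> {\<zero>\<^bsub>src X\<^esub>} \<union> {\<zero>\<^bsub>tgt X\<^esub>} \<times> S"] conjI allI impI)
    fix P assume P: "submodule P (T2 R) (T2_module X)"
      and sub: "T \<times> {\<zero>\<^bsub>src X\<^esub>} \<union> {\<zero>\<^bsub>tgt X\<^esub>} \<times> S \<subseteq> P"
    have P0: "(\<zero>\<^bsub>tgt X\<^esub>, \<zero>\<^bsub>src X\<^esub>) \<in> P"
      and Padd: "\<And>s t. s \<in> P \<Longrightarrow> t \<in> P \<Longrightarrow> s \<oplus>\<^bsub>T2_module X\<^esub> t \<in> P"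
      and Psm: "\<And>a s. a \<in> carrier (T2 R) \<Longrightarrow> s \<in> P \<Longrightarrow> a \<odot>\<^bsub>T2_module X\<^esub> s \<in> P"
      using P by (auto simp: T.submodule_iff simp del: T2_simps)
    have "(a \<odot>\<^bsub>tgt X\<^esub> y, \<zero>\<^bsub>src X\<^esub>) \<in> P"
      if "a \<in> carrier R" "y \<in> carrier (tgt X)" "(y, \<zero>\<^bsub>src X\<^esub>) \<in> P" for a y
      using Psm[of "(a, \<zero>\<^bsub>R\<^esub>, \<zero>\<^bsub>R\<^esub>)" "(y, \<zero>\<^bsub>src X\<^esub>)"] that
      by (simp add: A.smult_r_zero B.smult_closed B.smult_zero arr_simps)
    then have "submodule {y \<in> carrier (tgt X). (y, \<zero>\<^bsub>src X\<^esub>) \<in> P} R (tgt X)"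
      unfolding B.submodule_iff
      using P0 Padd[of "(_, \<zero>\<^bsub>src X\<^esub>)" "(_, \<zero>\<^bsub>src X\<^esub>)"] by (auto simp: B.smult_closed)
    then have 1: "carrier (tgt X) \<subseteq> {y \<in> carrier (tgt X). (y, \<zero>\<^bsub>src X\<^esub>) \<in> P}"
      using sub T by (intro genB) auto
    have "(\<zero>\<^bsub>tgt X\<^esub>, a \<odot>\<^bsub>src X\<^esub> x) \<in> P"
      if "a \<in> carrier R" "x \<in> carrier (src X)" "(\<zero>\<^bsub>tgt X\<^esub>, x) \<in> P" for a x
      using Psm[of "(\<zero>\<^bsub>R\<^esub>, \<zero>\<^bsub>R\<^esub>, a)" "(\<zero>\<^bsub>tgt X\<^esub>, x)"] that by (simp add: B.smult_zero arr_simps)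
    then have "submodule {x \<in> carrier (src X). (\<zero>\<^bsub>tgt X\<^esub>, x) \<in> P} R (src X)"
      unfolding A.submodule_iff
      using P0 Padd[of "(\<zero>\<^bsub>tgt X\<^esub>, _)" "(\<zero>\<^bsub>tgt X\<^esub>, _)"] by (auto simp: A.smult_closed)
    then have 2: "carrier (src X) \<subseteq> {x \<in> carrier (src X). (\<zero>\<^bsub>tgt X\<^esub>, x) \<in> P}"
      using sub S by (intro genA) auto
    show "carrier (T2_module X) \<subseteq> P"
    proof clarsimp
      fix y x assume "y \<in> carrier (tgt X)" "x \<in> carrier (src X)"
      then show "(y, x) \<in> P" using 1 2 Padd[of "(y, \<zero>\<^bsub>src X\<^esub>)" "(\<zero>\<^bsub>tgt X\<^esub>, x)"] by auto
    qed
  qed (use S T in auto)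
  then show ?thesis using T.left_module_axioms by (simp add: fg_module_def)
qed

lemma T2_map_lin_hom:
  assumes X: "mor_object R X" and Y: "mor_object R Y" and h: "h \<in> mor_hom R X Y"
  shows "T2_map h \<in> lin_hom (T2 R) (T2_module X) (T2_module Y)"
proof -
  have mods: "left_module R (src X)" "left_module R (tgt X)"
      "left_module R (src Y)" "left_module R (tgt Y)"
    and arr: "arr X \<in> lin_hom R (src X) (tgt X)"
    using X Y by (auto simp: mor_object_def fg_module_def)
  interpret B: left_module R "tgt X" by (fact mods)
  have h1: "fst h \<in> lin_hom R (src X) (src Y)" and h2: "snd h \<in> lin_hom R (tgt X) (tgt Y)"
    and comm: "\<And>x. x \<in> carrier (src X) \<Longrightarrow> arr Y (fst h x) = snd h (arr X x)"
    using h by (auto simp: mor_hom_def)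
  show ?thesis
    by (auto simp: lin_hom_def[of "T2 R"] comm B.smult_closed lin_hom_rules[OF mods(1,2) arr]
      lin_hom_rules[OF mods(1,3) h1] lin_hom_rules[OF mods(2,4) h2])
qed

text \<open>Fullness of the functor to modules over the matrix ring: linearity for the two diagonal
  idempotents makes \<open>u\<close> act entry by entry, and linearity for the off-diagonal unit is
  the commuting square.\<close>

lemma lin_hom_T2_map:
  assumes X: "mor_object R X" and Y: "mor_object R Y"
    and u: "u \<in> lin_hom (T2 R) (T2_module X) (T2_module Y)"
  shows "\<exists>h\<in>mor_hom R X Y. \<forall>y\<in>carrier (tgt X). \<forall>x\<in>carrier (src X). u (y, x) = (snd h y, fst h x)"
proof -
  have mods: "left_module R (src X)" "left_module R (tgt X)"
      "left_module R (src Y)" "left_module R (tgt Y)"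
    and arr: "arr X \<in> lin_hom R (src X) (tgt X)" "arr Y \<in> lin_hom R (src Y) (tgt Y)"
    using X Y by (auto simp: mor_object_def fg_module_def)
  interpret A: left_module R "src X" by (fact mods)
  interpret B: left_module R "tgt X" by (fact mods)
  interpret C: left_module R "src Y" by (fact mods)
  interpret D: left_module R "tgt Y" by (fact mods)
  note arr_simps = lin_hom_rules[OF mods(1,2) arr(1)] lin_hom_rules[OF mods(3,4) arr(2)]
  note u_rules = lin_hom_rules[OF T2_module_left_module[OF X] T2_module_left_module[OF Y] u]
  define h1 where "h1 x = snd (u (\<zero>\<^bsub>tgt X\<^esub>, x))" for x
  define h2 where "h2 y = fst (u (y, \<zero>\<^bsub>src X\<^esub>))" for y
  have mem: "fst (u (y, x)) \<in> carrier (tgt Y)" "snd (u (y, x)) \<in> carrier (src Y)"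
    if "y \<in> carrier (tgt X)" "x \<in> carrier (src X)" for y x
    using u_rules(1)[of "(y, x)"] that by (auto simp: mem_Times_iff)
  have sm: "u ((a, b, c) \<odot>\<^bsub>T2_module X\<^esub> (y, x)) =
      (a \<odot>\<^bsub>tgt Y\<^esub> fst (u (y, x)) \<oplus>\<^bsub>tgt Y\<^esub> b \<odot>\<^bsub>tgt Y\<^esub> arr Y (snd (u (y, x))), c \<odot>\<^bsub>src Y\<^esub> snd (u (y, x)))"
    if "a \<in> carrier R" "b \<in> carrier R" "c \<in> carrier R" "y \<in> carrier (tgt X)" "x \<in> carrier (src X)"
    for a b c y x
    using u_rules(3)[of "(a, b, c)" "(y, x)"] that by (cases "u (y, x)") auto
  note u_simps = mem A.smult_zero B.smult_zero C.smult_zero D.smult_zero A.smult_one B.smult_one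
    C.smult_one D.smult_one arr_simps A.smult_closed B.smult_closed
  have u_eq: "u (y, x) = (h2 y, h1 x)" if yx: "y \<in> carrier (tgt X)" "x \<in> carrier (src X)" for y x
  proof -
    have "u (y, \<zero>\<^bsub>src X\<^esub>) = (fst (u (y, x)), \<zero>\<^bsub>src Y\<^esub>)"
      using sm[of "\<one>\<^bsub>R\<^esub>" "\<zero>\<^bsub>R\<^esub>" "\<zero>\<^bsub>R\<^esub>" y x] yx by (simp add: u_simps)
    moreover have "u (\<zero>\<^bsub>tgt X\<^esub>, x) = (\<zero>\<^bsub>tgt Y\<^esub>, snd (u (y, x)))"
      using sm[of "\<zero>\<^bsub>R\<^esub>" "\<zero>\<^bsub>R\<^esub>" "\<one>\<^bsub>R\<^esub>" y x] yx by (simp add: u_simps)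
    ultimately show ?thesis by (simp add: h1_def h2_def)
  qed
  have "h1 \<in> lin_hom R (src X) (src Y)"
    unfolding lin_hom_def
  proof (intro CollectI conjI ballI funcsetI)
    fix x x' assume x: "x \<in> carrier (src X)" "x' \<in> carrier (src X)"
    show "h1 (x \<oplus>\<^bsub>src X\<^esub> x') = h1 x \<oplus>\<^bsub>src Y\<^esub> h1 x'"
      using u_rules(2)[of "(\<zero>\<^bsub>tgt X\<^esub>, x)" "(\<zero>\<^bsub>tgt X\<^esub>, x')"] x by (simp add: u_eq)
  next
    fix a x assume "a \<in> carrier R" "x \<in> carrier (src X)"
    then show "h1 (a \<odot>\<^bsub>src X\<^esub> x) = a \<odot>\<^bsub>src Y\<^esub> h1 x"
      using sm[of "\<zero>\<^bsub>R\<^esub>" "\<zero>\<^bsub>R\<^esub>" a "\<zero>\<^bsub>tgt X\<^esub>" x] by (simp add: u_eq u_simps)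
  qed (simp add: h1_def mem)
  moreover have "h2 \<in> lin_hom R (tgt X) (tgt Y)"
    unfolding lin_hom_def
  proof (intro CollectI conjI ballI funcsetI)
    fix y y' assume y: "y \<in> carrier (tgt X)" "y' \<in> carrier (tgt X)"
    show "h2 (y \<oplus>\<^bsub>tgt X\<^esub> y') = h2 y \<oplus>\<^bsub>tgt Y\<^esub> h2 y'"
      using u_rules(2)[of "(y, \<zero>\<^bsub>src X\<^esub>)" "(y', \<zero>\<^bsub>src X\<^esub>)"] y by (simp add: u_eq)
  next
    fix a y assume ay: "a \<in> carrier R" "y \<in> carrier (tgt X)"
    have "h1 \<zero>\<^bsub>src X\<^esub> \<in> carrier (src Y)" "h2 y \<in> carrier (tgt Y)"
      using ay by (simp_all add: h1_def h2_def mem)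
    then show "h2 (a \<odot>\<^bsub>tgt X\<^esub> y) = a \<odot>\<^bsub>tgt Y\<^esub> h2 y"
      using sm[of a "\<zero>\<^bsub>R\<^esub>" "\<zero>\<^bsub>R\<^esub>" y "\<zero>\<^bsub>src X\<^esub>"] ay by (simp add: u_eq u_simps D.smult_closed)
  qed (simp add: h2_def mem)
  \<comment> \<open>The off-diagonal unit sends the column with entries 0 and \<open>x\<close> to
    the one with entries \<open>arr X x\<close> and 0; comparing upper entries after applying
    \<open>u\<close> gives the square.\<close>
  moreover have "arr Y (h1 x) = h2 (arr X x)" if x: "x \<in> carrier (src X)" for x
  proof -
    have "h1 x \<in> carrier (src Y)" "h2 \<zero>\<^bsub>tgt X\<^esub> \<in> carrier (tgt Y)"
      using x by (simp_all add: h1_def h2_def mem)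
    then show ?thesis
      using sm[of "\<zero>\<^bsub>R\<^esub>" "\<one>\<^bsub>R\<^esub>" "\<zero>\<^bsub>R\<^esub>" "\<zero>\<^bsub>tgt X\<^esub>" x] x by (simp add: u_eq u_simps)
  qed
  ultimately have "(h1, h2) \<in> mor_hom R X Y" by (simp add: mor_hom_def)
  then show ?thesis using u_eq by (intro bexI[of _ "(h1, h2)"]) auto
qed

lemma lin_hom_inverse:
  assumes M: "left_module R M" and N: "left_module R N" and h: "h \<in> lin_hom R M N"
    and k: "k \<in> carrier N \<rightarrow> carrier M"
    and kh: "\<And>x. x \<in> carrier M \<Longrightarrow> k (h x) = x" and hk: "\<And>y. y \<in> carrier N \<Longrightarrow> h (k y) = y"
  shows "k \<in> lin_hom R N M"
proof -
  interpret M: left_module R M by (fact M)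
  interpret N: left_module R N by (fact N)
  note h_simps = lin_hom_rules[OF M N h]
  have kc: "k y \<in> carrier M" if "y \<in> carrier N" for y using k that by blast
  show ?thesis
    unfolding lin_hom_def
  proof (intro CollectI conjI ballI k)
    fix y y' assume "y \<in> carrier N" "y' \<in> carrier N"
    then show "k (y \<oplus>\<^bsub>N\<^esub> y') = k y \<oplus>\<^bsub>M\<^esub> k y'"
      using kh[of "k y \<oplus>\<^bsub>M\<^esub> k y'"] by (simp add: h_simps kc hk)
  next
    fix a y assume "a \<in> carrier R" "y \<in> carrier N"
    then show "k (a \<odot>\<^bsub>N\<^esub> y) = a \<odot>\<^bsub>M\<^esub> k y"
      using kh[of "a \<odot>\<^bsub>M\<^esub> k y"] by (simp add: h_simps kc hk M.smult_closed)
  qed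
qed

text \<open>Source and target are the parts cut out by the two diagonal idempotents, and the matrix unit off
  the diagonal acts as the arrow.\<close>

definition T2_object :: "('r, 'e) ring_scheme \<Rightarrow> ('r \<times> 'r \<times> 'r, 'm) module \<Rightarrow> ('r, 'm, 'm) mor_obj" where
  "T2_object R M = \<lparr>
    src = \<lparr>carrier = {x \<in> carrier M. (\<zero>\<^bsub>R\<^esub>, \<zero>\<^bsub>R\<^esub>, \<one>\<^bsub>R\<^esub>) \<odot>\<^bsub>M\<^esub> x = x}, mult = mult M, one = one M,
      zero = zero M, add = add M, smult = (\<lambda>a x. (\<zero>\<^bsub>R\<^esub>, \<zero>\<^bsub>R\<^esub>, a) \<odot>\<^bsub>M\<^esub> x)\<rparr>,
    tgt = \<lparr>carrier = {y \<in> carrier M. (\<one>\<^bsub>R\<^esub>, \<zero>\<^bsub>R\<^esub>, \<zero>\<^bsub>R\<^esub>) \<odot>\<^bsub>M\<^esub> y = y}, mult = mult M, one = one M,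
      zero = zero M, add = add M, smult = (\<lambda>a y. (a, \<zero>\<^bsub>R\<^esub>, \<zero>\<^bsub>R\<^esub>) \<odot>\<^bsub>M\<^esub> y)\<rparr>,
    arr = (\<lambda>x. (\<zero>\<^bsub>R\<^esub>, \<one>\<^bsub>R\<^esub>, \<zero>\<^bsub>R\<^esub>) \<odot>\<^bsub>M\<^esub> x)\<rparr>"

lemma T2_object_simps [simp]:
  "carrier (src (T2_object R M)) = {x \<in> carrier M. (\<zero>\<^bsub>R\<^esub>, \<zero>\<^bsub>R\<^esub>, \<one>\<^bsub>R\<^esub>) \<odot>\<^bsub>M\<^esub> x = x}"
  "carrier (tgt (T2_object R M)) = {y \<in> carrier M. (\<one>\<^bsub>R\<^esub>, \<zero>\<^bsub>R\<^esub>, \<zero>\<^bsub>R\<^esub>) \<odot>\<^bsub>M\<^esub> y = y}"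
  "\<zero>\<^bsub>src (T2_object R M)\<^esub> = \<zero>\<^bsub>M\<^esub>" "\<zero>\<^bsub>tgt (T2_object R M)\<^esub> = \<zero>\<^bsub>M\<^esub>"
  "add (src (T2_object R M)) = add M" "add (tgt (T2_object R M)) = add M"
  "smult (src (T2_object R M)) a x = (\<zero>\<^bsub>R\<^esub>, \<zero>\<^bsub>R\<^esub>, a) \<odot>\<^bsub>M\<^esub> x"
  "smult (tgt (T2_object R M)) a x = (a, \<zero>\<^bsub>R\<^esub>, \<zero>\<^bsub>R\<^esub>) \<odot>\<^bsub>M\<^esub> x"
  "arr (T2_object R M) x = (\<zero>\<^bsub>R\<^esub>, \<one>\<^bsub>R\<^esub>, \<zero>\<^bsub>R\<^esub>) \<odot>\<^bsub>M\<^esub> x"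
  by (simp_all add: T2_object_def)

text \<open>Density of the functor, by the Peirce decomposition: each element is the sum of its
  images under the two diagonal idempotents. Both carriers are subsets of that of \<open>M\<close>,
  so the object keeps the element type of the test modules.\<close>

lemma T2_module_representative:
  fixes R :: "('r, 'e) ring_scheme" and M :: "('r \<times> 'r \<times> 'r, 'm) module"
  assumes R: "ring R" and M: "fg_module (T2 R) M"
  shows "\<exists>(X :: ('r, 'm, 'm) mor_obj) h k. mor_object R X \<and> h \<in> lin_hom (T2 R) M (T2_module X) \<and>
    k \<in> lin_hom (T2 R) (T2_module X) M \<and>
    (\<forall>x\<in>carrier M. k (h x) = x) \<and> (\<forall>y\<in>carrier (T2_module X). h (k y) = y)"
proof -
  interpret R: ring R by (fact R)
  have Mm: "left_module (T2 R) M" using M by (rule fg_left_module)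
  interpret M: left_module "T2 R" M by (fact Mm)
  define X where "X = T2_object R M"
  note X_simps = T2_object_simps[of R M, folded X_def]
  have sm_add: "t \<odot>\<^bsub>M\<^esub> (x \<oplus>\<^bsub>M\<^esub> y) = t \<odot>\<^bsub>M\<^esub> x \<oplus>\<^bsub>M\<^esub> t \<odot>\<^bsub>M\<^esub> y"
    if "t \<in> carrier R \<times> carrier R \<times> carrier R" "x \<in> carrier M" "y \<in> carrier M" for t x y
    using that by (auto intro: M.smult_r_distr)
  have sm: "t \<odot>\<^bsub>M\<^esub> x \<in> carrier M" "t \<odot>\<^bsub>M\<^esub> (\<ominus>\<^bsub>M\<^esub> x) = \<ominus>\<^bsub>M\<^esub> (t \<odot>\<^bsub>M\<^esub> x)"
    if "t \<in> carrier R \<times> carrier R \<times> carrier R" "x \<in> carrier M" for t x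
    using that by (auto intro: M.smult_closed M.smult_r_neg)
  have sm_zero: "t \<odot>\<^bsub>M\<^esub> \<zero>\<^bsub>M\<^esub> = \<zero>\<^bsub>M\<^esub>" if "t \<in> carrier R \<times> carrier R \<times> carrier R" for t
    using that by (auto intro: M.smult_r_zero)
  have assoc: "(a, b, c) \<odot>\<^bsub>M\<^esub> ((a', b', c') \<odot>\<^bsub>M\<^esub> x) =
      (a \<otimes>\<^bsub>R\<^esub> a', (a \<otimes>\<^bsub>R\<^esub> b') \<oplus>\<^bsub>R\<^esub> (b \<otimes>\<^bsub>R\<^esub> c'), c \<otimes>\<^bsub>R\<^esub> c') \<odot>\<^bsub>M\<^esub> x"
    if "x \<in> carrier M" "a \<in> carrier R" "b \<in> carrier R" "c \<in> carrier R"
      "a' \<in> carrier R" "b' \<in> carrier R" "c' \<in> carrier R" for a b c a' b' c' x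
    using M.smult_assoc1[of "(a, b, c)" "(a', b', c')" x] that by simp
  have ladd: "(a, b, c) \<odot>\<^bsub>M\<^esub> x \<oplus>\<^bsub>M\<^esub> (a', b', c') \<odot>\<^bsub>M\<^esub> x =
      (a \<oplus>\<^bsub>R\<^esub> a', b \<oplus>\<^bsub>R\<^esub> b', c \<oplus>\<^bsub>R\<^esub> c') \<odot>\<^bsub>M\<^esub> x"
    if "x \<in> carrier M" "a \<in> carrier R" "b \<in> carrier R" "c \<in> carrier R"
      "a' \<in> carrier R" "b' \<in> carrier R" "c' \<in> carrier R" for a b c a' b' c' x
    using M.smult_l_distr[of "(a, b, c)" "(a', b', c')" x] that by simp
  have one: "(\<one>\<^bsub>R\<^esub>, \<zero>\<^bsub>R\<^esub>, \<one>\<^bsub>R\<^esub>) \<odot>\<^bsub>M\<^esub> x = x" if "x \<in> carrier M" for x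
    using M.smult_one[OF that] by simp
  have zero: "(\<zero>\<^bsub>R\<^esub>, \<zero>\<^bsub>R\<^esub>, \<zero>\<^bsub>R\<^esub>) \<odot>\<^bsub>M\<^esub> x = \<zero>\<^bsub>M\<^esub>" if "x \<in> carrier M" for x
    using M.smult_zero[OF that] by simp
  have "abelian_group (src X)"
  proof (rule abelian_groupI)
    fix x assume "x \<in> carrier (src X)"
    then show "\<exists>y\<in>carrier (src X). y \<oplus>\<^bsub>src X\<^esub> x = \<zero>\<^bsub>src X\<^esub>"
      by (intro bexI[of _ "\<ominus>\<^bsub>M\<^esub> x"]) (auto simp: X_simps sm sm_zero sm_add M.M.l_neg)
  qed (auto simp: X_simps sm sm_zero sm_add M.M.a_ac)
  then have src: "left_module R (src X)"
    by (intro left_module.intro left_module_axioms.intro R)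
      (auto simp: X_simps sm sm_zero sm_add assoc ladd)
  have "abelian_group (tgt X)"
  proof (rule abelian_groupI)
    fix x assume "x \<in> carrier (tgt X)"
    then show "\<exists>y\<in>carrier (tgt X). y \<oplus>\<^bsub>tgt X\<^esub> x = \<zero>\<^bsub>tgt X\<^esub>"
      by (intro bexI[of _ "\<ominus>\<^bsub>M\<^esub> x"]) (auto simp: X_simps sm sm_zero sm_add M.M.l_neg)
  qed (auto simp: X_simps sm sm_zero sm_add M.M.a_ac)
  then have tgt: "left_module R (tgt X)"
    by (intro left_module.intro left_module_axioms.intro R)
      (auto simp: X_simps sm sm_zero sm_add assoc ladd)
  interpret A: left_module R "src X" by (fact src)
  interpret B: left_module R "tgt X" by (fact tgt)
  obtain S where S: "finite S" "S \<subseteq> carrier M"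
    and gen: "\<And>P. submodule P (T2 R) M \<Longrightarrow> S \<subseteq> P \<Longrightarrow> carrier M \<subseteq> P"
    using M unfolding fg_module_def fin_gen_iff[OF Mm] by blast
  have "fin_gen R (src X)"
    unfolding fin_gen_iff[OF src]
  proof (intro exI[of _ "(\<lambda>x. (\<zero>\<^bsub>R\<^esub>, \<zero>\<^bsub>R\<^esub>, \<one>\<^bsub>R\<^esub>) \<odot>\<^bsub>M\<^esub> x) ` S"] conjI allI impI)
    show "(\<lambda>x. (\<zero>\<^bsub>R\<^esub>, \<zero>\<^bsub>R\<^esub>, \<one>\<^bsub>R\<^esub>) \<odot>\<^bsub>M\<^esub> x) ` S \<subseteq> carrier (src X)"
      using S by (auto simp: X_simps sm sm_zero sm_add assoc subset_iff)
    fix P assume P: "submodule P R (src X)" and SP: "(\<lambda>x. (\<zero>\<^bsub>R\<^esub>, \<zero>\<^bsub>R\<^esub>, \<one>\<^bsub>R\<^esub>) \<odot>\<^bsub>M\<^esub> x) ` S \<subseteq> P"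
    have P0: "\<zero>\<^bsub>M\<^esub> \<in> P" and Padd: "\<And>x y. x \<in> P \<Longrightarrow> y \<in> P \<Longrightarrow> x \<oplus>\<^bsub>M\<^esub> y \<in> P"
      and Psm: "\<And>a x. a \<in> carrier R \<Longrightarrow> x \<in> P \<Longrightarrow> (\<zero>\<^bsub>R\<^esub>, \<zero>\<^bsub>R\<^esub>, a) \<odot>\<^bsub>M\<^esub> x \<in> P"
      using P by (auto simp: A.submodule_iff X_simps)
    have "submodule {x \<in> carrier M. (\<zero>\<^bsub>R\<^esub>, \<zero>\<^bsub>R\<^esub>, \<one>\<^bsub>R\<^esub>) \<odot>\<^bsub>M\<^esub> x \<in> P} (T2 R) M"
      unfolding M.submodule_iff
    proof (intro conjI ballI)
      fix t x assume t: "t \<in> carrier (T2 R)" and x: "x \<in> {x \<in> carrier M. (\<zero>\<^bsub>R\<^esub>, \<zero>\<^bsub>R\<^esub>, \<one>\<^bsub>R\<^esub>) \<odot>\<^bsub>M\<^esub> x \<in> P}"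
      obtain a b c where abc: "t = (a, b, c)" "a \<in> carrier R" "b \<in> carrier R" "c \<in> carrier R"
        using t by auto
      show "t \<odot>\<^bsub>M\<^esub> x \<in> {x \<in> carrier M. (\<zero>\<^bsub>R\<^esub>, \<zero>\<^bsub>R\<^esub>, \<one>\<^bsub>R\<^esub>) \<odot>\<^bsub>M\<^esub> x \<in> P}"
        using x abc Psm[of c "(\<zero>\<^bsub>R\<^esub>, \<zero>\<^bsub>R\<^esub>, \<one>\<^bsub>R\<^esub>) \<odot>\<^bsub>M\<^esub> x"] by (simp add: sm sm_add assoc)
    qed (use P0 Padd in \<open>auto simp: sm sm_zero sm_add\<close>)
    then have "carrier M \<subseteq> {x \<in> carrier M. (\<zero>\<^bsub>R\<^esub>, \<zero>\<^bsub>R\<^esub>, \<one>\<^bsub>R\<^esub>) \<odot>\<^bsub>M\<^esub> x \<in> P}"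
      using S SP by (intro gen) auto
    then show "carrier (src X) \<subseteq> P" by (force simp: X_simps)
  qed (use S in auto)
  moreover have "fin_gen R (tgt X)"
    unfolding fin_gen_iff[OF tgt]
  \<comment> \<open>The upper entry of \<open>(a, b, c) x\<close> is \<open>a\<close> times
    \<open>(1, 0, 0) x\<close> plus \<open>b\<close> times \<open>(0, 1, 0) x\<close>. Hence the
    target needs the images of \<open>S\<close> under both elements of the first matrix row, whereas
    the source needs only one.\<close>
  proof (intro exI[of _ "(\<lambda>x. (\<one>\<^bsub>R\<^esub>, \<zero>\<^bsub>R\<^esub>, \<zero>\<^bsub>R\<^esub>) \<odot>\<^bsub>M\<^esub> x) ` S \<union> (\<lambda>x. (\<zero>\<^bsub>R\<^esub>, \<one>\<^bsub>R\<^esub>, \<zero>\<^bsub>R\<^esub>) \<odot>\<^bsub>M\<^esub> x) ` S"]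
      conjI allI impI)
    show "(\<lambda>x. (\<one>\<^bsub>R\<^esub>, \<zero>\<^bsub>R\<^esub>, \<zero>\<^bsub>R\<^esub>) \<odot>\<^bsub>M\<^esub> x) ` S \<union> (\<lambda>x. (\<zero>\<^bsub>R\<^esub>, \<one>\<^bsub>R\<^esub>, \<zero>\<^bsub>R\<^esub>) \<odot>\<^bsub>M\<^esub> x) ` S \<subseteq> carrier (tgt X)"
      using S by (auto simp: X_simps sm sm_zero sm_add assoc subset_iff)
    fix P assume P: "submodule P R (tgt X)"
      and SP: "(\<lambda>x. (\<one>\<^bsub>R\<^esub>, \<zero>\<^bsub>R\<^esub>, \<zero>\<^bsub>R\<^esub>) \<odot>\<^bsub>M\<^esub> x) ` S \<union> (\<lambda>x. (\<zero>\<^bsub>R\<^esub>, \<one>\<^bsub>R\<^esub>, \<zero>\<^bsub>R\<^esub>) \<odot>\<^bsub>M\<^esub> x) ` S \<subseteq> P"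
    have P0: "\<zero>\<^bsub>M\<^esub> \<in> P" and Padd: "\<And>x y. x \<in> P \<Longrightarrow> y \<in> P \<Longrightarrow> x \<oplus>\<^bsub>M\<^esub> y \<in> P"
      and Psm: "\<And>a x. a \<in> carrier R \<Longrightarrow> x \<in> P \<Longrightarrow> (a, \<zero>\<^bsub>R\<^esub>, \<zero>\<^bsub>R\<^esub>) \<odot>\<^bsub>M\<^esub> x \<in> P"
      using P by (auto simp: B.submodule_iff X_simps)
    let ?Q = "{x \<in> carrier M. (\<one>\<^bsub>R\<^esub>, \<zero>\<^bsub>R\<^esub>, \<zero>\<^bsub>R\<^esub>) \<odot>\<^bsub>M\<^esub> x \<in> P \<and> (\<zero>\<^bsub>R\<^esub>, \<one>\<^bsub>R\<^esub>, \<zero>\<^bsub>R\<^esub>) \<odot>\<^bsub>M\<^esub> x \<in> P}"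
    have "submodule ?Q (T2 R) M"
      unfolding M.submodule_iff
    proof (intro conjI ballI)
      fix t x assume t: "t \<in> carrier (T2 R)" and x: "x \<in> ?Q"
      obtain a b c where abc: "t = (a, b, c)" "a \<in> carrier R" "b \<in> carrier R" "c \<in> carrier R"
        using t by auto
      have xP: "x \<in> carrier M" "(\<one>\<^bsub>R\<^esub>, \<zero>\<^bsub>R\<^esub>, \<zero>\<^bsub>R\<^esub>) \<odot>\<^bsub>M\<^esub> x \<in> P"
        "(\<zero>\<^bsub>R\<^esub>, \<one>\<^bsub>R\<^esub>, \<zero>\<^bsub>R\<^esub>) \<odot>\<^bsub>M\<^esub> x \<in> P"
        using x by auto
      have "(a, \<zero>\<^bsub>R\<^esub>, \<zero>\<^bsub>R\<^esub>) \<odot>\<^bsub>M\<^esub> ((\<one>\<^bsub>R\<^esub>, \<zero>\<^bsub>R\<^esub>, \<zero>\<^bsub>R\<^esub>) \<odot>\<^bsub>M\<^esub> x) \<oplus>\<^bsub>M\<^esub>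
          (b, \<zero>\<^bsub>R\<^esub>, \<zero>\<^bsub>R\<^esub>) \<odot>\<^bsub>M\<^esub> ((\<zero>\<^bsub>R\<^esub>, \<one>\<^bsub>R\<^esub>, \<zero>\<^bsub>R\<^esub>) \<odot>\<^bsub>M\<^esub> x) \<in> P"
        by (rule Padd[OF Psm[OF abc(2) xP(2)] Psm[OF abc(3) xP(3)]])
      moreover have "(c, \<zero>\<^bsub>R\<^esub>, \<zero>\<^bsub>R\<^esub>) \<odot>\<^bsub>M\<^esub> ((\<zero>\<^bsub>R\<^esub>, \<one>\<^bsub>R\<^esub>, \<zero>\<^bsub>R\<^esub>) \<odot>\<^bsub>M\<^esub> x) \<in> P"
        by (rule Psm[OF abc(4) xP(3)])
      ultimately show "t \<odot>\<^bsub>M\<^esub> x \<in> ?Q"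
        using x abc by (simp add: sm sm_add assoc ladd)
    qed (use P0 Padd in \<open>auto simp: sm sm_zero sm_add\<close>)
    then have "carrier M \<subseteq> ?Q" using S SP by (intro gen) auto
    then show "carrier (tgt X) \<subseteq> P" by (force simp: X_simps)
  qed (use S in auto)
  moreover have "arr X \<in> lin_hom R (src X) (tgt X)"
    by (auto simp: lin_hom_def X_simps sm sm_add assoc)
  ultimately have X: "mor_object R X"
    using src tgt by (simp add: mor_object_def fg_module_def)
  define h where "h x = ((\<one>\<^bsub>R\<^esub>, \<zero>\<^bsub>R\<^esub>, \<zero>\<^bsub>R\<^esub>) \<odot>\<^bsub>M\<^esub> x, (\<zero>\<^bsub>R\<^esub>, \<zero>\<^bsub>R\<^esub>, \<one>\<^bsub>R\<^esub>) \<odot>\<^bsub>M\<^esub> x)" for x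
  define k where "k = (\<lambda>(y, x). y \<oplus>\<^bsub>M\<^esub> x)"
  have h: "h \<in> lin_hom (T2 R) M (T2_module X)"
    by (auto simp: lin_hom_def h_def X_simps sm sm_add assoc ladd)
  have kh: "k (h x) = x" if "x \<in> carrier M" for x
    using that by (simp add: k_def h_def ladd one)
  have hk: "h (k z) = z" if zX: "z \<in> carrier (T2_module X)" for z
  proof -
    obtain y x where z: "z = (y, x)" and y: "y \<in> carrier M" "(\<one>\<^bsub>R\<^esub>, \<zero>\<^bsub>R\<^esub>, \<zero>\<^bsub>R\<^esub>) \<odot>\<^bsub>M\<^esub> y = y"
      and x: "x \<in> carrier M" "(\<zero>\<^bsub>R\<^esub>, \<zero>\<^bsub>R\<^esub>, \<one>\<^bsub>R\<^esub>) \<odot>\<^bsub>M\<^esub> x = x"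
      using zX by (auto simp: X_simps)
    have "(\<zero>\<^bsub>R\<^esub>, \<zero>\<^bsub>R\<^esub>, \<one>\<^bsub>R\<^esub>) \<odot>\<^bsub>M\<^esub> y = \<zero>\<^bsub>M\<^esub>"
      using assoc[of y "\<zero>\<^bsub>R\<^esub>" "\<zero>\<^bsub>R\<^esub>" "\<one>\<^bsub>R\<^esub>" "\<one>\<^bsub>R\<^esub>" "\<zero>\<^bsub>R\<^esub>" "\<zero>\<^bsub>R\<^esub>"] y by (simp add: zero)
    moreover have "(\<one>\<^bsub>R\<^esub>, \<zero>\<^bsub>R\<^esub>, \<zero>\<^bsub>R\<^esub>) \<odot>\<^bsub>M\<^esub> x = \<zero>\<^bsub>M\<^esub>"
      using assoc[of x "\<one>\<^bsub>R\<^esub>" "\<zero>\<^bsub>R\<^esub>" "\<zero>\<^bsub>R\<^esub>" "\<zero>\<^bsub>R\<^esub>" "\<zero>\<^bsub>R\<^esub>" "\<one>\<^bsub>R\<^esub>"] x by (simp add: zero)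
    ultimately show ?thesis using x y by (simp add: z k_def h_def sm sm_add)
  qed
  have "k \<in> lin_hom (T2 R) (T2_module X) M"
    by (rule lin_hom_inverse[OF Mm T2_module_left_module[OF X] h _ kh hk]) (auto simp: k_def X_simps)
  with X h kh hk show ?thesis by (intro exI[of _ X] exI[of _ h] exI[of _ k]) simp
qed

section \<open>Splitting and almost splitting tested inside the morphism category\<close>

definition mor_split_mono ::
  "('r, 'e) ring_scheme \<Rightarrow> ('r, 'a, 'b) mor_obj \<Rightarrow> ('a \<Rightarrow> 'c) \<times> ('b \<Rightarrow> 'd) \<Rightarrow> ('r, 'c, 'd) mor_obj \<Rightarrow> bool"
where
  "mor_split_mono R X h Y \<longleftrightarrow> (\<exists>k\<in>mor_hom R Y X.
    (\<forall>x\<in>carrier (src X). fst k (fst h x) = x) \<and> (\<forall>y\<in>carrier (tgt X). snd k (snd h y) = y))"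

definition mor_split_epi ::
  "('r, 'e) ring_scheme \<Rightarrow> ('r, 'a, 'b) mor_obj \<Rightarrow> ('a \<Rightarrow> 'c) \<times> ('b \<Rightarrow> 'd) \<Rightarrow> ('r, 'c, 'd) mor_obj \<Rightarrow> bool"
where
  "mor_split_epi R X h Y \<longleftrightarrow> (\<exists>k\<in>mor_hom R Y X.
    (\<forall>x\<in>carrier (src Y). fst h (fst k x) = x) \<and> (\<forall>y\<in>carrier (tgt Y). snd h (snd k y) = y))"

lemma mor_hom_closed:
  assumes "h \<in> mor_hom R X Y"
  shows "x \<in> carrier (src X) \<Longrightarrow> fst h x \<in> carrier (src Y)"
    and "y \<in> carrier (tgt X) \<Longrightarrow> snd h y \<in> carrier (tgt Y)"
  using assms by (auto simp: mor_hom_def lin_hom_def)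

lemma mor_split_mono_imp_split_mono:
  assumes X: "mor_object R X" and Y: "mor_object R Y" and h: "h \<in> mor_hom R X Y"
    and split: "mor_split_mono R X h Y"
  shows "split_mono (T2 R) (T2_module X) (T2_map h) (T2_module Y)"
proof -
  obtain k where k: "k \<in> mor_hom R Y X" "\<forall>x\<in>carrier (src X). fst k (fst h x) = x"
    "\<forall>y\<in>carrier (tgt X). snd k (snd h y) = y"
    using split unfolding mor_split_mono_def by blast
  show ?thesis
    unfolding split_mono_def
    by (intro conjI T2_map_lin_hom[OF X Y h] bexI[OF _ T2_map_lin_hom[OF Y X k(1)]])
      (auto simp: k(2,3))
qed

lemma split_mono_imp_mor_split_mono:
  assumes X: "mor_object R X" and Y: "mor_object R Y" and h: "h \<in> mor_hom R X Y"
    and split: "split_mono (T2 R) (T2_module X) (T2_map h) (T2_module Y)"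
  shows "mor_split_mono R X h Y"
proof -
  obtain r where r: "r \<in> lin_hom (T2 R) (T2_module Y) (T2_module X)"
    and r_eq: "\<forall>z\<in>carrier (T2_module X). r (T2_map h z) = z"
    using split unfolding split_mono_def by blast
  obtain k where k: "k \<in> mor_hom R Y X"
    and k_eq: "\<forall>y\<in>carrier (tgt Y). \<forall>x\<in>carrier (src Y). r (y, x) = (snd k y, fst k x)"
    using lin_hom_T2_map[OF Y X r] by blast
  interpret A: left_module R "src X" using X by (simp add: mor_object_def fg_module_def)
  interpret B: left_module R "tgt X" using X by (simp add: mor_object_def fg_module_def)
  have eq: "snd k (snd h y) = y \<and> fst k (fst h x) = x"
    if "y \<in> carrier (tgt X)" "x \<in> carrier (src X)" for y x
    using bspec[OF r_eq, of "(y, x)"] that k_eq mor_hom_closed[OF h] by simp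
  \<comment> \<open>\<open>eq\<close> speaks of both entries of a column at once; each half is
    isolated by putting zero into the other entry.\<close>
  show ?thesis
    unfolding mor_split_mono_def
    by (intro bexI[OF _ k] conjI ballI) (use eq A.M.zero_closed B.M.zero_closed in blast)+
qed

lemma mor_split_epi_imp_split_epi:
  assumes X: "mor_object R X" and Y: "mor_object R Y" and h: "h \<in> mor_hom R X Y"
    and split: "mor_split_epi R X h Y"
  shows "split_epi (T2 R) (T2_module X) (T2_map h) (T2_module Y)"
proof -
  obtain k where k: "k \<in> mor_hom R Y X" "\<forall>x\<in>carrier (src Y). fst h (fst k x) = x"
    "\<forall>y\<in>carrier (tgt Y). snd h (snd k y) = y"
    using split unfolding mor_split_epi_def by blast
  show ?thesis
    unfolding split_epi_def
    by (intro conjI T2_map_lin_hom[OF X Y h] bexI[OF _ T2_map_lin_hom[OF Y X k(1)]])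
      (auto simp: k(2,3))
qed

lemma split_epi_imp_mor_split_epi:
  assumes X: "mor_object R X" and Y: "mor_object R Y" and h: "h \<in> mor_hom R X Y"
    and split: "split_epi (T2 R) (T2_module X) (T2_map h) (T2_module Y)"
  shows "mor_split_epi R X h Y"
proof -
  obtain r where r: "r \<in> lin_hom (T2 R) (T2_module Y) (T2_module X)"
    and r_eq: "\<forall>z\<in>carrier (T2_module Y). T2_map h (r z) = z"
    using split unfolding split_epi_def by blast
  obtain k where k: "k \<in> mor_hom R Y X"
    and k_eq: "\<forall>y\<in>carrier (tgt Y). \<forall>x\<in>carrier (src Y). r (y, x) = (snd k y, fst k x)"
    using lin_hom_T2_map[OF Y X r] by blast
  interpret A: left_module R "src Y" using Y by (simp add: mor_object_def fg_module_def)
  interpret B: left_module R "tgt Y" using Y by (simp add: mor_object_def fg_module_def)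
  have eq: "snd h (snd k y) = y \<and> fst h (fst k x) = x"
    if "y \<in> carrier (tgt Y)" "x \<in> carrier (src Y)" for y x
    using bspec[OF r_eq, of "(y, x)"] that k_eq by simp
  show ?thesis
    unfolding mor_split_epi_def
    by (intro bexI[OF _ k] conjI ballI) (use eq A.M.zero_closed B.M.zero_closed in blast)+
qed

text \<open>Reduces the test against modules to a test against objects: a test module
  \<open>M\<close> is replaced by an isomorphic column module, and fullness turns maps into it into
  morphisms. The element type of \<open>Z\<close> is that of the test modules over the matrix
  ring.\<close>

lemma left_almost_split_T2_map:
  fixes R :: "('r, 'e) ring_scheme" and X :: "('r, 'a, 'b) mor_obj"
  assumes R: "ring R" and X: "mor_object R X" and Y: "mor_object R Y" and h: "h \<in> mor_hom R X Y"
    and not_split: "\<not> mor_split_mono R X h Y"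
    and ext: "\<And>(Z :: ('r, (nat \<Rightarrow> 'r \<times> 'r \<times> 'r) set, (nat \<Rightarrow> 'r \<times> 'r \<times> 'r) set) mor_obj) u.
      \<lbrakk>mor_object R Z; u \<in> mor_hom R X Z; \<not> mor_split_mono R X u Z\<rbrakk> \<Longrightarrow>
      \<exists>v\<in>mor_hom R Y Z. (\<forall>x\<in>carrier (src X). fst v (fst h x) = fst u x) \<and>
        (\<forall>y\<in>carrier (tgt X). snd v (snd h y) = snd u y)"
  shows "left_almost_split (T2 R) (T2_module X) (T2_map h) (T2_module Y)"
  unfolding left_almost_split_def
proof (intro conjI allI impI)
  show "T2_map h \<in> lin_hom (T2 R) (T2_module X) (T2_module Y)" by (rule T2_map_lin_hom[OF X Y h])
  show "\<not> split_mono (T2 R) (T2_module X) (T2_map h) (T2_module Y)"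
    using not_split split_mono_imp_mor_split_mono[OF X Y h] by blast
next
  fix M :: "('r \<times> 'r \<times> 'r, (nat \<Rightarrow> 'r \<times> 'r \<times> 'r) set) module" and u
  assume "fg_module (T2 R) M \<and> u \<in> lin_hom (T2 R) (T2_module X) M \<and>
    \<not> split_mono (T2 R) (T2_module X) u M"
  then have M: "fg_module (T2 R) M" and u: "u \<in> lin_hom (T2 R) (T2_module X) M"
    and nu: "\<not> split_mono (T2 R) (T2_module X) u M" by auto
  obtain Z :: "('r, (nat \<Rightarrow> 'r \<times> 'r \<times> 'r) set, (nat \<Rightarrow> 'r \<times> 'r \<times> 'r) set) mor_obj" and i k
    where Z: "mor_object R Z" and i: "i \<in> lin_hom (T2 R) M (T2_module Z)"
      and k: "k \<in> lin_hom (T2 R) (T2_module Z) M" and ki: "\<forall>x\<in>carrier M. k (i x) = x"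
    using T2_module_representative[OF R M] by blast
  have uc: "u z \<in> carrier M" if "z \<in> carrier (T2_module X)" for z
    using u that unfolding lin_hom_def by blast
  obtain w where w: "w \<in> mor_hom R X Z"
    and w_eq: "\<forall>y\<in>carrier (tgt X). \<forall>x\<in>carrier (src X). i (u (y, x)) = (snd w y, fst w x)"
    using lin_hom_T2_map[OF X Z lin_hom_comp[OF u i]] by blast
  have "\<not> mor_split_mono R X w Z"
  proof
    assume "mor_split_mono R X w Z"
    then obtain r where r: "r \<in> lin_hom (T2 R) (T2_module Z) (T2_module X)"
      "\<forall>z\<in>carrier (T2_module X). r (T2_map w z) = z"
      using mor_split_mono_imp_split_mono[OF X Z w] unfolding split_mono_def by blast
    have "split_mono (T2 R) (T2_module X) u M"
      unfolding split_mono_def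
      by (intro conjI u bexI[OF _ lin_hom_comp[OF i r(1)]]) (use w_eq r(2) in auto)
    with nu show False ..
  qed
  then obtain v where v: "v \<in> mor_hom R Y Z"
    "\<forall>x\<in>carrier (src X). fst v (fst h x) = fst w x"
    "\<forall>y\<in>carrier (tgt X). snd v (snd h y) = snd w y"
    using ext[OF Z w] by blast
  have "k (T2_map v (T2_map h z)) = u z" if z: "z \<in> carrier (T2_module X)" for z
  proof -
    obtain y x where yx: "z = (y, x)" "y \<in> carrier (tgt X)" "x \<in> carrier (src X)" using z by auto
    have "T2_map v (T2_map h z) = i (u z)" using yx v w_eq by simp
    then show ?thesis using ki uc[OF z] by simp
  qed
  then show "\<exists>v\<in>lin_hom (T2 R) (T2_module Y) M. \<forall>x\<in>carrier (T2_module X). v (T2_map h x) = u x"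
    by (intro bexI[OF _ lin_hom_comp[OF T2_map_lin_hom[OF Y Z v(1)] k]] ballI)
qed

text \<open>The same reduction for maps out of a test module: precomposition with \<open>k\<close>
  makes \<open>u\<close> a morphism \<open>w\<close>, and a lift of \<open>w\<close> precomposed
  with \<open>i\<close> lifts \<open>u\<close>.\<close>

lemma right_almost_split_T2_map:
  fixes R :: "('r, 'e) ring_scheme" and Y :: "('r, 'a, 'b) mor_obj"
  assumes R: "ring R" and X: "mor_object R X" and Y: "mor_object R Y" and h: "h \<in> mor_hom R X Y"
    and not_split: "\<not> mor_split_epi R X h Y"
    and lift: "\<And>(Z :: ('r, (nat \<Rightarrow> 'r \<times> 'r \<times> 'r) set, (nat \<Rightarrow> 'r \<times> 'r \<times> 'r) set) mor_obj) u.
      \<lbrakk>mor_object R Z; u \<in> mor_hom R Z Y; \<not> mor_split_epi R Z u Y\<rbrakk> \<Longrightarrow>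
      \<exists>v\<in>mor_hom R Z X. (\<forall>x\<in>carrier (src Z). fst h (fst v x) = fst u x) \<and>
        (\<forall>y\<in>carrier (tgt Z). snd h (snd v y) = snd u y)"
  shows "right_almost_split (T2 R) (T2_module X) (T2_map h) (T2_module Y)"
  unfolding right_almost_split_def
proof (intro conjI allI impI)
  show "T2_map h \<in> lin_hom (T2 R) (T2_module X) (T2_module Y)" by (rule T2_map_lin_hom[OF X Y h])
  show "\<not> split_epi (T2 R) (T2_module X) (T2_map h) (T2_module Y)"
    using not_split split_epi_imp_mor_split_epi[OF X Y h] by blast
next
  fix M :: "('r \<times> 'r \<times> 'r, (nat \<Rightarrow> 'r \<times> 'r \<times> 'r) set) module" and u
  assume "fg_module (T2 R) M \<and> u \<in> lin_hom (T2 R) M (T2_module Y) \<and>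
    \<not> split_epi (T2 R) M u (T2_module Y)"
  then have M: "fg_module (T2 R) M" and u: "u \<in> lin_hom (T2 R) M (T2_module Y)"
    and nu: "\<not> split_epi (T2 R) M u (T2_module Y)" by auto
  obtain Z :: "('r, (nat \<Rightarrow> 'r \<times> 'r \<times> 'r) set, (nat \<Rightarrow> 'r \<times> 'r \<times> 'r) set) mor_obj" and i k
    where Z: "mor_object R Z" and i: "i \<in> lin_hom (T2 R) M (T2_module Z)"
      and k: "k \<in> lin_hom (T2 R) (T2_module Z) M" and ki: "\<forall>x\<in>carrier M. k (i x) = x"
    using T2_module_representative[OF R M] by blast
  have ic: "i x \<in> carrier (T2_module Z)" if "x \<in> carrier M" for x
    using i that unfolding lin_hom_def by blast
  obtain w where w: "w \<in> mor_hom R Z Y"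
    and w_eq: "\<forall>y\<in>carrier (tgt Z). \<forall>x\<in>carrier (src Z). u (k (y, x)) = (snd w y, fst w x)"
    using lin_hom_T2_map[OF Z Y lin_hom_comp[OF k u]] by blast
  have w_map: "u (k z) = T2_map w z" if "z \<in> carrier (T2_module Z)" for z
    using that w_eq by auto
  have "\<not> mor_split_epi R Z w Y"
  proof
    assume "mor_split_epi R Z w Y"
    then obtain r where r: "r \<in> lin_hom (T2 R) (T2_module Y) (T2_module Z)"
      "\<forall>z\<in>carrier (T2_module Y). T2_map w (r z) = z"
      using mor_split_epi_imp_split_epi[OF Z Y w] unfolding split_epi_def by blast
    have "r z \<in> carrier (T2_module Z)" if "z \<in> carrier (T2_module Y)" for z
      using r(1) that unfolding lin_hom_def by blast
    then have "\<forall>z\<in>carrier (T2_module Y). u (k (r z)) = z"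
      using w_map r(2) by simp
    then have "split_epi (T2 R) M u (T2_module Y)"
      unfolding split_epi_def by (intro conjI u bexI[OF _ lin_hom_comp[OF r(1) k]])
    with nu show False ..
  qed
  then obtain v where v: "v \<in> mor_hom R Z X"
    "\<forall>x\<in>carrier (src Z). fst h (fst v x) = fst w x"
    "\<forall>y\<in>carrier (tgt Z). snd h (snd v y) = snd w y"
    using lift[OF Z w] by blast
  have "T2_map h (T2_map v (i m)) = u m" if m: "m \<in> carrier M" for m
  proof -
    obtain y x where yx: "i m = (y, x)" "y \<in> carrier (tgt Z)" "x \<in> carrier (src Z)"
      using ic[OF m] by auto
    have "T2_map h (T2_map v (i m)) = u (k (i m))" using yx v w_eq by simp
    then show ?thesis using ki m by simp
  qed
  then show "\<exists>v\<in>lin_hom (T2 R) M (T2_module X). \<forall>x\<in>carrier M. T2_map h (v x) = u x"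
    by (intro bexI[OF _ lin_hom_comp[OF i T2_map_lin_hom[OF Z X v(1)]]] ballI)
qed


section \<open>Two consecutive almost split sequences\<close>

lemma (in abelian_group) neg_add_cancel:
  "\<lbrakk>x \<in> carrier G; y \<in> carrier G\<rbrakk> \<Longrightarrow> \<ominus> x \<oplus> (y \<oplus> x) = y"
  by (simp add: a_comm[of y x] r_neg1)

lemma lin_hom_pair:
  "u \<in> lin_hom R M N \<Longrightarrow> v \<in> lin_hom R M P \<Longrightarrow> (\<lambda>x. (u x, v x)) \<in> lin_hom R M (dsum N P)"
  by (auto simp: lin_hom_def)

lemma lin_hom_copair:
  assumes "left_module R P" "u \<in> lin_hom R M P" "v \<in> lin_hom R N P"
  shows "(\<lambda>(x, y). u x \<oplus>\<^bsub>P\<^esub> v y) \<in> lin_hom R (dsum M N) P"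
proof -
  interpret P: left_module R P by fact
  show ?thesis using assms(2,3) by (auto simp: lin_hom_def Pi_iff P.smult_r_distr P.M.a_ac)
qed

lemma lin_hom_fst: "fst \<in> lin_hom R (dsum M N) M"
  and lin_hom_snd: "snd \<in> lin_hom R (dsum M N) N"
  by (auto simp: lin_hom_def)

text \<open>An idempotent with an inverse on either side is the identity. Right minimality of
  \<open>g'\<close> gives \<open>e1\<close> a left inverse, left minimality of \<open>f\<close>
  gives \<open>e2\<close> a right inverse.\<close>

lemma minimal_idempotents_ident:
  assumes S: "almost_split R A f B g C" and S': "almost_split R A' f' B' g' A"
    and e1: "e1 \<in> lin_hom R B' B'" "\<And>z. z \<in> carrier B' \<Longrightarrow> e1 (e1 z) = e1 z"
      "\<And>z. z \<in> carrier B' \<Longrightarrow> g' (e1 z) = g' z"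
    and e2: "e2 \<in> lin_hom R B B" "\<And>y. y \<in> carrier B \<Longrightarrow> e2 (e2 y) = e2 y"
      "\<And>a. a \<in> carrier A \<Longrightarrow> e2 (f a) = f a"
  shows "(\<forall>z\<in>carrier B'. e1 z = z) \<and> (\<forall>y\<in>carrier B. e2 y = y)"
proof -
  have "e1 z \<in> carrier B'" if "z \<in> carrier B'" for z using e1(1) that by (auto simp: lin_hom_def)
  moreover obtain k where "\<forall>z\<in>carrier B'. k (e1 z) = z"
    using almost_split_right_minimal[OF S' e1(1,3)] by blast
  ultimately have "\<forall>z\<in>carrier B'. e1 z = z" using e1(2) by metis
  moreover obtain l where "l \<in> lin_hom R B B" "\<forall>y\<in>carrier B. e2 (l y) = y"
    using almost_split_left_minimal[OF S e2(1,3)] by blast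
  then have "\<forall>y\<in>carrier B. e2 y = y" using e2(2) by (auto simp: lin_hom_def Pi_iff) metis
  ultimately show ?thesis by blast
qed

lemma composite_idempotent_trivial:
  assumes S: "almost_split R A f B g C" and S': "almost_split R A' f' B' g' A"
    and e1: "e1 \<in> lin_hom R B' B'" "\<And>z. z \<in> carrier B' \<Longrightarrow> e1 (e1 z) = e1 z"
    and e2: "e2 \<in> lin_hom R B B" "\<And>y. y \<in> carrier B \<Longrightarrow> e2 (e2 y) = e2 y"
    and comm: "\<And>z. z \<in> carrier B' \<Longrightarrow> f (g' (e1 z)) = e2 (f (g' z))"
  shows "(\<forall>z\<in>carrier B'. e1 z = \<zero>\<^bsub>B'\<^esub>) \<and> (\<forall>y\<in>carrier B. e2 y = \<zero>\<^bsub>B\<^esub>) \<or>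
    (\<forall>z\<in>carrier B'. e1 z = z) \<and> (\<forall>y\<in>carrier B. e2 y = y)"
proof -
  have A: "left_module R A" and B: "left_module R B" and B': "left_module R B'" and fgA: "fg_module R A"
    and R: "right_almost_split R B' g' A"
    and f: "f \<in> lin_hom R A B" and g': "g' \<in> lin_hom R B' A"
    and inj: "inj_on f (carrier A)" and surj: "g' ` carrier B' = carrier A"
    using S S' by (auto simp: almost_split_def fg_module_def short_exact_def)
  interpret A: left_module R A by (fact A)
  interpret B: left_module R B by (fact B)
  interpret B': left_module R B' by (fact B')
  note f_simps = lin_hom_rules[OF A B f] and g'_simps = lin_hom_rules[OF B' A g']
    and e1_simps = lin_hom_rules[OF B' B' e1(1)] and e2_simps = lin_hom_rules[OF B B e2(1)]
  \<comment> \<open>As \<open>f\<close> is injective and \<open>f g' e1 = e2 f g'\<close>, the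
    idempotent \<open>e1\<close> preserves the kernel of \<open>g'\<close> and so descends to
    \<open>e0\<close> on \<open>A\<close>.\<close>
  have "g' (e1 z) = \<zero>\<^bsub>A\<^esub>" if "z \<in> carrier B'" "g' z = \<zero>\<^bsub>A\<^esub>" for z
  proof (rule inj_onD[OF inj])
    show "f (g' (e1 z)) = f \<zero>\<^bsub>A\<^esub>" using that by (simp add: comm f_simps e2_simps)
  qed (use that in \<open>simp_all add: g'_simps e1_simps\<close>)
  then obtain e0 where e0: "e0 \<in> lin_hom R A A" and e0_g': "\<forall>z\<in>carrier B'. e0 (g' z) = g' (e1 z)"
    using hom_factors_through_epi[OF B' A A g' lin_hom_comp[OF e1(1) g'] surj] by blast
  have im: "\<exists>z\<in>carrier B'. a = g' z" if "a \<in> carrier A" for a using surj that by blast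
  have "e0 (e0 a) = e0 a" if "a \<in> carrier A" for a
    using im[OF that] e0_g' e1(2) by (auto simp: e1_simps)
  then consider "\<forall>a\<in>carrier A. e0 a = \<zero>\<^bsub>A\<^esub>" | "\<forall>a\<in>carrier A. e0 a = a"
    using right_almost_split_idempotent[OF R B' fgA e0] by blast
  then show ?thesis
  proof cases
    case 1
    have g'_e1: "g' (e1 z) = \<zero>\<^bsub>A\<^esub>" if "z \<in> carrier B'" for z
      using that 1 e0_g' by (simp add: g'_simps)
    have e2_f: "e2 (f a) = \<zero>\<^bsub>B\<^esub>" if "a \<in> carrier A" for a
      using im[OF that] by (auto simp: g'_e1 f_simps simp flip: comm)
    \<comment> \<open>When \<open>e0\<close> is zero, the complementary idempotents
      \<open>1 - e1\<close> and \<open>1 - e2\<close> leave \<open>g'\<close> and \<open>f\<close>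
      unchanged, so minimality is applied to them.\<close>
    have *: "(\<forall>z\<in>carrier B'. z \<ominus>\<^bsub>B'\<^esub> e1 z = z) \<and> (\<forall>y\<in>carrier B. y \<ominus>\<^bsub>B\<^esub> e2 y = y)"
    proof (rule minimal_idempotents_ident[OF S S'])
      show "(\<lambda>z. z \<ominus>\<^bsub>B'\<^esub> e1 z) \<in> lin_hom R B' B'" by (intro lin_hom_intros B' e1(1))
      show "(\<lambda>y. y \<ominus>\<^bsub>B\<^esub> e2 y) \<in> lin_hom R B B" by (intro lin_hom_intros B e2(1))
    qed (simp_all add: e1_simps e2_simps g'_simps f_simps e1(2) e2(2) g'_e1 e2_f
        A.M.minus_self B.M.minus_self B'.M.minus_self,
        simp_all add: a_minus_def e1_simps e2_simps g'_simps f_simps)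
    have "e1 z = \<zero>\<^bsub>B'\<^esub>" if "z \<in> carrier B'" for z
      using bspec[OF conjunct1[OF *] that] that by (simp add: B'.M.minus_eq_iff e1_simps)
    moreover have "e2 y = \<zero>\<^bsub>B\<^esub>" if "y \<in> carrier B" for y
      using bspec[OF conjunct2[OF *] that] that by (simp add: B.M.minus_eq_iff e2_simps)
    ultimately show ?thesis by blast
  next
    case 2
    have "g' (e1 z) = g' z" if "z \<in> carrier B'" for z
      using that 2 e0_g' by (simp add: g'_simps)
    moreover have "e2 (f a) = f a" if "a \<in> carrier A" for a
      using im[OF that] calculation by (auto simp flip: comm)
    ultimately show ?thesis
      using minimal_idempotents_ident[OF S S' e1 _ e2] by blast
  qed
qed

text \<open>Turns a decomposition into an idempotent: \<open>e\<close> is the projection onto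
  \<open>Y\<close> along \<open>Z\<close>, carried over to \<open>M\<close>. Since \<open>k\<close>
  embeds the sum, \<open>e\<close> can vanish only if \<open>Y\<close> does and be the identity only
  if \<open>Z\<close> is zero.\<close>

lemma dsum_projection:
  assumes M: "left_module R M" and Y: "left_module R Y" and Z: "left_module R Z"
    and h: "h \<in> lin_hom R M (dsum Y Z)" and k: "k \<in> lin_hom R (dsum Y Z) M"
    and "\<forall>w\<in>carrier (dsum Y Z). h (k w) = w"
  defines "e \<equiv> \<lambda>x. k (fst (h x), \<zero>\<^bsub>Z\<^esub>)"
  shows "e \<in> lin_hom R M M" "x \<in> carrier M \<Longrightarrow> e (e x) = e x"
    "\<forall>x\<in>carrier M. e x = \<zero>\<^bsub>M\<^esub> \<Longrightarrow> carrier Y = {\<zero>\<^bsub>Y\<^esub>}"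
    "\<forall>x\<in>carrier M. e x = x \<Longrightarrow> carrier Z = {\<zero>\<^bsub>Z\<^esub>}"
proof -
  interpret Y: left_module R Y by (fact Y)
  interpret Z: left_module R Z by (fact Z)
  have D: "left_module R (dsum Y Z)" by (rule dsum_left_module[OF Y Z])
  have hk: "h (k w) = w" if "w \<in> carrier (dsum Y Z)" for w using assms(6) that by (rule bspec)
  note h_simps = lin_hom_rules[OF M D h] and k_simps = lin_hom_rules[OF D M k]
  show "e \<in> lin_hom R M M"
    unfolding e_def
    by (intro lin_hom_comp[OF lin_hom_pair k] lin_hom_comp[OF h lin_hom_fst] lin_hom_const_zero[OF Z])
  have hc: "fst (h x) \<in> carrier Y" if "x \<in> carrier M" for x
    using h_simps(1)[OF that] by (auto simp: mem_Times_iff)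
  show "e (e x) = e x" if "x \<in> carrier M"
    using hc[OF that] by (simp add: e_def hk)
  have kc: "k w \<in> carrier M" if "w \<in> carrier (dsum Y Z)" for w using k_simps(1)[OF that] .
  show "carrier Y = {\<zero>\<^bsub>Y\<^esub>}" if e0: "\<forall>x\<in>carrier M. e x = \<zero>\<^bsub>M\<^esub>"
  proof -
    have "y = \<zero>\<^bsub>Y\<^esub>" if y: "y \<in> carrier Y" for y
    proof -
      have w: "(y, \<zero>\<^bsub>Z\<^esub>) \<in> carrier (dsum Y Z)" using y by simp
      have "k (y, \<zero>\<^bsub>Z\<^esub>) = \<zero>\<^bsub>M\<^esub>" using bspec[OF e0 kc[OF w]] by (simp add: e_def hk[OF w])
      then have "(y, \<zero>\<^bsub>Z\<^esub>) = (\<zero>\<^bsub>Y\<^esub>, \<zero>\<^bsub>Z\<^esub>)" using hk[OF w] h_simps(4) by simp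
      then show ?thesis by simp
    qed
    then show ?thesis by auto
  qed
  show "carrier Z = {\<zero>\<^bsub>Z\<^esub>}" if e1: "\<forall>x\<in>carrier M. e x = x"
  proof -
    have "z = \<zero>\<^bsub>Z\<^esub>" if z: "z \<in> carrier Z" for z
    proof -
      have w: "(\<zero>\<^bsub>Y\<^esub>, z) \<in> carrier (dsum Y Z)" using z by simp
      have "k (\<zero>\<^bsub>Y\<^esub>, \<zero>\<^bsub>Z\<^esub>) = k (\<zero>\<^bsub>Y\<^esub>, z)" using bspec[OF e1 kc[OF w]] by (simp add: e_def hk[OF w])
      then have "(\<zero>\<^bsub>Y\<^esub>, \<zero>\<^bsub>Z\<^esub>) = (\<zero>\<^bsub>Y\<^esub>, z)"
        using hk[OF w] hk[of "(\<zero>\<^bsub>Y\<^esub>, \<zero>\<^bsub>Z\<^esub>)"] by simp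
      then show ?thesis by simp
    qed
    then show ?thesis by auto
  qed
qed

text \<open>The projections onto the first summand, on source and target, commute with
  \<open>f g'\<close> because both isomorphisms are morphisms of the category, so
  \<open>composite_idempotent_trivial\<close> decides which summand vanishes. The object is nonzero
  since \<open>f\<close> embeds the nonzero module \<open>A\<close> into \<open>B\<close>.\<close>

lemma composite_indecomposable:
  fixes R :: "('r, 'e) ring_scheme"
  assumes S: "almost_split R A f B g C" and S': "almost_split R A' f' B' g' A"
  shows "mor_indecomposable R \<lparr>src = B', tgt = B, arr = f \<circ> g'\<rparr>"
proof -
  let ?X = "\<lparr>src = B', tgt = B, arr = f \<circ> g'\<rparr>"
  have fg: "fg_module R A" "fg_module R B" "fg_module R B'" and L: "left_almost_split R A f B"
    and f: "f \<in> lin_hom R A B" and g': "g' \<in> lin_hom R B' A" and inj: "inj_on f (carrier A)"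
    using S S' by (auto simp: almost_split_def short_exact_def)
  have A: "left_module R A" and B: "left_module R B" and B': "left_module R B'"
    using fg by (auto simp: fg_module_def)
  interpret A: left_module R A by (fact A)
  have X: "mor_object R ?X"
    using fg lin_hom_comp[OF g' f] by (simp add: mor_object_def comp_def)
  have "\<not> mor_zero ?X"
  proof
    assume "mor_zero ?X"
    then have B0: "carrier B = {\<zero>\<^bsub>B\<^esub>}" by (simp add: mor_zero_def)
    obtain a where a: "a \<in> carrier A" "a \<noteq> \<zero>\<^bsub>A\<^esub>" using left_almost_split_nonzero[OF L A B] by blast
    have "f a = f \<zero>\<^bsub>A\<^esub>"
      using lin_hom_closed[OF A B f a(1)] lin_hom_zero[OF A B f] by (simp add: B0)
    then show False using inj_onD[OF inj _ a(1) A.M.zero_closed] a(2) by blast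
  qed
  moreover have "mor_zero Y \<or> mor_zero Z"
    if Y: "mor_object R Y" and Z: "mor_object R Z" and iso: "mor_iso R ?X (mor_dsum Y Z)"
    for Y Z :: "('r, (nat \<Rightarrow> 'r) set, (nat \<Rightarrow> 'r) set) mor_obj"
  proof -
    have mods: "left_module R (src Y)" "left_module R (tgt Y)"
        "left_module R (src Z)" "left_module R (tgt Z)"
      and arrZ: "arr Z \<in> lin_hom R (src Z) (tgt Z)"
      using Y Z by (auto simp: mor_object_def fg_module_def)
    obtain h1 h2 k1 k2 where h: "(h1, h2) \<in> mor_hom R ?X (mor_dsum Y Z)"
      and k: "(k1, k2) \<in> mor_hom R (mor_dsum Y Z) ?X"
      and hk: "\<forall>y\<in>carrier (src (mor_dsum Y Z)). h1 (k1 y) = y"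
        "\<forall>y\<in>carrier (tgt (mor_dsum Y Z)). h2 (k2 y) = y"
      using iso unfolding mor_iso_def by blast
    have h1: "h1 \<in> lin_hom R B' (dsum (src Y) (src Z))" and h2: "h2 \<in> lin_hom R B (dsum (tgt Y) (tgt Z))"
      and h_comm: "\<And>x. x \<in> carrier B' \<Longrightarrow> map_prod (arr Y) (arr Z) (h1 x) = h2 (f (g' x))"
      using h by (auto simp: mor_hom_def mor_dsum_def)
    have k1: "k1 \<in> lin_hom R (dsum (src Y) (src Z)) B'" and k2: "k2 \<in> lin_hom R (dsum (tgt Y) (tgt Z)) B"
      and k_comm: "\<And>x. x \<in> carrier (dsum (src Y) (src Z)) \<Longrightarrow>
        f (g' (k1 x)) = k2 (map_prod (arr Y) (arr Z) x)"
      using k by (auto simp: mor_hom_def mor_dsum_def)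
    have hk': "\<forall>w\<in>carrier (dsum (src Y) (src Z)). h1 (k1 w) = w"
      "\<forall>w\<in>carrier (dsum (tgt Y) (tgt Z)). h2 (k2 w) = w"
      using hk by (simp_all add: mor_dsum_def)
    define e1 where "e1 x = k1 (fst (h1 x), \<zero>\<^bsub>src Z\<^esub>)" for x
    define e2 where "e2 x = k2 (fst (h2 x), \<zero>\<^bsub>tgt Z\<^esub>)" for x
    note p1 = dsum_projection[OF B' mods(1,3) h1 k1 hk'(1), folded e1_def]
    note p2 = dsum_projection[OF B mods(2,4) h2 k2 hk'(2), folded e2_def]
    interpret Z1: left_module R "src Z" by (fact mods)
    have comm: "f (g' (e1 x)) = e2 (f (g' x))" if x: "x \<in> carrier B'" for x
    proof -
      have h1x: "fst (h1 x) \<in> carrier (src Y)"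
        using lin_hom_closed[OF B' dsum_left_module[OF mods(1,3)] h1 x] by (auto simp: mem_Times_iff)
      have "f (g' (e1 x)) = k2 (arr Y (fst (h1 x)), arr Z \<zero>\<^bsub>src Z\<^esub>)"
        unfolding e1_def using h1x by (subst k_comm) auto
      also have "\<dots> = e2 (f (g' x))"
        by (simp add: e2_def lin_hom_zero[OF mods(3,4) arrZ] flip: h_comm[OF x])
      finally show ?thesis .
    qed
    have "(\<forall>z\<in>carrier B'. e1 z = \<zero>\<^bsub>B'\<^esub>) \<and> (\<forall>y\<in>carrier B. e2 y = \<zero>\<^bsub>B\<^esub>) \<or>
        (\<forall>z\<in>carrier B'. e1 z = z) \<and> (\<forall>y\<in>carrier B. e2 y = y)"
      by (rule composite_idempotent_trivial[OF S S' p1(1,2) p2(1,2) comm])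
    then show ?thesis
    proof (elim disjE conjE)
      assume "\<forall>z\<in>carrier B'. e1 z = \<zero>\<^bsub>B'\<^esub>" "\<forall>y\<in>carrier B. e2 y = \<zero>\<^bsub>B\<^esub>"
      then show ?thesis using p1(3) p2(3) by (simp add: mor_zero_def)
    next
      assume "\<forall>z\<in>carrier B'. e1 z = z" "\<forall>y\<in>carrier B. e2 y = y"
      then show ?thesis using p1(4) p2(4) by (simp add: mor_zero_def)
    qed
  qed
  ultimately show ?thesis using X by (simp add: mor_indecomposable_def)
qed

section \<open>Exactness and almost splitness of the sequence of objects\<close>

locale two_almost_split_sequences =
  fixes K :: "('k, 'd) ring_scheme" and \<eta> :: "'k \<Rightarrow> 'r" and R :: "('r, 'e) ring_scheme"
    and A :: "('r, 'a) module" and B :: "('r, 'b) module" and C :: "('r, 'c) module"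
    and A' :: "('r, 'p) module" and B' :: "('r, 'q) module"
    and f :: "'a \<Rightarrow> 'b" and g :: "'b \<Rightarrow> 'c" and f' :: "'p \<Rightarrow> 'q" and g' :: "'q \<Rightarrow> 'a"
  assumes artin: "artin_algebra K \<eta> R"
    and S: "almost_split R A f B g C"
    and S': "almost_split R A' f' B' g' A"
begin

abbreviation X where "X \<equiv> \<lparr>src = B', tgt = A, arr = g'\<rparr>"
abbreviation Y where
  "Y \<equiv> mor_dsum \<lparr>src = A, tgt = A, arr = (\<lambda>a. a)\<rparr> \<lparr>src = B', tgt = B, arr = f \<circ> g'\<rparr>"
abbreviation Z where "Z \<equiv> \<lparr>src = A, tgt = B, arr = f\<rparr>"
abbreviation \<phi> where "\<phi> \<equiv> (\<lambda>x. (g' x, x), \<lambda>a. (a, f a))"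
abbreviation \<psi> where
  "\<psi> \<equiv> (\<lambda>(a, x). \<ominus>\<^bsub>A\<^esub> a \<oplus>\<^bsub>A\<^esub> g' x, \<lambda>(a, b). \<ominus>\<^bsub>B\<^esub> f a \<oplus>\<^bsub>B\<^esub> b)"

lemma ring: "ring R"
  using artin by (simp add: artin_algebra_def)

lemma fg: "fg_module R A" "fg_module R B" "fg_module R B'"
  and L: "left_almost_split R A f B" and R: "right_almost_split R B' g' A"
  and f: "f \<in> lin_hom R A B" and g': "g' \<in> lin_hom R B' A"
  and inj: "inj_on f (carrier A)" and surj: "g' ` carrier B' = carrier A"
  using S S' by (auto simp: almost_split_def short_exact_def)

lemma A: "left_module R A" and B: "left_module R B" and B': "left_module R B'"
  using fg by (auto simp: fg_module_def)

sublocale A: left_module R A by (fact A)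
sublocale B: left_module R B by (fact B)
sublocale B': left_module R B' by (fact B')

lemmas f_simps = lin_hom_rules[OF A B f]
lemmas g'_simps = lin_hom_rules[OF B' A g']

lemma Y_simps [simp]:
  "src Y = dsum A B'" "tgt Y = dsum A B" "arr Y = map_prod (\<lambda>a. a) (f \<circ> g')"
  by (simp_all add: mor_dsum_def)

lemma X: "mor_object R X" and Z: "mor_object R Z"
  using fg f g' by (simp_all add: mor_object_def)

lemma Y: "mor_object R Y"
  unfolding mor_object_def Y_simps
proof (intro conjI dsum_fg_module fg)
  show "map_prod (\<lambda>a. a) (f \<circ> g') \<in> lin_hom R (dsum A B') (dsum A B)"
    by (auto simp: lin_hom_def f_simps g'_simps)
qed

lemma phi_mor_hom: "\<phi> \<in> mor_hom R X Y"
  using lin_hom_pair[OF g' lin_hom_ident] lin_hom_pair[OF lin_hom_ident f]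
  by (simp add: mor_hom_def)

lemma psi_mor_hom: "\<psi> \<in> mor_hom R Y Z"
  using lin_hom_copair[OF A lin_hom_uminus[OF A lin_hom_ident] g']
    lin_hom_copair[OF B lin_hom_uminus[OF B f] lin_hom_ident]
  by (auto simp: mor_hom_def f_simps g'_simps)

lemma sequence_short_exact:
  "short_exact (T2 R) (T2_module X) (T2_map \<phi>) (T2_module Y) (T2_map \<psi>) (T2_module Z)"
  unfolding short_exact_def
proof (intro conjI T2_map_lin_hom X Y Z phi_mor_hom psi_mor_hom)
  show "inj_on (T2_map \<phi>) (carrier (T2_module X))"
    by (auto simp: inj_on_def)
  have iff: "\<ominus>\<^bsub>A\<^esub> a \<oplus>\<^bsub>A\<^esub> a' = \<zero>\<^bsub>A\<^esub> \<longleftrightarrow> a' = a" if "a \<in> carrier A" "a' \<in> carrier A" for a a'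
    using that by (metis A.M.add.inv_closed A.M.l_neg A.M.minus_equality A.M.minus_minus A.M.a_comm)
  have iff': "\<ominus>\<^bsub>B\<^esub> a \<oplus>\<^bsub>B\<^esub> a' = \<zero>\<^bsub>B\<^esub> \<longleftrightarrow> a' = a" if "a \<in> carrier B" "a' \<in> carrier B" for a a'
    using that by (metis B.M.add.inv_closed B.M.l_neg B.M.minus_equality B.M.minus_minus B.M.a_comm)
  show "T2_map \<phi> ` carrier (T2_module X) =
      {y \<in> carrier (T2_module Y). T2_map \<psi> y = \<zero>\<^bsub>T2_module Z\<^esub>}"
    by (auto simp: iff iff' f_simps g'_simps image_iff)
  show "T2_map \<psi> ` carrier (T2_module Y) = carrier (T2_module Z)"
  proof
    show "T2_map \<psi> ` carrier (T2_module Y) \<subseteq> carrier (T2_module Z)"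
      by (auto simp: f_simps g'_simps)
    show "carrier (T2_module Z) \<subseteq> T2_map \<psi> ` carrier (T2_module Y)"
    proof clarsimp
      fix b a assume ba: "b \<in> carrier B" "a \<in> carrier A"
      \<comment> \<open>Columns list the target first: the pair with \<open>b\<close> lies in the
        sum of \<open>A\<close> and \<open>B\<close>, the other in the sum of \<open>A\<close> and
        \<open>B'\<close>. The sign of \<open>a\<close> cancels the -1 in the source component of
        \<open>\<psi>\<close>.\<close>
      then have "T2_map \<psi> ((\<zero>\<^bsub>A\<^esub>, b), (\<ominus>\<^bsub>A\<^esub> a, \<zero>\<^bsub>B'\<^esub>)) = (b, a)"
        by (simp add: f_simps g'_simps)
      then show "(b, a) \<in> T2_map \<psi> ` ((carrier A \<times> carrier B) \<times> carrier A \<times> carrier B')"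
        using ba by (intro image_eqI[of _ _ "((\<zero>\<^bsub>A\<^esub>, b), (\<ominus>\<^bsub>A\<^esub> a, \<zero>\<^bsub>B'\<^esub>))"]) auto
    qed
  qed
qed

text \<open>For a retraction \<open>(k1, k2)\<close> one has
  \<open>a = k2 (0, f a) + k2 (a, 0)\<close>, and the commuting square at \<open>(a, 0)\<close>
  gives \<open>k2 (a, 0) = g' (k1 (a, 0))\<close>. This writes the identity of \<open>A\<close> as a
  map through \<open>f\<close> plus a map through \<open>g'\<close>.\<close>

lemma phi_not_split: "\<not> mor_split_mono R X \<phi> Y"
proof
  assume "mor_split_mono R X \<phi> Y"
  then obtain k1 k2 where k: "(k1, k2) \<in> mor_hom R Y X"
    and split: "\<forall>a\<in>carrier A. k2 (a, f a) = a"
    by (auto simp: mor_split_mono_def)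
  have k1: "k1 \<in> lin_hom R (dsum A B') B'" and k2: "k2 \<in> lin_hom R (dsum A B) A"
    and comm: "\<And>a x. a \<in> carrier A \<Longrightarrow> x \<in> carrier B' \<Longrightarrow> g' (k1 (a, x)) = k2 (a, f (g' x))"
    using k by (auto simp: mor_hom_def)
  note k2_simps = lin_hom_rules[OF dsum_left_module[OF A B] A k2]
  have i1: "(\<lambda>a. (a, \<zero>\<^bsub>B'\<^esub>)) \<in> lin_hom R A (dsum A B')"
    and i2: "(\<lambda>b. (\<zero>\<^bsub>A\<^esub>, b)) \<in> lin_hom R B (dsum A B)"
    by (intro lin_hom_pair lin_hom_intros A B')+
  show False
  proof (rule almost_split_no_decomposition_of_identity[OF L R fg(1) B B'
        lin_hom_comp[OF i2 k2] lin_hom_comp[OF i1 k1]])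
    fix a assume a: "a \<in> carrier A"
    have "a = k2 (\<zero>\<^bsub>A\<^esub>, f a) \<oplus>\<^bsub>A\<^esub> k2 (a, \<zero>\<^bsub>B\<^esub>)"
      using split a k2_simps(2)[of "(\<zero>\<^bsub>A\<^esub>, f a)" "(a, \<zero>\<^bsub>B\<^esub>)"] by (simp add: f_simps)
    then have "a \<ominus>\<^bsub>A\<^esub> g' (k1 (a, \<zero>\<^bsub>B'\<^esub>)) = k2 (\<zero>\<^bsub>A\<^esub>, f a)"
      using a by (subst A.M.minus_eq_iff) (simp_all add: comm k2_simps f_simps g'_simps)
    then show "k2 (\<zero>\<^bsub>A\<^esub>, f a) = a \<ominus>\<^bsub>A\<^esub> g' (k1 (a, \<zero>\<^bsub>B'\<^esub>))" ..
  qed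
qed

text \<open>For a section \<open>(s1, s2)\<close> with \<open>s1 a = (c, x)\<close>, the splitting
  reads \<open>a = g' x - c\<close>, while the commuting square says that \<open>c\<close> is the
  first entry of \<open>s2 (f a)\<close>. Again the identity of \<open>A\<close> is a map through
  \<open>f\<close> plus a map through \<open>g'\<close>.\<close>

lemma psi_not_split: "\<not> mor_split_epi R Y \<psi> Z"
proof
  assume "mor_split_epi R Y \<psi> Z"
  then obtain s1 s2 where s: "(s1, s2) \<in> mor_hom R Z Y"
    and split: "\<forall>a\<in>carrier A. (case s1 a of (a, x) \<Rightarrow> \<ominus>\<^bsub>A\<^esub> a \<oplus>\<^bsub>A\<^esub> g' x) = a"
    by (auto simp: mor_split_epi_def)
  have s1: "s1 \<in> lin_hom R A (dsum A B')" and s2: "s2 \<in> lin_hom R B (dsum A B)"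
    and comm: "\<And>a. a \<in> carrier A \<Longrightarrow> map_prod (\<lambda>a. a) (f \<circ> g') (s1 a) = s2 (f a)"
    using s by (auto simp: mor_hom_def)
  have d: "(\<lambda>b. \<ominus>\<^bsub>A\<^esub> fst (s2 b)) \<in> lin_hom R B A"
    by (intro lin_hom_uminus A lin_hom_comp[OF s2 lin_hom_fst])
  show False
  proof (rule almost_split_no_decomposition_of_identity[OF L R fg(1) B B' d
        lin_hom_comp[OF s1 lin_hom_snd]])
    fix a assume a: "a \<in> carrier A"
    obtain c x where cx: "s1 a = (c, x)" "c \<in> carrier A" "x \<in> carrier B'"
      using lin_hom_closed[OF A dsum_left_module[OF A B'] s1 a] by auto
    have "a \<ominus>\<^bsub>A\<^esub> g' x = \<ominus>\<^bsub>A\<^esub> c"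
      using bspec[OF split a] a cx by (subst A.M.minus_eq_iff) (simp_all add: g'_simps)
    then show "\<ominus>\<^bsub>A\<^esub> fst (s2 (f a)) = a \<ominus>\<^bsub>A\<^esub> g' (snd (s1 a))"
      using cx by (simp flip: comm[OF a])
  qed
qed

lemma phi_left_almost_split:
  "left_almost_split (T2 R) (T2_module X) (T2_map \<phi>) (T2_module Y)"
proof (rule left_almost_split_T2_map[OF ring X Y phi_mor_hom phi_not_split])
  fix W :: "('r, (nat \<Rightarrow> 'r \<times> 'r \<times> 'r) set, (nat \<Rightarrow> 'r \<times> 'r \<times> 'r) set) mor_obj" and u
  assume W: "mor_object R W" and u: "u \<in> mor_hom R X W" and nu: "\<not> mor_split_mono R X u W"
  obtain u1 u2 where u_eq: "u = (u1, u2)" by fastforce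
  have fgW: "fg_module R (src W)" "fg_module R (tgt W)" and arr: "arr W \<in> lin_hom R (src W) (tgt W)"
    using W by (auto simp: mor_object_def)
  have W1: "left_module R (src W)" and W2: "left_module R (tgt W)"
    using fgW by (auto simp: fg_module_def)
  interpret W1: left_module R "src W" by (fact W1)
  interpret W2: left_module R "tgt W" by (fact W2)
  have u1: "u1 \<in> lin_hom R B' (src W)" and u2: "u2 \<in> lin_hom R A (tgt W)"
    and comm: "\<And>z. z \<in> carrier B' \<Longrightarrow> arr W (u1 z) = u2 (g' z)"
    using u by (auto simp: u_eq mor_hom_def)
  have "\<exists>p\<in>lin_hom R A (src W). \<exists>s\<in>lin_hom R B (tgt W).
    \<forall>a\<in>carrier A. s (f a) = u2 a \<oplus>\<^bsub>tgt W\<^esub> arr W (p a)"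
  proof (rule extend_from_target_almost_split[OF S S' fgW
        artin_algebra_fg_module_dcc_below[OF artin fgW(2)] arr u1 u2 comm])
    fix r1 r2
    assume r: "r1 \<in> lin_hom R (src W) B'" "r2 \<in> lin_hom R (tgt W) A"
      "\<forall>z\<in>carrier B'. r1 (u1 z) = z" "\<forall>a\<in>carrier A. r2 (u2 a) = a"
      "\<forall>z\<in>carrier (src W). g' (r1 z) = r2 (arr W z)"
    then have "mor_split_mono R X u W"
      unfolding mor_split_mono_def by (intro bexI[of _ "(r1, r2)"]) (auto simp: u_eq mor_hom_def)
    with nu show False ..
  qed
  then obtain p s where p: "p \<in> lin_hom R A (src W)" and s: "s \<in> lin_hom R B (tgt W)"
    and sf: "\<And>a. a \<in> carrier A \<Longrightarrow> s (f a) = u2 a \<oplus>\<^bsub>tgt W\<^esub> arr W (p a)" by blast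
  note simps = lin_hom_rules[OF W1 W2 arr] lin_hom_rules[OF B' W1 u1] lin_hom_rules[OF A W2 u2]
    lin_hom_rules[OF A W1 p] lin_hom_rules[OF B W2 s]
  \<comment> \<open>On the identity summand the extension is \<open>- p\<close> with target
    component \<open>- arr W p\<close>. Compatibility with \<open>\<phi>\<close> then forces
    \<open>u1 + p g'\<close> on \<open>B'\<close> and asks for \<open>s f = u2 + arr W p\<close> on
    \<open>B\<close>, which is how \<open>p\<close> and \<open>s\<close> were obtained.\<close>
  define v1 where "v1 = (\<lambda>(a, x). \<ominus>\<^bsub>src W\<^esub> p a \<oplus>\<^bsub>src W\<^esub> (u1 x \<oplus>\<^bsub>src W\<^esub> p (g' x)))"
  define v2 where "v2 = (\<lambda>(a, b). \<ominus>\<^bsub>tgt W\<^esub> arr W (p a) \<oplus>\<^bsub>tgt W\<^esub> s b)"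
  have "v1 \<in> lin_hom R (dsum A B') (src W)"
    unfolding v1_def by (intro lin_hom_copair lin_hom_uminus lin_hom_plus W1 p u1 lin_hom_comp[OF g' p])
  moreover have "v2 \<in> lin_hom R (dsum A B) (tgt W)"
    unfolding v2_def by (intro lin_hom_copair lin_hom_uminus W2 s lin_hom_comp[OF p arr])
  ultimately have "(v1, v2) \<in> mor_hom R Y W"
    by (auto simp: mor_hom_def v1_def v2_def simps f_simps g'_simps sf comm)
  moreover have "v1 (g' x, x) = u1 x" if "x \<in> carrier B'" for x
    using that by (simp add: v1_def simps g'_simps W1.M.neg_add_cancel)
  moreover have "v2 (a, f a) = u2 a" if "a \<in> carrier A" for a
    using that by (simp add: v2_def sf simps W2.M.neg_add_cancel)
  ultimately show "\<exists>v\<in>mor_hom R Y W. (\<forall>x\<in>carrier (src X). fst v (fst \<phi> x) = fst u x) \<and>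
      (\<forall>y\<in>carrier (tgt X). snd v (snd \<phi> y) = snd u y)"
    by (intro bexI[of _ "(v1, v2)"]) (simp_all add: u_eq)
qed

lemma psi_right_almost_split:
  "right_almost_split (T2 R) (T2_module Y) (T2_map \<psi>) (T2_module Z)"
proof (rule right_almost_split_T2_map[OF ring Y Z psi_mor_hom psi_not_split])
  fix W :: "('r, (nat \<Rightarrow> 'r \<times> 'r \<times> 'r) set, (nat \<Rightarrow> 'r \<times> 'r \<times> 'r) set) mor_obj" and u
  assume W: "mor_object R W" and u: "u \<in> mor_hom R W Z" and nu: "\<not> mor_split_epi R W u Z"
  obtain u1 u2 where u_eq: "u = (u1, u2)" by fastforce
  have fgW: "fg_module R (src W)" "fg_module R (tgt W)" and arr: "arr W \<in> lin_hom R (src W) (tgt W)"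
    using W by (auto simp: mor_object_def)
  have W1: "left_module R (src W)" and W2: "left_module R (tgt W)"
    using fgW by (auto simp: fg_module_def)
  have u1: "u1 \<in> lin_hom R (src W) A" and u2: "u2 \<in> lin_hom R (tgt W) B"
    and comm: "\<And>z. z \<in> carrier (src W) \<Longrightarrow> f (u1 z) = u2 (arr W z)"
    using u by (auto simp: u_eq mor_hom_def)
  have "\<exists>r\<in>lin_hom R (tgt W) A. \<exists>q\<in>lin_hom R (src W) B'.
    \<forall>z\<in>carrier (src W). g' (q z) = u1 z \<oplus>\<^bsub>A\<^esub> r (arr W z)"
  proof (rule lift_through_source_almost_split[OF S S' fgW
        artin_algebra_fg_module_dcc_below[OF artin fgW(1)] arr u1 u2 comm])
    fix s1 s2
    assume s: "s1 \<in> lin_hom R A (src W)" "s2 \<in> lin_hom R B (tgt W)"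
      "\<forall>a\<in>carrier A. u1 (s1 a) = a" "\<forall>b\<in>carrier B. u2 (s2 b) = b"
      "\<forall>a\<in>carrier A. arr W (s1 a) = s2 (f a)"
    then have "mor_split_epi R W u Z"
      unfolding mor_split_epi_def by (intro bexI[of _ "(s1, s2)"]) (auto simp: u_eq mor_hom_def)
    with nu show False ..
  qed
  then obtain r q where r: "r \<in> lin_hom R (tgt W) A" and q: "q \<in> lin_hom R (src W) B'"
    and g'q: "\<And>z. z \<in> carrier (src W) \<Longrightarrow> g' (q z) = u1 z \<oplus>\<^bsub>A\<^esub> r (arr W z)" by blast
  note simps = lin_hom_rules[OF W1 W2 arr] lin_hom_rules[OF W1 A u1] lin_hom_rules[OF W2 B u2]
    lin_hom_rules[OF W2 A r] lin_hom_rules[OF W1 B' q]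
  \<comment> \<open>The component into the identity summand is given by \<open>r\<close> and the one
    into the composite by \<open>q\<close> and \<open>u2 + f r\<close>; its square commutes because
    \<open>f g' q = f u1 + f r (arr W) = (u2 + f r) (arr W)\<close>.\<close>
  define v1 where "v1 z = (r (arr W z), q z)" for z
  define v2 where "v2 w = (r w, u2 w \<oplus>\<^bsub>B\<^esub> f (r w))" for w
  have "v1 \<in> lin_hom R (src W) (dsum A B')"
    unfolding v1_def by (intro lin_hom_pair q lin_hom_comp[OF arr r])
  moreover have "v2 \<in> lin_hom R (tgt W) (dsum A B)"
    unfolding v2_def by (intro lin_hom_pair lin_hom_plus B u2 r lin_hom_comp[OF r f])
  ultimately have "(v1, v2) \<in> mor_hom R W Y"
    by (auto simp: mor_hom_def v1_def v2_def simps f_simps g'q comm)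
  moreover have "\<ominus>\<^bsub>A\<^esub> r (arr W z) \<oplus>\<^bsub>A\<^esub> g' (q z) = u1 z" if "z \<in> carrier (src W)" for z
    using that by (simp add: g'q simps A.M.neg_add_cancel)
  moreover have "\<ominus>\<^bsub>B\<^esub> f (r w) \<oplus>\<^bsub>B\<^esub> (u2 w \<oplus>\<^bsub>B\<^esub> f (r w)) = u2 w" if "w \<in> carrier (tgt W)" for w
    using that by (simp add: simps f_simps B.M.neg_add_cancel)
  ultimately show "\<exists>v\<in>mor_hom R W Y. (\<forall>x\<in>carrier (src W). fst \<psi> (fst v x) = fst u x) \<and>
      (\<forall>y\<in>carrier (tgt W). snd \<psi> (snd v y) = snd u y)"
    by (intro bexI[of _ "(v1, v2)"]) (simp_all add: u_eq v1_def v2_def)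
qed

lemma composite_sequence_almost_split: "mor_almost_split R X \<phi> Y \<psi> Z"
  unfolding mor_almost_split_def almost_split_def
  by (intro conjI X Y Z phi_mor_hom psi_mor_hom sequence_short_exact
      phi_left_almost_split psi_right_almost_split T2_module_fg_module)

end

theorem proposition3p2:
  fixes K :: "('k, 'd) ring_scheme" and \<eta> :: "'k \<Rightarrow> 'r" and \<Lambda> :: "('r, 'e) ring_scheme"
    and A :: "('r, 'a) module" and B :: "('r, 'b) module" and C :: "('r, 'c) module"
    and A' :: "('r, 'p) module" and B' :: "('r, 'q) module"
    and f :: "'a \<Rightarrow> 'b" and g :: "'b \<Rightarrow> 'c" and f' :: "'p \<Rightarrow> 'q" and g' :: "'q \<Rightarrow> 'a"
  assumes "artin_algebra K \<eta> \<Lambda>"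
    and "almost_split \<Lambda> A f B g C"
    and "almost_split \<Lambda> A' f' B' g' A"
  shows "mor_almost_split \<Lambda>
      \<lparr>src = B', tgt = A, arr = g'\<rparr>
      (\<lambda>x. (g' x, x), \<lambda>a. (a, f a))
      (mor_dsum \<lparr>src = A, tgt = A, arr = (\<lambda>a. a)\<rparr> \<lparr>src = B', tgt = B, arr = f \<circ> g'\<rparr>)
      (\<lambda>(a, x). \<ominus>\<^bsub>A\<^esub> a \<oplus>\<^bsub>A\<^esub> g' x, \<lambda>(a, b). \<ominus>\<^bsub>B\<^esub> f a \<oplus>\<^bsub>B\<^esub> b)
      \<lparr>src = A, tgt = B, arr = f\<rparr>
    \<and> mor_indecomposable \<Lambda> \<lparr>src = B', tgt = B, arr = f \<circ> g'\<rparr>"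
proof -
  interpret two_almost_split_sequences K \<eta> \<Lambda> A B C A' B' f g f' g'
    by unfold_locales fact+
  show ?thesis
    using composite_sequence_almost_split composite_indecomposable[OF assms(2,3)] by blast
qed

end
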